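(* Let $n\geq2$. Up to isometries of $\mathbb{L}^{n+1}$, any connected, timelike, $SO(n)$-invariant translating soliton in $\mathbb{L}^{n+1}$ is an open subset of either an Ogival Paraboloid, or a Timelike Calyx, or a Spindle.
   Context: $\mathbb{L}^{n+1}=\mathbb{R}^n\times\mathbb{R}$ has the metric $\sum_{i=1}^n dx_i^2-dt^2$, with $t=x_{n+1}$. A translating soliton in $\mathbb{L}^{n+1}$ is a hypersurface with non-degenerate induced metric whose mean curvature vector (the unnormalized trace of the second fundamental form with respect to the induced metric) equals $\partial_t^{\perp}$, the component of $\partial_t$ normal to the hypersurface. It is timelike if its unit normal $\nu$ satisfies $\langle\nu,\nu\rangle=+1$. It is $SO(n)$-invariant if it is invariant under the action $\sigma\cdot(x,t)=(\sigma x,t)$, $\sigma\in SO(n)$, $x\in\mathbb{R}^n$. Write $\|x\|$ for the Euclidean norm on $\mathbb{R}^n$. Consider, for $s>0$, the equation $$(\ast)\qquad w'(s)=\big(1-w(s)^2\big)\Big(1-\frac{n-1}{s}w(s)\Big).$$ Given a solution $w$ of $(\ast)$ on $(0,s_1)$, $0<s_1\le+\infty$, and a primitive $f=\int w$, consider the hypersurface $\{(x,f(\|x\|))\}$, with $f$ extended continuously to $s=0$ when possible. Ogival Paraboloid: the hypersurface $\{(x,f(\|x\|)):x\in\mathbb{R}^n\}$ with $f=\int\mathbf{w}$, where $\mathbf{w}:(0,+\infty)\to(1,+\infty)$ is the unique strictly increasing solution of $(\ast)$ with values in $(1,+\infty)$ that is defined on all of $(0,+\infty)$; it satisfies $\mathbf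 w(s)>s/(n-1)$ for all $s>0$ and is asymptotic to the line $x=s/(n-1)$ at infinity. Timelike Calyx: a hypersurface $\{(x,f(\|x\|)):x\in\mathbb{R}^n\}$ with $f=\int w$, where $w:(0,+\infty)\to(1,+\infty)$ is a solution of $(\ast)$ having exactly one critical point; it satisfies $\lim_{s\to0}w(s)=\lim_{s\to+\infty}w(s)=1$. Spindle: for some $s_1>0$, let $w_-:(0,s_1)\to(-\infty,-1)$ and $w_+:(0,s_1)\to(1,+\infty)$ be the solutions of $(\ast)$ with $\lim_{s\to s_1}w_-(s)=-\infty$ and $\lim_{s\to s_1}w_+(s)=+\infty$, and let $f_\pm=\int w_\pm$ be primitives with the same (finite) limit at $s_1$. The Spindle is the union of the graphs $\{(x,f_{+}(\|x\|))\}$ and $\{(x,f_-(\|x\|))\}$ over $0\le\|x\|<s_1$ together with their common boundary over $\|x\|=s_1$. It is a topological sphere, smooth except at its two lightlike-conic singular points on the rotation axis. *)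

theory Defs
  imports "HOL-Analysis.Analysis"
begin

section \<open>Smooth maps\<close>

primrec Ck_on :: "nat \<Rightarrow> 'a::euclidean_space set \<Rightarrow> ('a \<Rightarrow> 'b::euclidean_space) \<Rightarrow> bool" where
  "Ck_on 0 S f \<longleftrightarrow> continuous_on S f"
| "Ck_on (Suc k) S f \<longleftrightarrow>
     (\<forall>x\<in>S. f differentiable (at x)) \<and> (\<forall>v. Ck_on k S (\<lambda>x. frechet_derivative f (at x) v))"

definition smooth_on :: "'a::euclidean_space set \<Rightarrow> ('a \<Rightarrow> 'b::euclidean_space) \<Rightarrow> bool" where
  "smooth_on S f \<longleftrightarrow> open S \<and> (\<forall>k. Ck_on k S f)"


section \<open>Minkowski space\<close>

text \<open>The space is \<open>(real^'n) \<times> real\<close>, with \<open>n = CARD('n)\<close>. Its topology and its derivatives are the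
  usual Euclidean ones; only the metric is replaced by the form \<open>lor\<close>.\<close>

type_synonym 'n minkowski = "(real^'n) \<times> real"

definition lor :: "('n::finite) minkowski \<Rightarrow> 'n minkowski \<Rightarrow> real" where
  "lor p q = fst p \<bullet> fst q - snd p * snd q"

definition e_t :: "('n::finite) minkowski" where
  "e_t = (0, 1)"

definition lor_isometry :: "(('n::finite) minkowski \<Rightarrow> 'n minkowski) \<Rightarrow> bool" where
  "lor_isometry \<Phi> \<longleftrightarrow> bij \<Phi> \<and> smooth_on UNIV \<Phi> \<and> smooth_on UNIV (inv \<Phi>) \<and>
     (\<forall>p v w. lor (frechet_derivative \<Phi> (at p) v) (frechet_derivative \<Phi> (at p) w) = lor v w)"

text \<open>The component of \<open>v\<close> that is \<open>lor\<close>-orthogonal to the subspace \<open>T\<close>. It is well defined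
  whenever \<open>lor\<close> is non-degenerate on \<open>T\<close>.\<close>

definition normal_part :: "('n::finite) minkowski set \<Rightarrow> 'n minkowski \<Rightarrow> 'n minkowski" where
  "normal_part T v = (THE w. v - w \<in> T \<and> (\<forall>\<tau>\<in>T. lor w \<tau> = 0))"


section \<open>Hypersurfaces\<close>

text \<open>Hypersurfaces are smooth embedded submanifolds of codimension one, given as sets. All
  pointwise geometric conditions below are independent of the choice of local parametrization.\<close>

definition local_param ::
  "('n::finite) minkowski set \<Rightarrow> (real^'n) set \<Rightarrow> (real^'n \<Rightarrow> 'n minkowski) \<Rightarrow> bool" where
  "local_param M V X \<longleftrightarrow>
     open V \<and> smooth_on V X \<and> (\<forall>u\<in>V. inj (frechet_derivative X (at u))) \<and>
     openin (top_of_set M) (X ` V) \<and> (\<exists>g. homeomorphism V (X ` V) X g)"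

definition hypersurface :: "('n::finite) minkowski set \<Rightarrow> bool" where
  "hypersurface M \<longleftrightarrow> (\<forall>p\<in>M. \<exists>V X. local_param M V X \<and> p \<in> X ` V)"

definition tangent :: "(real^'n \<Rightarrow> ('n::finite) minkowski) \<Rightarrow> real^'n \<Rightarrow> 'n minkowski set" where
  "tangent X u = range (frechet_derivative X (at u))"

definition pderiv_at :: "'n \<Rightarrow> (real^'n \<Rightarrow> ('n::finite) minkowski) \<Rightarrow> real^'n \<Rightarrow> 'n minkowski" where
  "pderiv_at i X u = frechet_derivative X (at u) (axis i 1)"

definition first_ff :: "(real^'n \<Rightarrow> ('n::finite) minkowski) \<Rightarrow> real^'n \<Rightarrow> real^'n^'n" where
  "first_ff X u = (\<chi> i j. lor (pderiv_at i X u) (pderiv_at j X u))"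

text \<open>The ambient connection is flat, so the vector-valued second fundamental form is the normal
  part of the second partial derivatives of the parametrization.\<close>

definition second_ff ::
  "(real^'n \<Rightarrow> ('n::finite) minkowski) \<Rightarrow> real^'n \<Rightarrow> 'n \<Rightarrow> 'n \<Rightarrow> 'n minkowski" where
  "second_ff X u i j = normal_part (tangent X u) (pderiv_at i (pderiv_at j X) u)"

definition mean_curvature_vector ::
  "(real^'n \<Rightarrow> ('n::finite) minkowski) \<Rightarrow> real^'n \<Rightarrow> 'n minkowski" where
  "mean_curvature_vector X u =
     (\<Sum>i\<in>UNIV. \<Sum>j\<in>UNIV. (matrix_inv (first_ff X u) $ i $ j) *\<^sub>R second_ff X u i j)"

definition translating_soliton :: "('n::finite) minkowski set \<Rightarrow> bool" where
  "translating_soliton M \<longleftrightarrow> hypersurface M \<and>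
     (\<forall>V X. local_param M V X \<longrightarrow>
        (\<forall>u\<in>V. invertible (first_ff X u) \<and>
               mean_curvature_vector X u = normal_part (tangent X u) e_t))"

definition timelike :: "('n::finite) minkowski set \<Rightarrow> bool" where
  "timelike M \<longleftrightarrow>
     (\<forall>V X. local_param M V X \<longrightarrow>
        (\<forall>u\<in>V. \<exists>\<nu>. (\<forall>\<tau>\<in>tangent X u. lor \<nu> \<tau> = 0) \<and> lor \<nu> \<nu> = 1))"

definition SO_invariant :: "('n::finite) minkowski set \<Rightarrow> bool" where
  "SO_invariant M \<longleftrightarrow>
     (\<forall>\<sigma> :: real^'n^'n. rotation_matrix \<sigma> \<longrightarrow> (\<lambda>(x, t). (\<sigma> *v x, t)) ` M = M)"


section \<open>The rotational examples\<close>

definition solves_ode :: "nat \<Rightarrow> (real \<Rightarrow> real) \<Rightarrow> real set \<Rightarrow> bool" where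
  "solves_ode n w I \<longleftrightarrow>
     (\<forall>s\<in>I. (w has_real_derivative (1 - (w s)\<^sup>2) * (1 - (real n - 1) / s * w s)) (at s))"

text \<open>In the next three definitions, continuity of \<open>f\<close> on an interval closed at \<open>0\<close> expresses that
  the primitive is extended continuously to \<open>0\<close>.\<close>

definition ogival_paraboloid :: "('n::finite) minkowski set \<Rightarrow> bool" where
  "ogival_paraboloid S \<longleftrightarrow> (\<exists>w f.
     solves_ode CARD('n) w {0<..} \<and> (\<forall>s>0. w s > 1) \<and> strict_mono_on {0<..} w \<and>
     continuous_on {0..} f \<and> (\<forall>s>0. (f has_real_derivative w s) (at s)) \<and>
     S = {(x, f (norm x)) | x. True})"

definition timelike_calyx :: "('n::finite) minkowski set \<Rightarrow> bool" where
  "timelike_calyx S \<longleftrightarrow> (\<exists>w f.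
     solves_ode CARD('n) w {0<..} \<and> (\<forall>s>0. w s > 1) \<and>
     (\<exists>!s. s > 0 \<and> (w has_real_derivative 0) (at s)) \<and>
     continuous_on {0..} f \<and> (\<forall>s>0. (f has_real_derivative w s) (at s)) \<and>
     S = {(x, f (norm x)) | x. True})"

definition spindle :: "('n::finite) minkowski set \<Rightarrow> bool" where
  "spindle S \<longleftrightarrow> (\<exists>s1>0. \<exists>wp wm fp fm L.
     solves_ode CARD('n) wp {0<..<s1} \<and> (\<forall>s\<in>{0<..<s1}. wp s > 1) \<and>
     filterlim wp at_top (at_left s1) \<and>
     solves_ode CARD('n) wm {0<..<s1} \<and> (\<forall>s\<in>{0<..<s1}. wm s < -1) \<and>
     filterlim wm at_bot (at_left s1) \<and>
     continuous_on {0..<s1} fp \<and> (\<forall>s\<in>{0<..<s1}. (fp has_real_derivative wp s) (at s)) \<and>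
     continuous_on {0..<s1} fm \<and> (\<forall>s\<in>{0<..<s1}. (fm has_real_derivative wm s) (at s)) \<and>
     (fp \<longlongrightarrow> L) (at_left s1) \<and> (fm \<longlongrightarrow> L) (at_left s1) \<and>
     S = {(x, fp (norm x)) | x. norm x < s1} \<union> {(x, fm (norm x)) | x. norm x < s1}
         \<union> {(x, L) | x. norm x = s1})"

end

theory Submission
  imports Defs
begin

text \<open>Write \<open>k = n - 1\<close>. A rotationally invariant set is determined by its profile, the set of pairs
\<open>(norm x, t)\<close>. On the axis a rotationally invariant tangent hyperplane is horizontal, so its normal
is \<open>e_t\<close>, which is not spacelike: a timelike soliton avoids the axis (\<open>avoids_axis\<close>). Off the axis
the orbits force the normal to be radial (\<open>normal_radial\<close>), and since it is spacelike the profile is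
a timelike curve. It is therefore locally the graph \<open>s = g t\<close> of a radius over \<^emph>\<open>time\<close> with
\<open>\<bar>g'\<bar> < 1\<close> (\<open>local_graph\<close>), and the soliton condition turns into
\[ g'' = (1 - g'^2)(g' - k/g), \]
see \<open>soliton_profile_equation\<close>. For \<open>w = 1/g'\<close> as a function of the radius this is the equation that
defines the rotational examples. The graph over time is the better description, because it does not
break down where \<open>g' = 0\<close>, which is where the two halves of a spindle meet.

With \<open>p = g'\<close> the equation is a planar autonomous system. A maximal solution can stop at a finite
time only by running into the axis (\<open>exists_maximal_solution\<close>). Two curves organise the phase
portrait: \<open>p = 0\<close> is crossed only downwards and \<open>g p = k\<close> only upwards (\<open>p_nonpos_later\<close>,
\<open>gp_ge_later\<close>). A solution on which \<open>p\<close> is somewhere nonpositive rises from the axis, has exactly one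
zero of \<open>p\<close> and falls back to the axis: a spindle. If \<open>p\<close> stays positive, the solution rises from the
axis and its radius takes every positive value; it is an ogival paraboloid if \<open>g p < k\<close> throughout,
and a timelike calyx if \<open>g p = k\<close> happens, which then happens exactly once.

Finally, choose the maximal solution that is tangent to the profile of \<open>M\<close> at one point. By uniqueness for
the differential equation, the set of points of \<open>M\<close> near which \<open>M\<close> coincides with the rotated graph of
this solution is open and closed in \<open>M\<close> (\<open>matches_everywhere\<close>), hence is all of \<open>M\<close>. The isometry can be taken to be the
identity, because primitives are determined only up to a constant and this constant is the
translation along the axis.\<close>

section \<open>Ordinary differential equations with Lipschitz right-hand side\<close>

lemma exists_global_antiderivative:
  fixes h :: "real \<Rightarrow> 'a::banach"
  assumes "continuous_on UNIV h"
  shows "\<exists>H. H 0 = 0 \<and> (\<forall>x. (H has_vector_derivative h x) (at x))"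
proof -
  let ?H = "\<lambda>x. integral {0..x} h - integral {x..0} h"
  have "(?H has_vector_derivative h x) (at x)" for x :: real
  proof -
  define N where "N = \<bar>x\<bar> + 1"
  have int: "h integrable_on {a..b}" for a b
    using assms by (intro integrable_continuous_real) (auto intro: continuous_on_subset)
  have eq: "?H y = integral {-N..y} h - integral {-N..0} h" if "y \<in> {-N<..<N}" for y
  proof (cases "y \<ge> 0")
    case True
    have "integral {-N..0} h + integral {0..y} h = integral {-N..y} h"
      using True that by (intro Henstock_Kurzweil_Integration.integral_combine int) auto
    moreover have "integral {y..0} h = 0" using True by (cases "y = 0") auto
    ultimately show ?thesis by (simp add: algebra_simps)
  next
    case False
    have "integral {-N..y} h + integral {y..0} h = integral {-N..0} h"
      using False that by (intro Henstock_Kurzweil_Integration.integral_combine int) auto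
    moreover have "integral {0..y} h = 0" using False by auto
    ultimately show ?thesis by (simp add: algebra_simps)
  qed
  have xN: "x \<in> {-N<..<N}" unfolding N_def by auto
  have "((\<lambda>y. integral {-N..y} h) has_vector_derivative h x) (at x within {-N..N})"
    using xN by (intro integral_has_vector_derivative continuous_on_subset[OF assms]) auto
  hence "((\<lambda>y. integral {-N..y} h) has_vector_derivative h x) (at x)"
    using xN at_within_Icc_at[of "-N" x N] by simp
  hence "((\<lambda>y. integral {-N..y} h - integral {-N..0} h) has_vector_derivative h x) (at x)"
    by (auto intro!: derivative_eq_intros)
  thus "(?H has_vector_derivative h x) (at x)"
    by (rule has_vector_derivative_transform_within_open[OF _ open_greaterThanLessThan xN]) (rule eq[symmetric])
  qed
  moreover have "?H 0 = 0" by simp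
  ultimately show ?thesis by (intro exI[of _ ?H] conjI allI)
qed

text \<open>Integration gains the factor \<open>1 / K\<close> against the weight \<open>exp (K * \<bar>x\<bar>)\<close>. This gain makes the Picard
operator below a contraction.\<close>

lemma antiderivative_exp_bound:
  fixes H :: "real \<Rightarrow> 'a::real_normed_vector"
  assumes der: "\<And>x. (H has_vector_derivative h x) (at x)" and H0: "H 0 = 0"
    and K: "K > 0" and bound: "\<And>x. norm (h x) \<le> B * exp (K * \<bar>x\<bar>)"
  shows "norm (H x) \<le> B / K * exp (K * \<bar>x\<bar>)"
proof -
  have B: "B \<ge> 0" using order_trans[OF norm_ge_zero bound[of 0]] by simp
  have *: "norm (G x) \<le> B / K * exp (K * x)"
    if G: "\<And>x. (G has_vector_derivative g x) (at x)" "G 0 = 0"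
      and b: "\<And>x. norm (g x) \<le> B * exp (K * \<bar>x\<bar>)" and x: "x > 0"
    for G g :: "real \<Rightarrow> 'a" and x
  proof -
    have "norm (G x - G 0) \<le> B / K * exp (K * x) - B / K * exp (K * 0)"
    proof (rule differentiable_bound_general[where f' = g and \<phi>' = "\<lambda>x. B * exp (K * x)"])
      show "continuous_on {0..x} G"
        by (rule continuous_at_imp_continuous_on) (rule ballI, rule has_vector_derivative_continuous, rule G(1))
      show "((\<lambda>x. B / K * exp (K * x)) has_vector_derivative B * exp (K * y)) (at y)" for y
        unfolding has_real_derivative_iff_has_vector_derivative[symmetric]
        using K by (auto intro!: derivative_eq_intros)
      show "norm (g y) \<le> B * exp (K * y)" if "0 < y" for y using b[of y] that by simp
      show "continuous_on {0..x} (\<lambda>x. B / K * exp (K * x))" by (intro continuous_intros)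
      show "(G has_vector_derivative g y) (at y)" for y by (rule G(1))
    qed (rule x)
    also have "\<dots> \<le> B / K * exp (K * x)" using B K by simp
    finally show ?thesis by (simp add: G(2))
  qed
  consider "x > 0" | "x = 0" | "x < 0" by linarith
  thus ?thesis
  proof cases
    case 1 thus ?thesis using *[OF der H0 bound, of x] by simp
  next
    case 2 thus ?thesis using H0 B K by simp
  next
    case 3
    have "((\<lambda>x. H (- x)) has_vector_derivative - h (- x)) (at x)" for x
    proof -
      have "((H \<circ> uminus) has_vector_derivative (-1) *\<^sub>R h (- x)) (at x)"
        by (rule vector_diff_chain_at[OF _ der]) (auto intro!: derivative_eq_intros)
      thus ?thesis by (simp add: o_def)
    qed
    hence "norm (H (- (- x))) \<le> B / K * exp (K * - x)"
    proof (rule *)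
      show "norm (- h (- x)) \<le> B * exp (K * \<bar>x\<bar>)" for x using bound[of "-x"] by simp
    qed (use 3 H0 in simp_all)
    thus ?thesis using 3 by simp
  qed
qed

text \<open>Put \<open>u s = u0 + exp (K * \<bar>s\<bar>) *\<^sub>R v s\<close> and look for a bounded continuous \<open>v\<close>. In terms of \<open>v\<close> the
integral operator has Lipschitz constant \<open>L / K\<close>, which is \<open>1 / 2\<close> for \<open>K = 2 * L\<close>, so one application of
the Banach fixed point theorem yields a solution on the whole line at once.\<close>

theorem picard_global:
  fixes F :: "'a::banach \<Rightarrow> 'a"
  assumes L: "L > 0" and lip: "\<And>x y. norm (F x - F y) \<le> L * norm (x - y)"
  shows "\<exists>u. u 0 = u0 \<and> (\<forall>x. (u has_vector_derivative F (u x)) (at x))"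
proof -
  define K where "K = 2 * L"
  have K: "K > 0" using L by (simp add: K_def)
  have contF: "continuous_on UNIV F"
    by (rule lipschitz_on_continuous_on[of L])
       (use L lip in \<open>auto simp: lipschitz_on_def dist_norm\<close>)
  define h where "h v s = F (u0 + exp (K * \<bar>s\<bar>) *\<^sub>R apply_bcontfun v s)" for v s
  define P where "P v = (SOME H. H 0 = 0 \<and> (\<forall>x. (H has_vector_derivative h v x) (at x)))" for v
  have conth: "continuous_on UNIV (h v)" for v
    unfolding h_def
    by (rule continuous_on_compose2[OF contF]) (auto intro!: continuous_intros)
  have P: "P v 0 = 0" "(P v has_vector_derivative h v x) (at x)" for v x
    using someI_ex[OF exists_global_antiderivative[OF conth[of v]]] unfolding P_def[of v] by auto
  define T where "T v = Bcontfun (\<lambda>s. exp (- K * \<bar>s\<bar>) *\<^sub>R P v s)" for v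
  have one: "1 \<le> exp (K * \<bar>s\<bar>)" for s using K by simp
  have hb: "norm (h v s) \<le> (norm (F u0) + L * norm v) * exp (K * \<bar>s\<bar>)" for v s
  proof -
    have "norm (h v s) \<le> norm (F u0) + norm (h v s - F u0)" by norm
    also have "norm (h v s - F u0) \<le> L * norm (exp (K * \<bar>s\<bar>) *\<^sub>R apply_bcontfun v s)"
      unfolding h_def using lip[of _ u0] by (metis add_diff_cancel_left')
    also have "\<dots> \<le> L * (norm v * exp (K * \<bar>s\<bar>))"
      using L norm_bounded[of v s] by (simp add: mult.commute)
    also have "norm (F u0) \<le> norm (F u0) * exp (K * \<bar>s\<bar>)" using mult_left_mono[OF one[of s] norm_ge_zero[of "F u0"]] by simp
    finally show ?thesis by (simp add: algebra_simps)
  qed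
  have ee: "exp (- K * \<bar>s\<bar>) * exp (K * \<bar>s\<bar>) = 1" for s by (simp flip: exp_add)
  have T: "apply_bcontfun (T v) s = exp (- K * \<bar>s\<bar>) *\<^sub>R P v s" for v s
  proof -
    have "(\<lambda>s. exp (- K * \<bar>s\<bar>) *\<^sub>R P v s) \<in> bcontfun"
    proof (rule bcontfun_normI)
      have "continuous_on UNIV (P v)"
        by (rule continuous_at_imp_continuous_on) (rule ballI, rule has_vector_derivative_continuous, rule P(2))
      thus "continuous_on UNIV (\<lambda>s. exp (- K * \<bar>s\<bar>) *\<^sub>R P v s)"
        by (intro continuous_intros)
      fix s
      have "norm (P v s) \<le> (norm (F u0) + L * norm v) / K * exp (K * \<bar>s\<bar>)"
        by (rule antiderivative_exp_bound[OF P(2) P(1) K hb])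
      hence "exp (- K * \<bar>s\<bar>) * norm (P v s) \<le> exp (- K * \<bar>s\<bar>) * ((norm (F u0) + L * norm v) / K * exp (K * \<bar>s\<bar>))"
        by (intro mult_left_mono) auto
      also have "\<dots> = (norm (F u0) + L * norm v) / K" using ee[of s] by (simp add: algebra_simps)
      finally show "norm (exp (- K * \<bar>s\<bar>) *\<^sub>R P v s) \<le> (norm (F u0) + L * norm v) / K" by simp
    qed
    thus ?thesis unfolding T_def by (simp add: Bcontfun_inverse)
  qed
  have "dist (T v) (T w) \<le> 1 / 2 * dist v w" for v w
  proof (rule dist_bound)
    fix s
    have d: "((\<lambda>x. P v x - P w x) has_vector_derivative h v x - h w x) (at x)" for x
      by (intro derivative_intros P)
    have b: "norm (h v x - h w x) \<le> (L * dist v w) * exp (K * \<bar>x\<bar>)" for x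
    proof -
      have "norm (h v x - h w x) \<le> L * norm (exp (K * \<bar>x\<bar>) *\<^sub>R (apply_bcontfun v x - apply_bcontfun w x))"
        unfolding h_def using lip by (metis add_diff_cancel_left scaleR_diff_right)
      also have "\<dots> = L * (exp (K * \<bar>x\<bar>) * dist (apply_bcontfun v x) (apply_bcontfun w x))"
        by (simp add: dist_norm)
      also have "\<dots> \<le> L * (exp (K * \<bar>x\<bar>) * dist v w)"
        using L dist_bounded[of v x w] by simp
      finally show ?thesis by (simp add: algebra_simps)
    qed
    have "norm (P v s - P w s) \<le> L * dist v w / K * exp (K * \<bar>s\<bar>)"
      using antiderivative_exp_bound[OF d _ K b, of s] P by simp
    hence "exp (- K * \<bar>s\<bar>) * norm (P v s - P w s) \<le> exp (- K * \<bar>s\<bar>) * (L * dist v w / K * exp (K * \<bar>s\<bar>))"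
      by (intro mult_left_mono) auto
    also have "\<dots> = L * dist v w / K" using ee[of s] by (simp add: algebra_simps)
    also have "\<dots> = 1 / 2 * dist v w" using L by (simp add: K_def)
    finally show "dist (apply_bcontfun (T v) s) (apply_bcontfun (T w) s) \<le> 1 / 2 * dist v w"
      by (simp add: T dist_norm flip: scaleR_diff_right)
  qed
  from banach_fix_type[of "1/2" T] this obtain v where v: "T v = v" by auto
  define u where "u s = u0 + P v s" for s
  have "h v s = F (u s)" for s
  proof -
    have "exp (K * \<bar>s\<bar>) *\<^sub>R apply_bcontfun v s = exp (K * \<bar>s\<bar>) *\<^sub>R apply_bcontfun (T v) s" by (simp add: v)
    also have "\<dots> = P v s" using ee[of s] by (simp add: T mult.commute)
    finally show ?thesis by (simp add: h_def u_def)
  qed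
  hence "(u has_vector_derivative F (u x)) (at x)" for x
    using P(2)[of v x] unfolding u_def by (auto intro!: derivative_eq_intros)
  moreover have "u 0 = u0" by (simp add: u_def P)
  ultimately show ?thesis by blast
qed

text \<open>The logarithmic derivative of \<open>w \<bullet> w\<close> is at most \<open>2 * L\<close> in absolute value, so \<open>w\<close> cannot leave \<open>0\<close>
forwards or backwards in time. Applied to a difference of two solutions this is uniqueness.\<close>

lemma linear_growth_zero:
  fixes w :: "real \<Rightarrow> 'a::real_inner"
  assumes S: "is_interval S"
    and der: "\<And>t. t \<in> S \<Longrightarrow> (w has_vector_derivative w' t) (at t)"
    and bound: "\<And>t. t \<in> S \<Longrightarrow> norm (w' t) \<le> L * norm (w t)"
    and t0: "t0 \<in> S" "w t0 = 0" and t: "t \<in> S"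
  shows "w t = 0"
proof -
  define \<phi> where "\<phi> t = w t \<bullet> w t" for t
  have d\<phi>: "(\<phi> has_real_derivative 2 * (w t \<bullet> w' t)) (at t)" if "t \<in> S" for t
  proof -
    have "((\<lambda>t. w t \<bullet> w t) has_vector_derivative (w t \<bullet> w' t + w' t \<bullet> w t)) (at t)"
      using der[OF that] unfolding has_vector_derivative_def
      by (auto intro!: derivative_eq_intros simp: algebra_simps)
    thus ?thesis
      unfolding \<phi>_def[abs_def] has_real_derivative_iff_has_vector_derivative by (simp add: inner_commute)
  qed
  have b: "\<bar>2 * (w t \<bullet> w' t)\<bar> \<le> 2 * L * \<phi> t" if "t \<in> S" for t
  proof -
    have "\<bar>w t \<bullet> w' t\<bar> \<le> norm (w t) * norm (w' t)" by (rule Cauchy_Schwarz_ineq2)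
    also have "\<dots> \<le> norm (w t) * (L * norm (w t))" using bound[OF that] by (intro mult_left_mono) auto
    also have "\<dots> = L * \<phi> t" by (simp add: \<phi>_def dot_square_norm power2_eq_square)
    finally show ?thesis by simp
  qed
  have in_S: "y \<in> S" if "a \<in> S" "b \<in> S" "a \<le> y" "y \<le> b" for a b y
    using S that by (meson is_interval_1)
  have "\<phi> t \<le> 0"
  proof (cases "t0 \<le> t")
    case True
    have "\<phi> t * exp (- 2 * L * t) \<le> \<phi> t0 * exp (- 2 * L * t0)"
    proof (rule DERIV_nonpos_imp_nonincreasing[OF True])
      fix y assume "t0 \<le> y" "y \<le> t"
      hence y: "y \<in> S" using in_S t0 t by blast
      have "((\<lambda>t. \<phi> t * exp (- 2 * L * t)) has_real_derivative
          (2 * (w y \<bullet> w' y) - 2 * L * \<phi> y) * exp (- 2 * L * y)) (at y)"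
        by (rule derivative_eq_intros d\<phi>[OF y] refl | simp add: algebra_simps)+
      moreover have "(2 * (w y \<bullet> w' y) - 2 * L * \<phi> y) * exp (- 2 * L * y) \<le> 0"
        using b[OF y] by (intro mult_nonpos_nonneg) auto
      ultimately show "\<exists>d. ((\<lambda>t. \<phi> t * exp (- 2 * L * t)) has_real_derivative d) (at y) \<and> d \<le> 0" by blast
    qed
    thus ?thesis using t0 by (simp add: \<phi>_def mult_le_0_iff not_le[symmetric])
  next
    case False
    hence le: "t \<le> t0" by simp
    have "\<phi> t * exp (2 * L * t) \<le> \<phi> t0 * exp (2 * L * t0)"
    proof (rule DERIV_nonneg_imp_nondecreasing[OF le])
      fix y assume "t \<le> y" "y \<le> t0"
      hence y: "y \<in> S" using in_S t0 t by blast
      have "((\<lambda>t. \<phi> t * exp (2 * L * t)) has_real_derivative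
          (2 * (w y \<bullet> w' y) + 2 * L * \<phi> y) * exp (2 * L * y)) (at y)"
        by (rule derivative_eq_intros d\<phi>[OF y] refl | simp add: algebra_simps)+
      moreover have "(2 * (w y \<bullet> w' y) + 2 * L * \<phi> y) * exp (2 * L * y) \<ge> 0"
        using b[OF y] by (intro mult_nonneg_nonneg) auto
      ultimately show "\<exists>d. ((\<lambda>t. \<phi> t * exp (2 * L * t)) has_real_derivative d) (at y) \<and> 0 \<le> d" by blast
    qed
    thus ?thesis using t0 by (simp add: \<phi>_def mult_le_0_iff not_le[symmetric])
  qed
  thus ?thesis using inner_gt_zero_iff[of "w t"] unfolding \<phi>_def by linarith
qed

section \<open>The profile equation and its maximal solutions\<close>

lemma mem_interval_real:
  fixes J :: "real set"
  assumes "is_interval J" "a \<in> J" "b \<in> J" "a \<le> x" "x \<le> b"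
  shows "x \<in> J"
  using assms unfolding is_interval_1 by blast

text \<open>By the mean value theorem, \<open>h\<close> is injective as soon as its derivative has no zero on the interval;
this serves for increasing and decreasing \<open>h\<close> alike.\<close>

lemma inverse_function_interval:
  fixes h h' :: "real \<Rightarrow> real"
  assumes J: "open J" "is_interval J"
    and der: "\<And>t. t \<in> J \<Longrightarrow> (h has_real_derivative h' t) (at t)"
    and nz: "\<And>t. t \<in> J \<Longrightarrow> h' t \<noteq> 0"
  obtains f where "open (h ` J)" "is_interval (h ` J)" "\<And>t. t \<in> J \<Longrightarrow> f (h t) = t"
    "\<And>s. s \<in> h ` J \<Longrightarrow> (f has_real_derivative 1 / h' (f s)) (at s)"
proof -
  have cont: "continuous_on J h"
    using der by (meson DERIV_isCont continuous_at_imp_continuous_on)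
  have inj: "inj_on h J"
  proof (rule linorder_inj_onI')
    fix a b assume ab: "a \<in> J" "b \<in> J" "a < b"
    have sub: "x \<in> J" if "a \<le> x" "x \<le> b" for x
      using mem_interval_real[OF J(2) ab(1,2) that] .
    obtain z where "a < z" "z < b" "h b - h a = (b - a) * h' z"
      using MVT2[OF ab(3), of h h'] der sub by auto
    thus "h a \<noteq> h b" using nz[of z] sub[of z] ab by auto
  qed
  define f where "f = the_inv_into J h"
  have fh: "f (h t) = t" if "t \<in> J" for t
    unfolding f_def using inj that by (rule the_inv_into_f_f)
  show thesis
  proof
    show op: "open (h ` J)" by (rule invariance_of_domain[OF cont J(1) inj])
    show "is_interval (h ` J)"
      using J(2) cont by (meson connected_continuous_image is_interval_connected_1)
    show "f (h t) = t" if "t \<in> J" for t using that by (rule fh)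
    fix s assume "s \<in> h ` J"
    then obtain t where t: "t \<in> J" "s = h t" by blast
    have "(h has_derivative (*) (h' t)) (at t)"
      using der[OF t(1)] by (simp add: has_field_derivative_def)
    hence "(f has_derivative (*) (1 / h' t)) (at (h t))"
      by (intro has_derivative_inverse_strong[OF J(1) t(1) cont fh])
         (use nz[OF t(1)] in \<open>auto simp: fun_eq_iff\<close>)
    thus "(f has_real_derivative 1 / h' (f s)) (at s)"
      using fh[OF t(1)] t(2) by (simp add: has_field_derivative_def)
  qed
qed

text \<open>The number \<open>g t\<close> is the radius of the hypersurface at time \<open>t\<close>, and \<open>p\<close> is its derivative. Thus
\<open>\<bar>p t\<bar> < 1\<close> says that the profile is timelike.\<close>

definition profile_solution :: "real \<Rightarrow> real set \<Rightarrow> (real \<Rightarrow> real) \<Rightarrow> (real \<Rightarrow> real) \<Rightarrow> bool" where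
  "profile_solution k J g p \<longleftrightarrow> open J \<and> is_interval J \<and>
     (\<forall>t\<in>J. g t > 0 \<and> \<bar>p t\<bar> < 1 \<and> (g has_real_derivative p t) (at t) \<and>
        (p has_real_derivative (1 - (p t)\<^sup>2) * (p t - k / g t)) (at t))"

lemma profile_solutionD:
  assumes "profile_solution k J g p"
  shows "open J" "is_interval J" "t \<in> J \<Longrightarrow> g t > 0" "t \<in> J \<Longrightarrow> \<bar>p t\<bar> < 1"
    "t \<in> J \<Longrightarrow> (g has_real_derivative p t) (at t)"
    "t \<in> J \<Longrightarrow> (p has_real_derivative (1 - (p t)\<^sup>2) * (p t - k / g t)) (at t)"
  using assms unfolding profile_solution_def by auto

text \<open>Maximality is expressed by a uniform extension time as long as the radius is bounded away from \<open>0\<close>.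
In particular, the solution can end at a finite time only by approaching the axis.\<close>

definition maximal_solution :: "real \<Rightarrow> real set \<Rightarrow> (real \<Rightarrow> real) \<Rightarrow> (real \<Rightarrow> real) \<Rightarrow> bool" where
  "maximal_solution k J g p \<longleftrightarrow> profile_solution k J g p \<and>
     (\<forall>c>0. \<exists>\<eta>>0. \<forall>t\<in>J. g t \<ge> c \<longrightarrow> {t - \<eta>..t + \<eta>} \<subseteq> J)"

lemma real_lipschitz_1:
  fixes f :: "real \<Rightarrow> real"
  assumes "\<And>x. (f has_real_derivative f' x) (at x)" "\<And>x. \<bar>f' x\<bar> \<le> 1"
  shows "\<bar>f a - f b\<bar> \<le> \<bar>a - b\<bar>"
  using field_differentiable_bound[of UNIV f f' 1 a b] assms by simp

lemma tanh_artanh_real: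
  fixes x :: real
  assumes "\<bar>x\<bar> < 1"
  shows "tanh (artanh x) = x"
proof -
  have "exp (- (2 * artanh x)) = inverse ((1 + x) / (1 - x))"
    using assms by (simp add: artanh_def exp_minus)
  hence e: "exp (- 2 * artanh x) = (1 - x) / (1 + x)" by simp
  show ?thesis using assms unfolding tanh_real_altdef e by (simp add: field_simps)
qed

text \<open>The equation is singular at \<open>g = 0\<close> and its domain is bounded by \<open>\<bar>p\<bar> = 1\<close>. Both defects disappear in the
coordinates \<open>y = ln g\<close> and \<open>\<theta> = artanh p\<close> with a new time \<open>\<tau>\<close> such that \<open>dt = \<sigma> y d\<tau>\<close>, where \<open>\<sigma>\<close> is the
logistic function. Since \<open>(1 - \<sigma> y) / \<sigma> y = exp (- y) = 1 / g\<close>, the system becomes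
\[ y' = (1 - \sigma(y)) \tanh\theta, \quad \theta' = \sigma(y) \tanh\theta - k (1 - \sigma(y)), \quad t' = \sigma(y), \]
with globally Lipschitz right-hand side, and its solutions exist for all \<open>\<tau>\<close>. As \<open>\<bar>y'\<bar> \<le> 1\<close>, within
one unit of \<open>\<tau>\<close> before or after a point with \<open>g \<ge> c\<close> the time \<open>t\<close> changes by at least \<open>\<sigma> (ln c - 1)\<close>; this is the
extension time.\<close>

lemma exists_maximal_solution:
  assumes k: "k \<ge> 0" and g0: "g0 > 0" and p0: "\<bar>p0\<bar> < 1"
  obtains J g p where "maximal_solution k J g p" "t0 \<in> J" "g t0 = g0" "p t0 = p0"
proof -
  define \<sigma> :: "real \<Rightarrow> real" where "\<sigma> y = exp y / (1 + exp y)" for y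
  have pos: "1 + exp y > 0" for y :: real using exp_gt_zero[of y] by linarith
  have \<sigma>01: "0 < \<sigma> y" "\<sigma> y < 1" for y using pos[of y] by (auto simp: \<sigma>_def field_simps)
  have d\<sigma>: "(\<sigma> has_real_derivative \<sigma> y * (1 - \<sigma> y)) (at y)" for y
    unfolding \<sigma>_def[abs_def]
    by (rule derivative_eq_intros refl | use pos[of y] in \<open>simp add: field_simps power2_eq_square\<close>)+
  have lip\<sigma>: "\<bar>\<sigma> a - \<sigma> b\<bar> \<le> \<bar>a - b\<bar>" for a b
  proof (rule real_lipschitz_1[OF d\<sigma>])
    show "\<bar>\<sigma> x * (1 - \<sigma> x)\<bar> \<le> 1" for x
      using \<sigma>01[of x] mult_le_one[of "\<sigma> x" "1 - \<sigma> x"] by (simp add: abs_mult)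
  qed
  have liptanh: "\<bar>tanh a - tanh b\<bar> \<le> \<bar>a - b\<bar>" for a b :: real
  proof (rule real_lipschitz_1)
    show "(tanh has_real_derivative 1 - (tanh x)\<^sup>2) (at x)" for x :: real
      by (rule derivative_eq_intros refl | simp)+
    show "\<bar>1 - (tanh x)\<^sup>2\<bar> \<le> 1" for x :: real
      using tanh_real_bounds[of x] by (simp add: abs_square_le_1 abs_le_iff less_imp_le)
  qed
  define F :: "real \<times> real \<times> real \<Rightarrow> real \<times> real \<times> real" where
    "F u = (tanh (fst (snd u)) * (1 - \<sigma> (fst u)),
            \<sigma> (fst u) * tanh (fst (snd u)) - k * (1 - \<sigma> (fst u)), \<sigma> (fst u))" for u
  have lipF: "norm (F u - F v) \<le> (5 + k) * norm (u - v)" for u v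
  proof -
    obtain a b c a' b' c' where uv: "u = (a, b, c)" "v = (a', b', c')" by (metis surj_pair)
    have n3: "norm (x, y, z) \<le> \<bar>x\<bar> + \<bar>y\<bar> + \<bar>z\<bar>" for x y z :: real
      using norm_Pair_le[of x "(y, z)"] norm_Pair_le[of y z] by simp
    have nu: "\<bar>a - a'\<bar> \<le> norm (u - v)" "\<bar>b - b'\<bar> \<le> norm (u - v)"
      using norm_fst_le[of "a - a'" "(b - b', c - c')"] norm_fst_le[of "b - b'" "c - c'"]
        norm_snd_le[of "(b - b', c - c')" "a - a'"] by (auto simp: uv)
    have t1: "\<bar>tanh x\<bar> \<le> 1" for x :: real using tanh_real_bounds[of x] by auto
    have prod: "\<bar>x * y - x' * y'\<bar> \<le> \<bar>x - x'\<bar> + \<bar>y - y'\<bar>" if "\<bar>x\<bar> \<le> 1" "\<bar>y'\<bar> \<le> 1" for x y x' y' :: real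
    proof -
      have "x * y - x' * y' = x * (y - y') + (x - x') * y'" by (simp add: algebra_simps)
      also have "\<bar>\<dots>\<bar> \<le> \<bar>x\<bar> * \<bar>y - y'\<bar> + \<bar>x - x'\<bar> * \<bar>y'\<bar>"
        by (metis abs_mult abs_triangle_ineq)
      also have "\<dots> \<le> 1 * \<bar>y - y'\<bar> + \<bar>x - x'\<bar> * 1"
        using that by (intro add_mono mult_mono) auto
      finally show ?thesis by simp
    qed
    have 1: "\<bar>tanh b * (1 - \<sigma> a) - tanh b' * (1 - \<sigma> a')\<bar> \<le> \<bar>b - b'\<bar> + \<bar>a - a'\<bar>"
      using prod[of "tanh b" "1 - \<sigma> a'" "1 - \<sigma> a" "tanh b'"] t1[of b] \<sigma>01[of a'] liptanh[of b b'] lip\<sigma>[of a a']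
      by (simp add: abs_minus_commute)
    have 2: "\<bar>\<sigma> a * tanh b - \<sigma> a' * tanh b'\<bar> \<le> \<bar>b - b'\<bar> + \<bar>a - a'\<bar>"
      using prod[of "\<sigma> a" "tanh b'" "tanh b" "\<sigma> a'"] t1[of b'] \<sigma>01[of a] liptanh[of b b'] lip\<sigma>[of a a'] by auto
    have 3: "\<bar>k * (1 - \<sigma> a) - k * (1 - \<sigma> a')\<bar> \<le> k * \<bar>a - a'\<bar>"
      using k lip\<sigma>[of a' a] by (simp add: abs_mult mult_left_mono abs_minus_commute flip: right_diff_distrib)
    have "norm (F u - F v) \<le> (\<bar>b - b'\<bar> + \<bar>a - a'\<bar>) + (\<bar>b - b'\<bar> + \<bar>a - a'\<bar> + k * \<bar>a - a'\<bar>) + \<bar>a - a'\<bar>"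
      unfolding F_def uv diff_Pair fst_conv snd_conv
      by (rule order_trans[OF n3]) (use 1 2 3 lip\<sigma>[of a a'] in linarith)
    also have "\<dots> \<le> (5 + k) * norm (u - v)"
      using nu mult_left_mono[OF nu(1) k] by (simp add: algebra_simps)
    finally show ?thesis .
  qed
  obtain u where u0: "u 0 = (ln g0, artanh p0, t0)" and u: "\<And>x. (u has_vector_derivative F (u x)) (at x)"
    using picard_global[of "5 + k" F "(ln g0, artanh p0, t0)"] lipF k by auto
  define y \<theta> T where "y x = fst (u x)" and "\<theta> x = fst (snd (u x))" and "T x = snd (snd (u x))" for x
  have du: "((\<lambda>x. fst (u x)) has_vector_derivative fst (F (u x))) (at x)"
       "((\<lambda>x. fst (snd (u x))) has_vector_derivative fst (snd (F (u x)))) (at x)"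
       "((\<lambda>x. snd (snd (u x))) has_vector_derivative snd (snd (F (u x)))) (at x)" for x
    using u[of x] unfolding has_vector_derivative_def
    by (auto intro!: derivative_eq_intros)
  have dy: "(y has_real_derivative tanh (\<theta> x) * (1 - \<sigma> (y x))) (at x)" for x
    using du(1)[of x] unfolding y_def \<theta>_def has_real_derivative_iff_has_vector_derivative by (simp add: F_def)
  have d\<theta>: "(\<theta> has_real_derivative \<sigma> (y x) * tanh (\<theta> x) - k * (1 - \<sigma> (y x))) (at x)" for x
    using du(2)[of x] unfolding y_def \<theta>_def has_real_derivative_iff_has_vector_derivative by (simp add: F_def)
  have dT: "(T has_real_derivative \<sigma> (y x)) (at x)" for x
    using du(3)[of x] unfolding y_def T_def has_real_derivative_iff_has_vector_derivative by (simp add: F_def)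
  obtain \<tau> where J: "open (range T)" "is_interval (range T)" and \<tau>T: "\<And>x. \<tau> (T x) = x"
    and d\<tau>: "\<And>t. t \<in> range T \<Longrightarrow> (\<tau> has_real_derivative 1 / \<sigma> (y (\<tau> t))) (at t)"
    using inverse_function_interval[of UNIV T "\<lambda>x. \<sigma> (y x)"] dT \<sigma>01 by (metis UNIV_I is_interval_univ less_irrefl open_UNIV)
  define g p where "g t = exp (y (\<tau> t))" and "p t = tanh (\<theta> (\<tau> t))" for t
  have key: "(1 - \<sigma> x) / \<sigma> x = 1 / exp x" for x
    using pos[of x] by (simp add: \<sigma>_def field_simps)
  have sol: "profile_solution k (range T) g p"
    unfolding profile_solution_def
  proof (intro conjI ballI J)
    fix t assume t: "t \<in> range T"
    let ?x = "\<tau> t"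
    have s0: "\<sigma> (y ?x) \<noteq> 0" using \<sigma>01(1)[of "y ?x"] by simp
    show "0 < g t" by (simp add: g_def)
    show "\<bar>p t\<bar> < 1" using tanh_real_bounds[of "\<theta> ?x"] by (auto simp: p_def)
    have "((\<lambda>t. exp (y (\<tau> t))) has_real_derivative
        exp (y ?x) * (tanh (\<theta> ?x) * (1 - \<sigma> (y ?x)) * (1 / \<sigma> (y ?x)))) (at t)"
      by (intro DERIV_fun_exp DERIV_chain2[OF dy d\<tau>[OF t]])
    also have "exp (y ?x) * (tanh (\<theta> ?x) * (1 - \<sigma> (y ?x)) * (1 / \<sigma> (y ?x)))
        = exp (y ?x) * tanh (\<theta> ?x) * ((1 - \<sigma> (y ?x)) / \<sigma> (y ?x))" by simp
    also have "\<dots> = p t" by (simp add: key p_def)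
    finally show "(g has_real_derivative p t) (at t)" by (simp add: g_def[abs_def])
    have dtanh: "(tanh has_real_derivative 1 - (tanh x)\<^sup>2) (at x)" for x :: real
      by (rule derivative_eq_intros refl | simp)+
    have "((\<lambda>t. tanh (\<theta> (\<tau> t))) has_real_derivative
        (1 - (tanh (\<theta> ?x))\<^sup>2) * ((\<sigma> (y ?x) * tanh (\<theta> ?x) - k * (1 - \<sigma> (y ?x))) * (1 / \<sigma> (y ?x)))) (at t)"
      by (rule DERIV_chain2[OF dtanh DERIV_chain2[OF d\<theta> d\<tau>[OF t]]])
    also have "(\<sigma> (y ?x) * tanh (\<theta> ?x) - k * (1 - \<sigma> (y ?x))) * (1 / \<sigma> (y ?x))
        = tanh (\<theta> ?x) - k * ((1 - \<sigma> (y ?x)) / \<sigma> (y ?x))" using s0 by (simp add: field_simps)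
    also have "\<dots> = p t - k / g t" by (simp add: key p_def g_def)
    finally show "(p has_real_derivative (1 - (p t)\<^sup>2) * (p t - k / g t)) (at t)"
      by (simp add: p_def[abs_def])
  qed
  have ext: "\<exists>\<eta>>0. \<forall>t\<in>range T. g t \<ge> c \<longrightarrow> {t - \<eta>..t + \<eta>} \<subseteq> range T" if c: "c > 0" for c
  proof (intro exI[of _ "\<sigma> (ln c - 1)"] conjI ballI impI)
    show "\<sigma> (ln c - 1) > 0" by (rule \<sigma>01)
    fix t assume "t \<in> range T" "c \<le> g t"
    then obtain x where x: "t = T x" by blast
    have yx: "y x \<ge> ln c" using \<open>c \<le> g t\<close> c ln_le_cancel_iff[of c "exp (y x)"] unfolding x g_def \<tau>T by simp
    have ylip: "\<bar>y a - y b\<bar> \<le> \<bar>a - b\<bar>" for a b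
    proof (rule real_lipschitz_1[OF dy])
      show "\<bar>tanh (\<theta> x) * (1 - \<sigma> (y x))\<bar> \<le> 1" for x
        using tanh_real_bounds[of "\<theta> x"] \<sigma>01[of "y x"] unfolding abs_mult
        by (intro mult_le_one) auto
    qed
    have mono\<sigma>: "\<sigma> a \<le> \<sigma> b" if "a \<le> b" for a b
      using that pos[of a] pos[of b] by (simp add: \<sigma>_def field_simps)
    have step: "T b - T a \<ge> \<sigma> (ln c - 1)" if "b = a + 1" "\<And>z. a \<le> z \<Longrightarrow> z \<le> b \<Longrightarrow> \<bar>z - x\<bar> \<le> 1" for a b
    proof -
      obtain z where z: "a < z" "z < b" "T b - T a = (b - a) * \<sigma> (y z)"
        using MVT2[of a b T "\<lambda>x. \<sigma> (y x)"] dT \<open>b = a + 1\<close> by auto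
      have "y z \<ge> ln c - 1" using ylip[of z x] that(2)[of z] yx z by auto
      thus ?thesis using mono\<sigma>[of "ln c - 1" "y z"] z(3) that(1) by simp
    qed
    have "T (x + 1) - T x \<ge> \<sigma> (ln c - 1)" by (rule step) auto
    moreover have "T x - T (x - 1) \<ge> \<sigma> (ln c - 1)" by (rule step) auto
    ultimately have "T (x - 1) \<le> t - \<sigma> (ln c - 1)" "t + \<sigma> (ln c - 1) \<le> T (x + 1)" by (auto simp: x)
    thus "{t - \<sigma> (ln c - 1)..t + \<sigma> (ln c - 1)} \<subseteq> range T"
      using mem_interval_real[OF J(2) rangeI rangeI, of "x - 1" _ "x + 1"] by auto
  qed
  show thesis
  proof
    show "maximal_solution k (range T) g p" using sol ext by (simp add: maximal_solution_def)
    have T0: "T 0 = t0" by (simp add: T_def u0)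
    thus "t0 \<in> range T" by (metis rangeI)
    have "\<tau> t0 = 0" using \<tau>T[of 0] T0 by simp
    thus "g t0 = g0" "p t0 = p0" using g0 p0 by (simp_all add: g_def p_def y_def \<theta>_def u0 tanh_artanh_real)
  qed
qed

text \<open>On the compact interval between \<open>t0\<close> and \<open>t\<close> both radii have a positive lower bound \<open>c\<close>, and for radii
above \<open>c\<close> the right-hand side is Lipschitz.\<close>

lemma profile_solution_unique:
  assumes 1: "profile_solution k J1 g1 p1" and 2: "profile_solution k J2 g2 p2" and k: "k \<ge> 0"
    and t0: "t0 \<in> J1" "t0 \<in> J2" "g1 t0 = g2 t0" "p1 t0 = p2 t0"
    and t: "t \<in> J1" "t \<in> J2"
  shows "g1 t = g2 t" "p1 t = p2 t"
proof -
  define S where "S = {min t0 t..max t0 t}"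
  have S1: "S \<subseteq> J1"
    using mem_interval_real[OF profile_solutionD(2)[OF 1], of t0 t]
      mem_interval_real[OF profile_solutionD(2)[OF 1], of t t0] t0 t
    by (cases "t0 \<le> t") (auto simp: S_def)
  have S2: "S \<subseteq> J2"
    using mem_interval_real[OF profile_solutionD(2)[OF 2], of t0 t]
      mem_interval_real[OF profile_solutionD(2)[OF 2], of t t0] t0 t
    by (cases "t0 \<le> t") (auto simp: S_def)
  have lower: "\<exists>c>0. \<forall>t\<in>S. c \<le> g t" if "profile_solution k J g p" "S \<subseteq> J" for J g p
  proof -
    have "continuous_on S g"
      by (intro continuous_at_imp_continuous_on ballI)
         (use profile_solutionD(5)[OF that(1)] that(2) DERIV_isCont in blast)
    moreover have "compact S" "S \<noteq> {}" by (auto simp: S_def)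
    ultimately obtain x where "x \<in> S" "\<forall>t\<in>S. g x \<le> g t"
      using continuous_attains_inf by metis
    thus ?thesis using profile_solutionD(3)[OF that(1)] that(2) by blast
  qed
  obtain c1 c2 where c12: "c1 > 0" "\<And>t. t \<in> S \<Longrightarrow> c1 \<le> g1 t" "c2 > 0" "\<And>t. t \<in> S \<Longrightarrow> c2 \<le> g2 t"
    using lower[OF 1 S1] lower[OF 2 S2] by blast
  define c where "c = min c1 c2"
  have c: "c > 0" "\<And>t. t \<in> S \<Longrightarrow> c \<le> g1 t" "\<And>t. t \<in> S \<Longrightarrow> c \<le> g2 t"
    using c12 by (auto simp: c_def min.coboundedI1 min.coboundedI2)
  define R where "R g p = (1 - p\<^sup>2) * (p - k / g)" for g p :: real
  have Rlip: "\<bar>R a x - R b y\<bar> \<le> (4 + 2 * k / c) * \<bar>x - y\<bar> + k / c\<^sup>2 * \<bar>a - b\<bar>"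
    if "c \<le> a" "c \<le> b" "\<bar>x\<bar> < 1" "\<bar>y\<bar> < 1" for a b x y
  proof -
    have ab: "a > 0" "b > 0" using that c by auto
    \<comment> \<open>with \<open>A = k / a\<close> and \<open>B = k / b\<close>, compare \<open>(1 - x^2) (x - A)\<close> and \<open>(1 - y^2) (y - B)\<close>\<close>
    have eq: "R a x - R b y = (x - y) * (1 - (x\<^sup>2 + x * y + y\<^sup>2) + k / a * (x + y)) + (1 - y\<^sup>2) * (k * (a - b) / (a * b))"
    proof -
      define A B where "A = k / a" and "B = k / b"
      have kk: "k * (a - b) / (a * b) = B - A" using ab by (simp add: A_def B_def field_simps)
      show ?thesis unfolding kk R_def A_def[symmetric] B_def[symmetric]
        by (simp add: power2_eq_square algebra_simps)
    qed
    have x2: "\<bar>x\<^sup>2\<bar> \<le> 1" "\<bar>x * y\<bar> \<le> 1" "\<bar>y\<^sup>2\<bar> \<le> 1"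
      using that mult_le_one[of "\<bar>x\<bar>" "\<bar>y\<bar>"] by (auto simp: abs_mult abs_square_le_1)
    have xyk: "\<bar>k / a * (x + y)\<bar> \<le> k / c * 2"
      unfolding abs_mult using that k c ab by (intro mult_mono) (auto intro!: divide_left_mono)
    have A: "\<bar>1 - (x\<^sup>2 + x * y + y\<^sup>2) + k / a * (x + y)\<bar> \<le> 4 + 2 * k / c"
    proof -
      have tri: "\<bar>1 - (u + v + w) + z\<bar> \<le> 4 + m" if "\<bar>u\<bar> \<le> 1" "\<bar>v\<bar> \<le> 1" "\<bar>w\<bar> \<le> 1" "\<bar>z\<bar> \<le> m"
        for u v w z m :: real using that unfolding abs_le_iff by linarith
      show ?thesis using tri[OF x2 xyk] by (simp add: mult.commute)
    qed
    have "\<bar>k * (a - b) / (a * b)\<bar> = k * \<bar>a - b\<bar> / (a * b)" using k ab by (simp add: abs_mult)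
    also have "\<dots> \<le> k * \<bar>a - b\<bar> / c\<^sup>2"
      unfolding power2_eq_square using that k c ab by (intro divide_left_mono mult_mono) auto
    finally have B1: "\<bar>k * (a - b) / (a * b)\<bar> \<le> k / c\<^sup>2 * \<bar>a - b\<bar>" by simp
    have "\<bar>1 - y\<^sup>2\<bar> \<le> 1" using x2 by auto
    hence B: "\<bar>(1 - y\<^sup>2) * (k * (a - b) / (a * b))\<bar> \<le> 1 * (k / c\<^sup>2 * \<bar>a - b\<bar>)"
      unfolding abs_mult using B1[unfolded abs_mult] by (intro mult_mono) auto
    have "\<bar>R a x - R b y\<bar> \<le> \<bar>x - y\<bar> * \<bar>1 - (x\<^sup>2 + x * y + y\<^sup>2) + k / a * (x + y)\<bar> + \<bar>(1 - y\<^sup>2) * (k * (a - b) / (a * b))\<bar>"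
      unfolding eq by (metis abs_mult abs_triangle_ineq)
    also have "\<dots> \<le> \<bar>x - y\<bar> * (4 + 2 * k / c) + 1 * (k / c\<^sup>2 * \<bar>a - b\<bar>)"
      using A B by (intro add_mono mult_left_mono) auto
    finally show ?thesis by (simp add: mult.commute)
  qed
  define w where "w s = (g1 s - g2 s, p1 s - p2 s)" for s
  define w' where "w' s = (p1 s - p2 s, R (g1 s) (p1 s) - R (g2 s) (p2 s))" for s
  define L where "L = 1 + (4 + 2 * k / c) + k / c\<^sup>2"
  have "w t = 0"
  proof (rule linear_growth_zero[where S = S and w' = w' and L = L])
    show "is_interval S" by (simp add: S_def is_interval_cc)
    show "t0 \<in> S" "t \<in> S" by (auto simp: S_def)
    show "w t0 = 0" by (simp add: w_def t0 zero_prod_def)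
    fix s assume s: "s \<in> S"
    hence s12: "s \<in> J1" "s \<in> J2" using S1 S2 by auto
    have "((\<lambda>s. g1 s - g2 s) has_vector_derivative p1 s - p2 s) (at s)"
      unfolding has_real_derivative_iff_has_vector_derivative[symmetric]
      by (intro DERIV_diff profile_solutionD(5)[OF 1] profile_solutionD(5)[OF 2] s12)
    moreover have "((\<lambda>s. p1 s - p2 s) has_vector_derivative R (g1 s) (p1 s) - R (g2 s) (p2 s)) (at s)"
      unfolding has_real_derivative_iff_has_vector_derivative[symmetric] R_def
      by (intro DERIV_diff profile_solutionD(6)[OF 1] profile_solutionD(6)[OF 2] s12)
    ultimately show "(w has_vector_derivative w' s) (at s)"
      unfolding w_def[abs_def] w'_def by (rule has_vector_derivative_Pair)
    have n: "\<bar>g1 s - g2 s\<bar> \<le> norm (w s)" "\<bar>p1 s - p2 s\<bar> \<le> norm (w s)"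
      using norm_fst_le[of "g1 s - g2 s" "p1 s - p2 s"] norm_snd_le[of "p1 s - p2 s" "g1 s - g2 s"] by (simp_all add: w_def)
    have r: "\<bar>R (g1 s) (p1 s) - R (g2 s) (p2 s)\<bar> \<le> (4 + 2 * k / c) * \<bar>p1 s - p2 s\<bar> + k / c\<^sup>2 * \<bar>g1 s - g2 s\<bar>"
      by (intro Rlip c s profile_solutionD(4)[OF 1] profile_solutionD(4)[OF 2] s12)
    have "norm (w' s) \<le> \<bar>p1 s - p2 s\<bar> + \<bar>R (g1 s) (p1 s) - R (g2 s) (p2 s)\<bar>"
      unfolding w'_def using norm_Pair_le[of "p1 s - p2 s" "R (g1 s) (p1 s) - R (g2 s) (p2 s)"] by simp
    also have "\<dots> \<le> norm (w s) + ((4 + 2 * k / c) * norm (w s) + k / c\<^sup>2 * norm (w s))"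
      using n k c by (intro add_mono order_trans[OF r] mult_left_mono) auto
    finally show "norm (w' s) \<le> L * norm (w s)" by (simp add: L_def algebra_simps)
  qed
  thus "g1 t = g2 t" "p1 t = p2 t" by (auto simp: w_def zero_prod_def)
qed

section \<open>Phase portrait of the profile equation\<close>

text \<open>A function that is increasing at each of its zeros cannot become nonpositive again: at the first
such point it would be a zero at which the function is not increasing.\<close>

lemma barrier:
  fixes \<phi> :: "real \<Rightarrow> real"
  assumes J: "is_interval J"
    and der: "\<And>t. t \<in> J \<Longrightarrow> (\<phi> has_real_derivative \<phi>' t) (at t)"
    and up: "\<And>t. t \<in> J \<Longrightarrow> \<phi> t = 0 \<Longrightarrow> \<phi>' t > 0"
    and a: "a \<in> J" "\<phi> a \<ge> 0" and b: "b \<in> J" "a < b"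
  shows "\<phi> b > 0"
proof (rule ccontr)
  assume "\<not> \<phi> b > 0"
  hence b0: "\<phi> b \<le> 0" by simp
  have inJ: "x \<in> J" if "a \<le> x" "x \<le> b" for x
    using mem_interval_real[OF J a(1) b(1) that] .
  obtain a' where a': "a \<le> a'" "a' < b" "\<phi> a' > 0"
  proof (cases "\<phi> a = 0")
    case True
    obtain d where d: "d > 0" "\<And>h. h > 0 \<Longrightarrow> h < d \<Longrightarrow> \<phi> a < \<phi> (a + h)"
      using DERIV_pos_inc_right[OF der[OF a(1)] up[OF a(1) True]] by blast
    define h where "h = min (d / 2) ((b - a) / 2)"
    have "h > 0" "h < d" "a + h < b" using d b by (auto simp: h_def min_def field_simps)
    thus ?thesis using that[of "a + h"] d(2)[of h] True by simp
  next
    case False thus ?thesis using that[of a] a b by simp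
  qed
  define Z where "Z = {a'..b} \<inter> \<phi> -` {..0}"
  have cont: "continuous_on {a'..b} \<phi>"
  proof (intro continuous_at_imp_continuous_on ballI)
    fix x assume "x \<in> {a'..b}"
    thus "isCont \<phi> x" using DERIV_isCont[OF der] inJ a' by simp
  qed
  have "closed Z" unfolding Z_def
    by (rule continuous_closed_preimage[OF cont]) auto
  hence "compact Z" using compact_Int_closed[of "{a'..b}" Z] by (simp add: Z_def Int_absorb1 inf.absorb2 flip: Int_assoc)
  moreover have "b \<in> Z" using a' b0 by (simp add: Z_def)
  ultimately obtain z where z: "z \<in> Z" "\<And>y. y \<in> Z \<Longrightarrow> z \<le> y"
    using compact_attains_inf[of Z] by blast
  have zJ: "z \<in> J" using z a' inJ by (auto simp: Z_def)
  have less: "\<phi> y > 0" if "a' \<le> y" "y < z" for y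
    using z(2)[of y] that z(1) by (force simp: Z_def)
  have za: "a' < z" using z(1) a' by (cases "z = a'") (auto simp: Z_def)
  have z0: "\<phi> z = 0"
  proof (rule ccontr)
    assume "\<phi> z \<noteq> 0"
    hence "\<phi> z < 0" using z(1) by (simp add: Z_def)
    have "continuous_on {a'..z} \<phi>" using cont z(1) by (auto simp: Z_def intro: continuous_on_subset)
    then obtain y where "a' \<le> y" "y \<le> z" "\<phi> y = 0"
      using IVT2'[of \<phi> z 0 a'] \<open>\<phi> z < 0\<close> a' za by auto
    thus False using less[of y] \<open>\<phi> z < 0\<close> by (cases "y = z") auto
  qed
  obtain d where d: "d > 0" "\<And>h. h > 0 \<Longrightarrow> h < d \<Longrightarrow> \<phi> (z - h) < \<phi> z"
    using DERIV_pos_inc_left[OF der[OF zJ] up[OF zJ z0]] by blast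
  define h where "h = min (d / 2) ((z - a') / 2)"
  have "h > 0" "h < d" "a' \<le> z - h" using d za by (auto simp: h_def min_def field_simps)
  thus False using d(2)[of h] less[of "z - h"] z0 by simp
qed

lemma derivative_ge_growth:
  fixes \<phi> :: "real \<Rightarrow> real"
  assumes "a \<le> b" and "\<And>t. a \<le> t \<Longrightarrow> t \<le> b \<Longrightarrow> (\<phi> has_real_derivative \<phi>' t) (at t)"
    and m: "\<And>t. a \<le> t \<Longrightarrow> t \<le> b \<Longrightarrow> \<phi>' t \<ge> m"
  shows "\<phi> b - \<phi> a \<ge> m * (b - a)"
proof (cases "a = b")
  case False
  then obtain z where z: "a < z" "z < b" "\<phi> b - \<phi> a = (b - a) * \<phi>' z"
    using MVT2[of a b \<phi> \<phi>'] assms by auto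
  have "m * (b - a) \<le> \<phi>' z * (b - a)" using m[of z] z assms(1) by (intro mult_right_mono) auto
  thus ?thesis using z by (simp add: mult.commute)
qed simp

lemma derivative_le_growth:
  fixes \<phi> :: "real \<Rightarrow> real"
  assumes "a \<le> b" and "\<And>t. a \<le> t \<Longrightarrow> t \<le> b \<Longrightarrow> (\<phi> has_real_derivative \<phi>' t) (at t)"
    and "\<And>t. a \<le> t \<Longrightarrow> t \<le> b \<Longrightarrow> \<phi>' t \<le> m"
  shows "\<phi> b - \<phi> a \<le> m * (b - a)"
  using derivative_ge_growth[of a b "\<lambda>t. - \<phi> t" "\<lambda>t. - \<phi>' t" "- m"] assms
  by (simp add: DERIV_minus)

text \<open>A rising piece of a profile, read as a graph \<open>t = f s\<close> over the radius \<open>s \<in> B\<close>. The continuous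
extension to radius \<open>0\<close> is the infimum of the times: \<open>f\<close> is monotone with range \<open>A\<close>, and radii
in \<open>B\<close> come arbitrarily close to \<open>0\<close>.\<close>

lemma increasing_branch_inverse:
  fixes g p :: "real \<Rightarrow> real"
  assumes A: "open A" "is_interval A" "bdd_below A" "A \<noteq> {}"
    and der: "\<And>t. t \<in> A \<Longrightarrow> (g has_real_derivative p t) (at t)"
    and pos: "\<And>t. t \<in> A \<Longrightarrow> p t > 0"
    and img: "g ` A = B" "\<And>s. s \<in> B \<Longrightarrow> s > 0" "\<And>s. s > 0 \<Longrightarrow> \<exists>s'\<in>B. s' < s"
  obtains f where "\<And>s. s \<in> B \<Longrightarrow> f s \<in> A \<and> g (f s) = s"
    "\<And>t. t \<in> A \<Longrightarrow> f (g t) = t"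
    "\<And>s. s \<in> B \<Longrightarrow> (f has_real_derivative 1 / p (f s)) (at s)"
    "continuous_on (insert 0 B) f"
proof -
  obtain f0 where f0: "open B" "is_interval B" "\<And>t. t \<in> A \<Longrightarrow> f0 (g t) = t"
    "\<And>s. s \<in> B \<Longrightarrow> (f0 has_real_derivative 1 / p (f0 s)) (at s)"
  proof (rule inverse_function_interval[where h = g and h' = p, OF A(1,2) der])
    show "p t \<noteq> 0" if "t \<in> A" for t using pos[OF that] by simp
  qed (auto simp: img(1))
  have f0A: "f0 s \<in> A \<and> g (f0 s) = s" if "s \<in> B" for s
    using that f0(3) unfolding img(1)[symmetric] by auto
  have mono: "g s < g t" if "s \<in> A" "t \<in> A" "s < t" for s t
    using that der pos mem_interval_real[OF A(2) that(1,2)]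
    by (intro DERIV_pos_imp_increasing[OF that(3)]) blast
  define f where "f s = (if s = 0 then Inf A else f0 s)" for s
  have ff: "f s = f0 s" if "s \<in> B" for s using img(2)[OF that] by (simp add: f_def)
  have d: "(f has_real_derivative 1 / p (f s)) (at s)" if s: "s \<in> B" for s
    unfolding ff[OF s]
    by (rule has_field_derivative_transform_within_open[OF f0(4)[OF s] f0(1) s]) (rule ff[symmetric])
  show thesis
  proof
    show "f s \<in> A \<and> g (f s) = s" if "s \<in> B" for s using f0A[OF that] ff[OF that] by simp
    show "f (g t) = t" if "t \<in> A" for t using f0(3)[OF that] ff[of "g t"] that img(1) by auto
    show "(f has_real_derivative 1 / p (f s)) (at s)" if s: "s \<in> B" for s by (rule d[OF s])
    show "continuous_on (insert 0 B) f"
      unfolding continuous_on_eq_continuous_within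
    proof
      fix s assume "s \<in> insert 0 B"
      then consider "s = 0" | "s \<in> B" by blast
      thus "continuous (at s within insert 0 B) f"
      proof cases
        case 2
        thus ?thesis using DERIV_isCont[OF d] continuous_at_imp_continuous_at_within by blast
      next
        case 1
        show ?thesis unfolding 1 continuous_within_eps_delta
        proof (intro allI impI)
          fix e :: real assume e: "e > 0"
          obtain t where t: "t \<in> A" "t < Inf A + e" using cInf_lessD[of A "Inf A + e"] A(4) e by auto
          have gt: "g t > 0" using img t by auto
          have "dist (f s) (f 0) < e" if s: "s \<in> insert 0 B" "dist s 0 < g t" for s
          proof (cases "s = 0")
            case False
            hence sB: "s \<in> B" using s by simp
            have s0: "f0 s \<in> A" "g (f0 s) = s" using f0A[OF sB] by auto
            have "s < g t" using s(2) by (simp add: dist_real_def)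
            hence "f0 s < t" using s0 mono[of t "f0 s"] t(1) by (cases "t = f0 s") force+
            moreover have "Inf A \<le> f0 s" using cInf_lower[OF s0(1) A(3)] .
            ultimately show ?thesis using t(2) False by (simp add: f_def dist_real_def)
          qed (use e in simp)
          thus "\<exists>d>0. \<forall>x'\<in>insert 0 B. dist x' 0 < d \<longrightarrow> dist (f x') (f 0) < e" using gt by blast
        qed
      qed
    qed
  qed
qed

text \<open>Time reversal reduces a falling piece to a rising one.\<close>

lemma decreasing_branch_inverse:
  fixes g p :: "real \<Rightarrow> real"
  assumes A: "open A" "is_interval A" "bdd_above A" "A \<noteq> {}"
    and der: "\<And>t. t \<in> A \<Longrightarrow> (g has_real_derivative p t) (at t)"
    and neg: "\<And>t. t \<in> A \<Longrightarrow> p t < 0"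
    and img: "g ` A = B" "\<And>s. s \<in> B \<Longrightarrow> s > 0" "\<And>s. s > 0 \<Longrightarrow> \<exists>s'\<in>B. s' < s"
  obtains f where "\<And>s. s \<in> B \<Longrightarrow> f s \<in> A \<and> g (f s) = s"
    "\<And>t. t \<in> A \<Longrightarrow> f (g t) = t"
    "\<And>s. s \<in> B \<Longrightarrow> (f has_real_derivative 1 / p (f s)) (at s)"
    "continuous_on (insert 0 B) f"
proof -
  have d: "((\<lambda>t. g (- t)) has_real_derivative - p (- t)) (at t)" if t: "t \<in> uminus ` A" for t
  proof -
    have "- t \<in> A" using t by auto
    have "(uminus has_real_derivative -1) (at t)" by (auto intro!: derivative_eq_intros)
    from DERIV_chain2[where f = g and g = uminus, OF der[OF \<open>- t \<in> A\<close>] this] show ?thesis by simp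
  qed
  obtain f where f: "\<And>s. s \<in> B \<Longrightarrow> f s \<in> uminus ` A \<and> g (- f s) = s"
    "\<And>t. t \<in> uminus ` A \<Longrightarrow> f (g (- t)) = t"
    "\<And>s. s \<in> B \<Longrightarrow> (f has_real_derivative 1 / (- p (- f s))) (at s)"
    "continuous_on (insert 0 B) f"
  proof (rule increasing_branch_inverse[of "uminus ` A" "\<lambda>t. g (- t)" "\<lambda>t. - p (- t)" B])
    show "open (uminus ` A)" using A(1) by (rule open_negations)
    show "is_interval (uminus ` A)" using A(2) by simp
    show "bdd_below (uminus ` A)" using A(3) by simp
    show "uminus ` A \<noteq> {}" using A(4) by simp
    show "((\<lambda>t. g (- t)) has_real_derivative - p (- t)) (at t)" if "t \<in> uminus ` A" for t
      using d[OF that] .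
    show "- p (- t) > 0" if "t \<in> uminus ` A" for t using neg that by auto
    show "(\<lambda>t. g (- t)) ` uminus ` A = B" using img(1) by (simp add: image_image)
  qed (use img in auto)
  show thesis
  proof (rule that[of "\<lambda>s. - f s"])
    show "- f s \<in> A \<and> g (- f s) = s" if "s \<in> B" for s using f(1)[OF that] by auto
    show "- f (g t) = t" if "t \<in> A" for t using f(2)[of "- t"] that by simp
    show "((\<lambda>s. - f s) has_real_derivative 1 / p (- f s)) (at s)" if "s \<in> B" for s
      using DERIV_minus[OF f(3)[OF that]] by simp
    show "continuous_on (insert 0 B) (\<lambda>s. - f s)" using f(4) by (rule continuous_on_minus)
  qed
qed

locale maximal_profile =
  fixes k :: real and J :: "real set" and g p :: "real \<Rightarrow> real"
  assumes maximal: "maximal_solution k J g p" and k_pos: "k > 0" and nonempty: "J \<noteq> {}"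
begin

lemma sol: "profile_solution k J g p" using maximal by (simp add: maximal_solution_def)

lemmas J_open = profile_solutionD(1)[OF sol] and J_interval = profile_solutionD(2)[OF sol]
  and g_pos = profile_solutionD(3)[OF sol] and p_bound = profile_solutionD(4)[OF sol]
  and dg = profile_solutionD(5)[OF sol] and dp = profile_solutionD(6)[OF sol]

lemma extend:
  assumes "c > 0"
  obtains \<eta> where "\<eta> > 0" "\<And>t. t \<in> J \<Longrightarrow> g t \<ge> c \<Longrightarrow> {t - \<eta>..t + \<eta>} \<subseteq> J"
  using maximal assms unfolding maximal_solution_def by blast

lemma in_J: "a \<in> J \<Longrightarrow> b \<in> J \<Longrightarrow> a \<le> x \<Longrightarrow> x \<le> b \<Longrightarrow> x \<in> J"
  using mem_interval_real[OF J_interval] .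

lemma p_square: "t \<in> J \<Longrightarrow> (p t)\<^sup>2 < 1"
  using p_bound by (simp add: abs_square_less_1)

lemma cont_g: "S \<subseteq> J \<Longrightarrow> continuous_on S g"
  by (intro continuous_at_imp_continuous_on ballI) (use dg DERIV_isCont in blast)

lemma cont_p: "S \<subseteq> J \<Longrightarrow> continuous_on S p"
  by (intro continuous_at_imp_continuous_on ballI) (use dp DERIV_isCont in blast)

text \<open>Where \<open>p\<close> vanishes, its derivative is \<open>- (k / g)\<close>, which is negative.\<close>

lemma p_nonpos_later:
  assumes "t \<in> J" "p t \<le> 0" "s \<in> J" "t < s"
  shows "p s < 0"
proof -
  have "- p s > 0"
  proof (rule barrier[where \<phi> = "\<lambda>t. - p t" and a = t, OF J_interval])
    show "((\<lambda>t. - p t) has_real_derivative - ((1 - (p t)\<^sup>2) * (p t - k / g t))) (at t)" if "t \<in> J" for t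
      using DERIV_minus[OF dp[OF that]] .
    show "- ((1 - (p t)\<^sup>2) * (p t - k / g t)) > 0" if "t \<in> J" "- p t = 0" for t
      using that g_pos[OF that(1)] k_pos by simp
  qed (use assms in auto)
  thus ?thesis by simp
qed

text \<open>On the nullcline \<open>g * p = k\<close> the derivative of \<open>p\<close> vanishes, so that of \<open>g * p\<close> is \<open>p\<^sup>2\<close>, which is positive there.\<close>

lemma gp_ge_later:
  assumes "t \<in> J" "g t * p t \<ge> k" "s \<in> J" "t < s"
  shows "g s * p s > k"
proof -
  have "g s * p s - k > 0"
  proof (rule barrier[where \<phi> = "\<lambda>t. g t * p t - k" and a = t, OF J_interval])
    show "((\<lambda>t. g t * p t - k) has_real_derivative (p t * p t + g t * ((1 - (p t)\<^sup>2) * (p t - k / g t)))) (at t)"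
      if "t \<in> J" for t
      using dg[OF that] dp[OF that] by (auto intro!: derivative_eq_intros)
    show "p t * p t + g t * ((1 - (p t)\<^sup>2) * (p t - k / g t)) > 0" if t: "t \<in> J" "g t * p t - k = 0" for t
    proof -
      have "p t = k / g t" using t g_pos[OF t(1)] by (simp add: field_simps)
      moreover have "p t > 0" using calculation k_pos g_pos[OF t(1)] by simp
      ultimately show ?thesis using mult_pos_pos[of "p t" "p t"] by simp
    qed
  qed (use assms in auto)
  thus ?thesis by simp
qed

text \<open>Follow the solution back from \<open>t\<close>. While \<open>g * p < k\<close>, the derivative of \<open>p\<close> is negative, so \<open>p\<close> was larger
before; while \<open>g * p \<ge> k\<close>, we have \<open>p \<ge> k / g\<close>, and \<open>g\<close> was smaller before. The first regime can
only precede the second one.\<close>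

lemma p_lower_bound_before:
  assumes t: "t \<in> J" "p t > 0" and s: "s \<in> J" "s \<le> t"
  shows "p s \<ge> min (p t) (k / g t)"
proof -
  have inJ: "x \<in> J" if "s \<le> x" "x \<le> t" for x using in_J[OF s(1) t(1) that] .
  have pp: "p x > 0" if "x \<in> J" "x \<le> t" for x
    using p_nonpos_later[of x t] that t by (cases "x = t") force+
  have gm: "g x \<le> g t" if "s \<le> x" "x \<le> t" for x
  proof -
    have "0 * (t - x) \<le> g t - g x"
    proof (rule derivative_ge_growth[where \<phi> = g and \<phi>' = p, OF that(2)])
      fix y assume "x \<le> y" "y \<le> t"
      hence "y \<in> J" using inJ that by simp
      thus "(g has_real_derivative p y) (at y)" "0 \<le> p y" using dg pp \<open>y \<le> t\<close> by (auto simp: less_imp_le)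
    qed
    thus ?thesis by simp
  qed
  have below: "p s \<ge> p z" if z: "s \<le> z" "z \<le> t" and lt: "\<And>x. s \<le> x \<Longrightarrow> x < z \<Longrightarrow> g x * p x < k" for z
  proof -
    have "p z - p s \<le> 0 * (z - s)" if zz: "g z * p z \<le> k"
    proof (rule derivative_le_growth[where \<phi> = p, OF z(1)])
      fix x assume x: "s \<le> x" "x \<le> z"
      hence xJ: "x \<in> J" using inJ z by auto
      show "(p has_real_derivative (1 - (p x)\<^sup>2) * (p x - k / g x)) (at x)" using dp[OF xJ] .
      have "g x * p x \<le> k" using lt[of x] x zz by (cases "x = z") auto
      hence "p x - k / g x \<le> 0" using g_pos[OF xJ] by (simp add: field_simps)
      thus "(1 - (p x)\<^sup>2) * (p x - k / g x) \<le> 0"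
        using p_square[OF xJ] by (intro mult_nonneg_nonpos) auto
    qed
    moreover have "g z * p z \<le> k \<or> z = s"
    proof (rule ccontr)
      assume "\<not> ?thesis"
      hence *: "g z * p z > k" "s < z" using z by auto
      have "continuous_on {s..z} (\<lambda>x. g x * p x)"
        using inJ z by (intro continuous_on_mult cont_g cont_p) auto
      then obtain x where x: "s \<le> x" "x \<le> z" "g x * p x = k"
        using IVT'[of "\<lambda>x. g x * p x" s k z] * lt[of s] by auto
      thus False using lt[of x] * by (cases "x = z") auto
    qed
    ultimately show ?thesis by auto
  qed
  have kg: "k / g t \<le> k / g x" if "s \<le> x" "x \<le> t" for x
    using gm[OF that] g_pos[OF inJ[OF that]] k_pos by (intro divide_left_mono) auto
  consider "g s * p s \<ge> k" | "g s * p s < k" "g t * p t < k" | "g s * p s < k" "g t * p t \<ge> k" by linarith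
  thus ?thesis
  proof cases
    case 1
    hence "p s \<ge> k / g s" using g_pos[OF s(1)] by (simp add: field_simps)
    thus ?thesis using kg[of s] s by simp
  next
    case 2
    have "p s \<ge> p t"
    proof (rule below)
      show "g x * p x < k" if "s \<le> x" "x < t" for x
        using gp_ge_later[of x t] inJ[of x] that t 2 by force
    qed (use s in auto)
    thus ?thesis by simp
  next
    case 3
    have "continuous_on {s..t} (\<lambda>x. g x * p x)"
      using inJ by (intro continuous_on_mult cont_g cont_p) auto
    then obtain z where z: "s \<le> z" "z \<le> t" "g z * p z = k"
      using IVT'[of "\<lambda>x. g x * p x" s k t] 3 s by auto
    have "p s \<ge> p z"
    proof (rule below)
      show "g x * p x < k" if "s \<le> x" "x < z" for x
        using gp_ge_later[of x z] inJ[of x] inJ[of z] that z by force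
    qed (use z in auto)
    moreover have "p z = k / g z" using z g_pos[OF inJ[of z]] by (simp add: field_simps)
    ultimately show ?thesis using kg[of z] z by simp
  qed
qed

text \<open>By the previous bound the radius decreases at a positive rate into the past and would become negative.\<close>

lemma rising_bdd_below:
  assumes t: "t \<in> J" "p t > 0"
  shows "bdd_below J"
proof -
  define \<delta> where "\<delta> = min (p t) (k / g t)"
  have \<delta>: "\<delta> > 0" using t g_pos[OF t(1)] k_pos by (simp add: \<delta>_def)
  have "min t (t - g t / \<delta>) \<le> s" if s: "s \<in> J" for s
  proof (cases "s \<le> t")
    case True
    have "\<delta> * (t - s) \<le> g t - g s"
      using True in_J[OF s t(1)] dg p_lower_bound_before[OF t]
      by (intro derivative_ge_growth[where \<phi> = g and \<phi>' = p]) (auto simp: \<delta>_def)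
    hence "\<delta> * (t - s) \<le> g t" using g_pos[OF s] by simp
    hence "t - g t / \<delta> \<le> s" using \<delta> by (simp add: field_simps)
    thus ?thesis by simp
  qed simp
  thus ?thesis by (rule bdd_belowI)
qed

text \<open>For negative \<open>p\<close> both \<open>p\<close> and \<open>p - k / g\<close> are negative, so \<open>p\<close> decreases further and the
radius is used up in finite time.\<close>

lemma falling_bdd_above:
  assumes t: "t \<in> J" "p t < 0"
  shows "bdd_above J"
proof -
  have "s \<le> max t (t + g t / (- p t))" if s: "s \<in> J" for s
  proof (cases "t \<le> s")
    case True
    have neg: "p x < 0" if "t \<le> x" "x \<in> J" for x
      using p_nonpos_later[OF t(1) less_imp_le[OF t(2)] that(2)] t(2) that(1) by (cases "x = t") simp_all
    have dec: "p x \<le> p t" if "t \<le> x" "x \<le> s" for x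
    proof -
      have "p x - p t \<le> 0 * (x - t)"
      proof (rule derivative_le_growth[where \<phi> = p, OF that(1)])
        fix y assume y: "t \<le> y" "y \<le> x"
        hence yJ: "y \<in> J" using in_J[OF t(1) s] that by auto
        show "(p has_real_derivative (1 - (p y)\<^sup>2) * (p y - k / g y)) (at y)" using dp[OF yJ] .
        have "p y < 0" "k / g y > 0" using neg y yJ k_pos g_pos[OF yJ] by auto
        thus "(1 - (p y)\<^sup>2) * (p y - k / g y) \<le> 0"
          using p_square[OF yJ] by (intro mult_nonneg_nonpos) auto
      qed
      thus ?thesis by simp
    qed
    have "g s - g t \<le> p t * (s - t)"
      using True in_J[OF t(1) s] dg dec
      by (intro derivative_le_growth[where \<phi> = g and \<phi>' = p]) auto
    hence "- p t * (s - t) \<le> g t" using g_pos[OF s] by (simp add: algebra_simps)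
    hence "s - t \<le> g t / (- p t)" using t(2) by (subst pos_le_divide_eq) (auto simp: mult.commute)
    thus ?thesis by simp
  qed simp
  thus ?thesis by (rule bdd_aboveI)
qed

text \<open>If the radius were bounded away from \<open>0\<close> near the left end of \<open>J\<close>, the uniform extension time would
lead beyond that end.\<close>

lemma small_values_left:
  assumes "bdd_below J" "c > 0" "t1 \<in> J"
  obtains t where "t \<in> J" "t < t1" "g t < c"
proof -
  have "\<exists>t\<in>J. t < t1 \<and> g t < c"
  proof (rule ccontr)
    assume "\<not> ?thesis"
    hence ge: "g t \<ge> c" if "t \<in> J" "t < t1" for t using that by force
    obtain \<eta> where \<eta>: "\<eta> > 0" "\<And>t. t \<in> J \<Longrightarrow> g t \<ge> c \<Longrightarrow> {t - \<eta>..t + \<eta>} \<subseteq> J"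
      using extend[OF assms(2)] by blast
    have "Inf J < t1"
    proof -
      obtain e where "e > 0" "ball t1 e \<subseteq> J" using J_open assms(3) by (meson openE)
      hence "t1 - e / 2 \<in> J" by (auto simp: dist_real_def subset_iff)
      from cInf_lower[OF this assms(1)] show ?thesis using \<open>e > 0\<close> by simp
    qed
    then obtain t where t: "t \<in> J" "t < min t1 (Inf J + \<eta>)"
      using cInf_lessD[OF nonempty, of "min t1 (Inf J + \<eta>)"] \<eta>(1) by auto
    have "t - \<eta> \<in> J" using \<eta> ge[of t] t by fastforce
    from cInf_lower[OF this assms(1)] show False using t by simp
  qed
  thus thesis using that by blast
qed

lemma small_values_right:
  assumes "bdd_above J" "c > 0" "t1 \<in> J"
  obtains t where "t \<in> J" "t > t1" "g t < c"
proof -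
  have "\<exists>t\<in>J. t > t1 \<and> g t < c"
  proof (rule ccontr)
    assume "\<not> ?thesis"
    hence ge: "g t \<ge> c" if "t \<in> J" "t > t1" for t using that by force
    obtain \<eta> where \<eta>: "\<eta> > 0" "\<And>t. t \<in> J \<Longrightarrow> g t \<ge> c \<Longrightarrow> {t - \<eta>..t + \<eta>} \<subseteq> J"
      using extend[OF assms(2)] by blast
    have "Sup J > t1"
    proof -
      obtain e where "e > 0" "ball t1 e \<subseteq> J" using J_open assms(3) by (meson openE)
      hence "t1 + e / 2 \<in> J" by (auto simp: dist_real_def subset_iff)
      from cSup_upper[OF this assms(1)] show ?thesis using \<open>e > 0\<close> by simp
    qed
    then obtain t where t: "t \<in> J" "t > max t1 (Sup J - \<eta>)"
      using less_cSupD[OF nonempty, of "max t1 (Sup J - \<eta>)"] \<eta>(1) by auto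
    have "t + \<eta> \<in> J" using \<eta> ge[of t] t by fastforce
    from cSup_upper[OF this assms(1)] show False using t by simp
  qed
  thus thesis using that by blast
qed

text \<open>Otherwise \<open>p\<close> is negative on all of \<open>J\<close>. Then the radius grows into the past, so the past is unbounded,
and there \<open>p' \<le> c * (p - k / g)\<close> with \<open>c = 1 - (p t)\<^sup>2\<close>. Dropping the last term shows that \<open>p - c * g\<close>
is decreasing, hence \<open>g\<close> is bounded in the past by some \<open>B\<close>. Dropping the other term then gives
\<open>p' \<le> - (c * k / B)\<close>, so \<open>p\<close> must have been positive long ago.\<close>

lemma zero_of_p:
  assumes t: "t \<in> J" "p t \<le> 0"
  obtains t1 where "t1 \<in> J" "p t1 = 0"
proof (rule ccontr)
  assume "\<not> thesis"
  hence nz: "p s \<noteq> 0" if "s \<in> J" for s using that \<open>\<And>t1. \<lbrakk>t1 \<in> J; p t1 = 0\<rbrakk> \<Longrightarrow> thesis\<close> by blast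
  have neg: "p s < 0" if s: "s \<in> J" for s
  proof (rule ccontr)
    assume "\<not> p s < 0"
    hence ps: "p s > 0" using nz[OF s] by simp
    have st: "s \<le> t" using p_nonpos_later[OF t s] ps by force
    have "continuous_on {s..t} p" using in_J[OF s t(1)] by (intro cont_p) auto
    then obtain z where "s \<le> z" "z \<le> t" "p z = 0" using IVT2'[of p t 0 s] ps t st by auto
    thus False using nz[of z] in_J[OF s t(1)] by blast
  qed
  have dneg: "(1 - (p y)\<^sup>2) * (p y - k / g y) \<le> 0" if "y \<in> J" for y
  proof -
    have "p y < 0" "k / g y > 0" using neg k_pos g_pos that by auto
    thus ?thesis using p_square[OF that] by (intro mult_nonneg_nonpos) auto
  qed
  have unb: "\<not> bdd_below J"
  proof
    assume "bdd_below J"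
    then obtain s where s: "s \<in> J" "s < t" "g s < g t" using small_values_left[of "g t" t] t g_pos by blast
    have "g t - g s \<le> 0 * (t - s)"
      using s in_J[OF s(1) t(1)] dg neg by (intro derivative_le_growth[where \<phi> = g and \<phi>' = p]) (auto simp: less_imp_le)
    thus False using s by simp
  qed
  have left: "s \<in> J" if "s \<le> t" for s
  proof -
    obtain r where "r \<in> J" "r < s" using unb unfolding bdd_below_def by (meson not_le)
    thus ?thesis using in_J[OF _ t(1)] that by auto
  qed
  define c where "c = 1 - (p t)\<^sup>2"
  have c: "c > 0" using p_square[OF t(1)] by (simp add: c_def)
  have der_le: "(1 - (p s)\<^sup>2) * (p s - k / g s) \<le> c * (p s - k / g s)" if s: "s \<le> t" for s
  proof -
    have "p t - p s \<le> 0 * (t - s)"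
      using s left dp dneg by (intro derivative_le_growth[where \<phi> = p]) auto
    hence "\<bar>p s\<bar> \<le> \<bar>p t\<bar>" using neg[OF left[OF s]] neg[OF t(1)] by simp
    hence "(p s)\<^sup>2 \<le> (p t)\<^sup>2" by (simp add: abs_le_square_iff)
    moreover have "p s - k / g s \<le> 0"
      using neg[OF left[OF s]] k_pos g_pos[OF left[OF s]] by (smt (verit) divide_pos_pos)
    ultimately show ?thesis unfolding c_def by (intro mult_right_mono_neg) auto
  qed
  define B where "B = (- p t + c * g t) / c"
  have B: "B > 0" using c neg[OF t(1)] g_pos[OF t(1)]
    unfolding B_def by (intro divide_pos_pos add_pos_pos mult_pos_pos) auto
  have gB: "g s \<le> B" if s: "s \<le> t" for s
  proof -
    have "(p t - c * g t) - (p s - c * g s) \<le> 0 * (t - s)"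
    proof (rule derivative_le_growth[where \<phi> = "\<lambda>x. p x - c * g x", OF s])
      fix x assume x: "s \<le> x" "x \<le> t"
      show "((\<lambda>x. p x - c * g x) has_real_derivative (1 - (p x)\<^sup>2) * (p x - k / g x) - c * p x) (at x)"
        by (rule DERIV_diff[OF dp[OF left[OF x(2)]] DERIV_cmult[OF dg[OF left[OF x(2)]]]])
      have "(1 - (p x)\<^sup>2) * (p x - k / g x) - c * p x \<le> - (c * (k / g x))"
        using der_le[OF x(2)] by (simp add: algebra_simps)
      also have "\<dots> \<le> 0" using c k_pos g_pos[OF left[OF x(2)]] by simp
      finally show "(1 - (p x)\<^sup>2) * (p x - k / g x) - c * p x \<le> 0" .
    qed
    hence "c * g s \<le> - p t + c * g t" using neg[OF left[OF s]] by simp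
    thus ?thesis using c by (simp add: B_def pos_le_divide_eq mult.commute)
  qed
  define m where "m = c * k / B"
  have m: "m > 0" using c k_pos B by (simp add: m_def)
  \<comment> \<open>going back from \<open>t\<close> at rate \<open>m\<close>, the bound on \<open>p\<close> reaches \<open>0\<close> exactly at this time\<close>
  define s where "s = t - (- p t / m)"
  have st: "s \<le> t" using m neg[OF t(1)] by (simp add: s_def divide_nonneg_pos divide_nonpos_pos)
  have "p t - p s \<le> - m * (t - s)"
  proof (rule derivative_le_growth[where \<phi> = p, OF st])
    fix x assume x: "s \<le> x" "x \<le> t"
    show "(p has_real_derivative (1 - (p x)\<^sup>2) * (p x - k / g x)) (at x)" by (rule dp[OF left[OF x(2)]])
    have "k / B \<le> k / g x" using gB[OF x(2)] g_pos[OF left[OF x(2)]] B k_pos by (intro divide_left_mono) auto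
    hence "p x - k / g x \<le> - (k / B)" using neg[OF left[OF x(2)]] by simp
    hence "c * (p x - k / g x) \<le> c * (- (k / B))" using c by (intro mult_left_mono) auto
    thus "(1 - (p x)\<^sup>2) * (p x - k / g x) \<le> - m" using der_le[OF x(2)] by (simp add: m_def)
  qed
  also have "- m * (t - s) = p t" using m by (simp add: s_def)
  finally show False using neg[OF left[OF st]] by simp
qed

text \<open>Suppose \<open>g \<le> B\<close>. The future is unbounded, so \<open>p\<close> cannot have a positive lower bound. If \<open>g * p \<ge> k\<close> once,
then \<open>p \<ge> k / B\<close> ever after. If \<open>g * p < k\<close> throughout, then \<open>p\<close> decreases; as soon as \<open>p\<close> is below
both \<open>1 / 2\<close> and \<open>k / (2 * B)\<close>, its derivative is at most \<open>- (k / (4 * B))\<close> and \<open>p\<close> turns negative.\<close>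

lemma rising_unbounded:
  assumes pos: "\<And>t. t \<in> J \<Longrightarrow> p t > 0"
  obtains t where "t \<in> J" "g t > B"
proof (rule ccontr)
  assume "\<not> thesis"
  hence gB: "g t \<le> B" if "t \<in> J" for t using that \<open>\<And>t. \<lbrakk>t \<in> J; B < g t\<rbrakk> \<Longrightarrow> thesis\<close> by force
  obtain t where t: "t \<in> J" using nonempty by blast
  have B: "B > 0" using gB[OF t] g_pos[OF t] by simp
  have unb: "\<not> bdd_above J"
  proof
    assume "bdd_above J"
    then obtain s where s: "s \<in> J" "s > t" "g s < g t" using small_values_right[of "g t" t] t g_pos by blast
    have "0 * (s - t) \<le> g s - g t"
      using s in_J[OF t s(1)] dg pos by (intro derivative_ge_growth[where \<phi> = g and \<phi>' = p]) (auto simp: less_imp_le)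
    thus False using s by simp
  qed
  have right: "s \<in> J" if "t \<le> s" "t \<in> J" for s t
  proof -
    obtain r where "r \<in> J" "r > s" using unb unfolding bdd_above_def by (meson not_le)
    thus ?thesis using in_J[OF that(2)] that by auto
  qed
  have no_slope: False if t: "t \<in> J" and d: "d > 0" and ge: "\<And>s. t \<le> s \<Longrightarrow> p s \<ge> d" for t d
  proof -
    define s where "s = t + B / d"
    have s: "t \<le> s" using B d by (simp add: s_def)
    have "d * (s - t) \<le> g s - g t"
      using s right t dg ge by (intro derivative_ge_growth[where \<phi> = g and \<phi>' = p]) auto
    moreover have "d * (s - t) = B" using d by (simp add: s_def)
    ultimately show False using gB[OF right[OF s t]] g_pos[OF t] by simp
  qed
  show False
  proof (cases "\<exists>t\<in>J. g t * p t \<ge> k")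
    case True
    then obtain t where t: "t \<in> J" "g t * p t \<ge> k" by blast
    show False
    proof (rule no_slope[OF t(1), of "k / B"])
      show "k / B > 0" using k_pos B by simp
      fix s assume s: "t \<le> s"
      have sJ: "s \<in> J" using right[OF s t(1)] .
      have "k \<le> g s * p s" using gp_ge_later[OF t sJ] t s by (cases "s = t") auto
      also have "\<dots> \<le> B * p s" using gB[OF sJ] pos[OF sJ] by (intro mult_right_mono) auto
      finally show "p s \<ge> k / B" using B by (simp add: field_simps)
    qed
  next
    case False
    hence lt: "g t * p t < k" if "t \<in> J" for t using that by force
    have dec: "p s \<le> p t" if "t \<in> J" "t \<le> s" for s t
    proof -
      have "p s - p t \<le> 0 * (s - t)"
      proof (rule derivative_le_growth[where \<phi> = p, OF that(2)])
        fix y assume y: "t \<le> y" "y \<le> s"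
        hence yJ: "y \<in> J" using right that by auto
        show "(p has_real_derivative (1 - (p y)\<^sup>2) * (p y - k / g y)) (at y)" using dp[OF yJ] .
        have "p y - k / g y \<le> 0" using lt[OF yJ] g_pos[OF yJ] by (simp add: field_simps)
        thus "(1 - (p y)\<^sup>2) * (p y - k / g y) \<le> 0"
          using p_square[OF yJ] by (intro mult_nonneg_nonpos) auto
      qed
      thus ?thesis by simp
    qed
    define d where "d = min (1 / 2) (k / (2 * B))"
    have d: "d > 0" using k_pos B by (simp add: d_def)
    obtain t where t: "t \<in> J" "p t < d"
      using no_slope[OF t d] right[OF _ t] by force
    define m where "m = k / (4 * B)"
    have m: "m > 0" using k_pos B by (simp add: m_def)
    define s where "s = t + p t / m"
    have st: "t \<le> s" using pos[OF t(1)] m by (simp add: s_def)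
    have "p s - p t \<le> - m * (s - t)"
    proof (rule derivative_le_growth[where \<phi> = p, OF st])
      fix x assume x: "t \<le> x" "x \<le> s"
      have xJ: "x \<in> J" using right[OF x(1) t(1)] .
      show "(p has_real_derivative (1 - (p x)\<^sup>2) * (p x - k / g x)) (at x)" by (rule dp[OF xJ])
      have px: "p x < d" using dec[OF t(1) x(1)] t by simp
      have "p x < 1 / 2" "p x < k / (2 * B)" using px by (auto simp: d_def)
      have "(p x)\<^sup>2 \<le> 1 / 2 * 1" unfolding power2_eq_square
        using \<open>p x < 1 / 2\<close> pos[OF xJ] by (intro mult_mono) auto
      hence 1: "1 / 2 \<le> 1 - (p x)\<^sup>2" by simp
      have "k / B \<le> k / g x" using gB[OF xJ] g_pos[OF xJ] B k_pos by (intro divide_left_mono) auto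
      moreover have "k / (2 * B) = k / B - k / (2 * B)" by (simp add: field_simps)
      ultimately have 2: "p x - k / g x \<le> - (k / (2 * B))" using \<open>p x < k / (2 * B)\<close> by linarith
      moreover have "- (k / (2 * B)) \<le> 0" using k_pos B by simp
      ultimately have "(1 - (p x)\<^sup>2) * (p x - k / g x) \<le> 1 / 2 * (p x - k / g x)"
        using 1 by (intro mult_right_mono_neg) auto
      thus "(1 - (p x)\<^sup>2) * (p x - k / g x) \<le> - m" using 2 unfolding m_def by (simp add: field_simps)
    qed
    also have "- m * (s - t) = - p t" using m by (simp add: s_def)
    finally have "p s \<le> 0" by simp
    thus False using pos[OF right[OF st t(1)]] by simp
  qed
qed

end

section \<open>Maximal solutions generate the rotational examples\<close>

context maximal_profile
begin

lemma reciprocal_slope_solves: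
  assumes s: "f s \<in> J" "g (f s) = s" "p (f s) \<noteq> 0"
    and der: "(f has_real_derivative 1 / p (f s)) (at s)"
  shows "((\<lambda>s. 1 / p (f s)) has_real_derivative
    (1 - (1 / p (f s))\<^sup>2) * (1 - k / s * (1 / p (f s)))) (at s)"
proof -
  have "((\<lambda>s. p (f s)) has_real_derivative
      (1 - (p (f s))\<^sup>2) * (p (f s) - k / s) * (1 / p (f s))) (at s)"
    using DERIV_chain2[where f = p and g = f, OF dp[OF s(1)] der] s(2) by simp
  from DERIV_inverse_fun[OF this s(3)]
  have "((\<lambda>s. 1 / p (f s)) has_real_derivative
      - (inverse (p (f s)) * ((1 - (p (f s))\<^sup>2) * (p (f s) - k / s) * (1 / p (f s))) * inverse (p (f s)))) (at s)"
    by (simp add: inverse_eq_divide power2_eq_square mult.assoc)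
  also have "- (inverse (p (f s)) * ((1 - (p (f s))\<^sup>2) * (p (f s) - k / s) * (1 / p (f s))) * inverse (p (f s)))
      = (1 - (1 / p (f s))\<^sup>2) * (1 - k / s * (1 / p (f s)))"
  proof -
    define a b where "a = p (f s)" and "b = k / s"
    have a: "a \<noteq> 0" using s(3) by (simp add: a_def)
    have "- (inverse a * ((1 - a\<^sup>2) * (a - b) * (1 / a)) * inverse a) = (1 - (1 / a)\<^sup>2) * (1 - b * (1 / a))"
      using a by (simp add: field_simps power2_eq_square power3_eq_cube)
    thus ?thesis by (simp add: a_def b_def)
  qed
  finally show ?thesis .
qed

lemma g_strict_mono_rising:
  assumes "s \<in> J" "t \<in> J" "s < t" "\<And>x. s < x \<Longrightarrow> x < t \<Longrightarrow> p x > 0"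
  shows "g s < g t"
proof (rule DERIV_pos_imp_increasing_open[OF assms(3)])
  show "\<exists>y. (g has_real_derivative y) (at x) \<and> 0 < y" if "s < x" "x < t" for x
    using dg[of x] in_J[OF assms(1,2), of x] assms(4)[OF that] that by auto
  show "continuous_on {s..t} g" using in_J[OF assms(1,2)] by (intro cont_g) auto
qed

lemma g_strict_mono_falling:
  assumes "s \<in> J" "t \<in> J" "s < t" "\<And>x. s < x \<Longrightarrow> x < t \<Longrightarrow> p x < 0"
  shows "g t < g s"
proof (rule DERIV_neg_imp_decreasing_open[OF assms(3)])
  show "\<exists>y. (g has_real_derivative y) (at x) \<and> y < 0" if "s < x" "x < t" for x
    using dg[of x] in_J[OF assms(1,2), of x] assms(4)[OF that] that by auto
  show "continuous_on {s..t} g" using in_J[OF assms(1,2)] by (intro cont_g) auto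
qed

text \<open>Before its unique zero \<open>t1\<close> the function \<open>p\<close> is positive, afterwards it is negative. Both branches reach
the axis in finite time and are the lower and the upper half of the spindle; they meet at the equator
of radius \<open>g t1\<close>, where the slopes \<open>1 / p\<close> over the radius are infinite.\<close>

lemma spindle_case:
  assumes k: "k = real CARD('n::finite) - 1" and t1: "t1 \<in> J" "p t1 = 0"
  obtains S :: "('n::finite) minkowski set" where "spindle S"
    "\<And>x t. x \<noteq> 0 \<Longrightarrow> (x, t) \<in> S \<longleftrightarrow> t \<in> J \<and> norm x = g t"
proof -
  define s1 where "s1 = g t1"
  have s1: "s1 > 0" using g_pos[OF t1(1)] by (simp add: s1_def)
  define A where "A = J \<inter> {..<t1}"
  define D where "D = J \<inter> {t1<..}"
  have pA: "p t > 0" if "t \<in> A" for t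
    using p_nonpos_later[of t t1] that t1 by (force simp: A_def)
  have pD: "p t < 0" if "t \<in> D" for t
    using p_nonpos_later[of t1 t] that t1 by (force simp: D_def)
  obtain e where e: "e > 0" "ball t1 e \<subseteq> J" using J_open t1 by (meson openE)
  have eA: "t1 - e / 2 \<in> A" and eD: "t1 + e / 2 \<in> D"
    using e by (auto simp: A_def D_def dist_real_def subset_iff)
  have bA: "bdd_below J" using rising_bdd_below[of "t1 - e / 2"] eA pA by (auto simp: A_def)
  have bD: "bdd_above J" using falling_bdd_above[of "t1 + e / 2"] eD pD by (auto simp: D_def)
  have gA: "g t < s1" if "t \<in> A" for t unfolding s1_def
  proof (rule g_strict_mono_rising)
    show tJ: "t \<in> J" and "t1 \<in> J" "t < t1" using that t1 by (simp_all add: A_def)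
    show "p x > 0" if x: "t < x" "x < t1" for x
      by (rule pA) (use in_J[OF tJ t1(1), of x] x in \<open>simp add: A_def\<close>)
  qed
  have gD: "g t < s1" if "t \<in> D" for t unfolding s1_def
  proof (rule g_strict_mono_falling)
    show tJ: "t \<in> J" and "t1 \<in> J" "t1 < t" using that t1 by (simp_all add: D_def)
    show "p x < 0" if x: "t1 < x" "x < t" for x
      by (rule pD) (use in_J[OF t1(1) tJ, of x] x in \<open>simp add: D_def\<close>)
  qed
  have monoA: "g a < g b" if ab: "a \<in> A" "b \<in> A" "a < b" for a b
  proof (rule g_strict_mono_rising)
    show J: "a \<in> J" "b \<in> J" using ab by (simp_all add: A_def)
    show "p x > 0" if x: "a < x" "x < b" for x
      by (rule pA) (use in_J[OF J, of x] x ab in \<open>simp add: A_def\<close>)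
  qed (rule ab)
  have monoD: "g b < g a" if ab: "a \<in> D" "b \<in> D" "a < b" for a b
  proof (rule g_strict_mono_falling)
    show J: "a \<in> J" "b \<in> J" using ab by (simp_all add: D_def)
    show "p x < 0" if x: "a < x" "x < b" for x
      by (rule pD) (use in_J[OF J, of x] x ab in \<open>simp add: D_def\<close>)
  qed (rule ab)
  have imgA: "g ` A = {0<..<s1}"
  proof (intro equalityI subsetI)
    fix s assume "s \<in> g ` A" thus "s \<in> {0<..<s1}" using gA g_pos by (auto simp: A_def)
  next
    fix s assume s: "s \<in> {0<..<s1}"
    obtain t where t: "t \<in> J" "t < t1" "g t < s" using small_values_left[OF bA _ t1(1), of s] s by auto
    have "continuous_on {t..t1} g" using in_J[OF t(1) t1(1)] by (intro cont_g) auto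
    then obtain z where z: "t \<le> z" "z \<le> t1" "g z = s" using IVT'[of g t s t1] t s by (auto simp: s1_def)
    hence "z \<noteq> t1" using s by (auto simp: s1_def)
    thus "s \<in> g ` A" using z in_J[OF t(1) t1(1)] by (auto simp: A_def)
  qed
  have imgD: "g ` D = {0<..<s1}"
  proof (intro equalityI subsetI)
    fix s assume "s \<in> g ` D" thus "s \<in> {0<..<s1}" using gD g_pos by (auto simp: D_def)
  next
    fix s assume s: "s \<in> {0<..<s1}"
    obtain t where t: "t \<in> J" "t > t1" "g t < s" using small_values_right[OF bD _ t1(1), of s] s by auto
    have "continuous_on {t1..t} g" using in_J[OF t1(1) t(1)] by (intro cont_g) auto
    then obtain z where z: "t1 \<le> z" "z \<le> t" "g z = s" using IVT2'[of g t s t1] t s by (auto simp: s1_def)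
    hence "z \<noteq> t1" using s by (auto simp: s1_def)
    thus "s \<in> g ` D" using z in_J[OF t1(1) t(1)] by (auto simp: D_def)
  qed
  have small: "\<exists>s'\<in>{0<..<s1}. s' < s" if "s > 0" for s
    using that s1 by (intro bexI[of _ "min s s1 / 2"]) auto
  have ins: "insert 0 {0<..<s1} = {0..<s1}" using s1 by auto
  obtain fp where fp: "\<And>s. s \<in> {0<..<s1} \<Longrightarrow> fp s \<in> A \<and> g (fp s) = s"
    "\<And>t. t \<in> A \<Longrightarrow> fp (g t) = t"
    "\<And>s. s \<in> {0<..<s1} \<Longrightarrow> (fp has_real_derivative 1 / p (fp s)) (at s)"
    "continuous_on (insert 0 {0<..<s1}) fp"
  proof (rule increasing_branch_inverse[where A = A and g = g and p = p and B = "{0<..<s1}"])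
    show "open A" using J_open by (auto simp: A_def)
    show "is_interval A" using J_interval unfolding A_def by (intro is_interval_Int) auto
    show "bdd_below A" using bA by (rule bdd_below_mono) (simp add: A_def)
    show "A \<noteq> {}" using eA by auto
    show "(g has_real_derivative p t) (at t)" if "t \<in> A" for t using dg that by (simp add: A_def)
    show "p t > 0" if "t \<in> A" for t by (rule pA[OF that])
    show "g ` A = {0<..<s1}" by (rule imgA)
    show "s > 0" if "s \<in> {0<..<s1}" for s using that by simp
    show "\<exists>s'\<in>{0<..<s1}. s' < s" if "s > 0" for s by (rule small[OF that])
  qed blast
  note fp = fp(1-3) fp(4)[unfolded ins]
  obtain fm where fm: "\<And>s. s \<in> {0<..<s1} \<Longrightarrow> fm s \<in> D \<and> g (fm s) = s"
    "\<And>t. t \<in> D \<Longrightarrow> fm (g t) = t"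
    "\<And>s. s \<in> {0<..<s1} \<Longrightarrow> (fm has_real_derivative 1 / p (fm s)) (at s)"
    "continuous_on (insert 0 {0<..<s1}) fm"
  proof (rule decreasing_branch_inverse[where A = D and g = g and p = p and B = "{0<..<s1}"])
    show "open D" using J_open by (auto simp: D_def)
    show "is_interval D" using J_interval unfolding D_def by (intro is_interval_Int) auto
    show "bdd_above D" using bD by (rule bdd_above_mono) (simp add: D_def)
    show "D \<noteq> {}" using eD by auto
    show "(g has_real_derivative p t) (at t)" if "t \<in> D" for t using dg that by (simp add: D_def)
    show "p t < 0" if "t \<in> D" for t by (rule pD[OF that])
    show "g ` D = {0<..<s1}" by (rule imgD)
    show "s > 0" if "s \<in> {0<..<s1}" for s using that by simp
    show "\<exists>s'\<in>{0<..<s1}. s' < s" if "s > 0" for s by (rule small[OF that])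
  qed blast
  note fm = fm(1-3) fm(4)[unfolded ins]
  have P: "fp s \<in> J" "g (fp s) = s" "p (fp s) > 0" if s: "s \<in> {0<..<s1}" for s
  proof -
    have A: "fp s \<in> A" using fp(1)[OF s] by (rule conjunct1)
    show "p (fp s) > 0" by (rule pA[OF A])
    show "fp s \<in> J" using A by (simp add: A_def)
    show "g (fp s) = s" using fp(1)[OF s] by (rule conjunct2)
  qed
  have M: "fm s \<in> J" "g (fm s) = s" "p (fm s) < 0" if s: "s \<in> {0<..<s1}" for s
  proof -
    have D: "fm s \<in> D" using fm(1)[OF s] by (rule conjunct1)
    show "p (fm s) < 0" by (rule pD[OF D])
    show "fm s \<in> J" using D by (simp add: D_def)
    show "g (fm s) = s" using fm(1)[OF s] by (rule conjunct2)
  qed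
  have evs1: "eventually (\<lambda>s. s \<in> {max c 0<..<s1}) (at_left s1)" if "c < s1" for c
    using eventually_at_leftI[of "max c 0" s1] that s1 by auto
  have limp: "(fp \<longlongrightarrow> t1) (at_left s1)"
  proof (rule tendstoI)
    fix r :: real assume r: "r > 0"
    define t where "t = t1 - min (e / 2) (r / 2)"
    have t: "t \<in> A" "t1 - r < t" using e r eA in_J[of "t1 - e / 2" t1 t] t1 by (auto simp: A_def t_def min_def)
    show "eventually (\<lambda>s. dist (fp s) t1 < r) (at_left s1)"
      using evs1[OF gA[OF t(1)]]
    proof eventually_elim
      case (elim s)
      hence s: "s \<in> {0<..<s1}" "g t < s" by auto
      have f: "fp s \<in> A" "g (fp s) = s" using fp(1)[OF s(1)] by auto
      have "t < fp s"
      proof (rule ccontr)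
        assume "\<not> t < fp s"
        hence "fp s < t" using f s by (cases "fp s = t") auto
        hence "g (fp s) < g t" by (rule monoA[OF f(1) t(1)])
        thus False using f s by simp
      qed
      thus ?case using t f(1) by (auto simp: dist_real_def A_def)
    qed
  qed
  have limm: "(fm \<longlongrightarrow> t1) (at_left s1)"
  proof (rule tendstoI)
    fix r :: real assume r: "r > 0"
    define t where "t = t1 + min (e / 2) (r / 2)"
    have t: "t \<in> D" "t < t1 + r" using e r eD in_J[of t1 "t1 + e / 2" t] t1 by (auto simp: D_def t_def min_def)
    show "eventually (\<lambda>s. dist (fm s) t1 < r) (at_left s1)"
      using evs1[OF gD[OF t(1)]]
    proof eventually_elim
      case (elim s)
      hence s: "s \<in> {0<..<s1}" "g t < s" by auto
      have f: "fm s \<in> D" "g (fm s) = s" using fm(1)[OF s(1)] by auto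
      have "fm s < t"
      proof (rule ccontr)
        assume "\<not> fm s < t"
        hence "t < fm s" using f s by (cases "fm s = t") auto
        hence "g (fm s) < g t" by (rule monoD[OF t(1) f(1)])
        thus False using f s by simp
      qed
      thus ?case using t f(1) by (auto simp: dist_real_def D_def)
    qed
  qed
  have pfp: "((\<lambda>s. p (fp s)) \<longlongrightarrow> 0) (at_left s1)"
    using isCont_tendsto_compose[OF DERIV_isCont[OF dp[OF t1(1)]] limp] t1(2) by simp
  have pfm: "((\<lambda>s. p (fm s)) \<longlongrightarrow> 0) (at_left s1)"
    using isCont_tendsto_compose[OF DERIV_isCont[OF dp[OF t1(1)]] limm] t1(2) by simp
  have wp: "filterlim (\<lambda>s. 1 / p (fp s)) at_top (at_left s1)"
  proof -
    have "eventually (\<lambda>s. 0 < p (fp s)) (at_left s1)"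
      using evs1[OF s1] by eventually_elim (use P(3) in simp)
    from filterlim_inverse_at_top[OF pfp this] show ?thesis by (simp add: inverse_eq_divide)
  qed
  have wm: "filterlim (\<lambda>s. 1 / p (fm s)) at_bot (at_left s1)"
  proof -
    have "eventually (\<lambda>s. p (fm s) < 0) (at_left s1)"
      using evs1[OF s1] by eventually_elim (use M(3) in simp)
    from filterlim_inverse_at_bot[OF pfm this] show ?thesis by (simp add: inverse_eq_divide)
  qed
  define S :: "'n minkowski set" where "S = {(x, fp (norm x)) | x. norm x < s1} \<union> {(x, fm (norm x)) | x. norm x < s1}
         \<union> {(x, t1) | x. norm x = s1}"
  have odep: "solves_ode CARD('n) (\<lambda>s. 1 / p (fp s)) {0<..<s1}"
    unfolding solves_ode_def k[symmetric]
  proof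
    fix s assume s: "s \<in> {0<..<s1}"
    show "((\<lambda>s. 1 / p (fp s)) has_real_derivative (1 - (1 / p (fp s))\<^sup>2) * (1 - k / s * (1 / p (fp s)))) (at s)"
      by (rule reciprocal_slope_solves[where f = fp, OF P(1,2)[OF s] _ fp(3)[OF s]]) (use P(3)[OF s] in simp)
  qed
  have odem: "solves_ode CARD('n) (\<lambda>s. 1 / p (fm s)) {0<..<s1}"
    unfolding solves_ode_def k[symmetric]
  proof
    fix s assume s: "s \<in> {0<..<s1}"
    show "((\<lambda>s. 1 / p (fm s)) has_real_derivative (1 - (1 / p (fm s))\<^sup>2) * (1 - k / s * (1 / p (fm s)))) (at s)"
      by (rule reciprocal_slope_solves[where f = fm, OF M(1,2)[OF s] _ fm(3)[OF s]]) (use M(3)[OF s] in simp)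
  qed
  have rangep: "\<forall>s\<in>{0<..<s1}. 1 / p (fp s) > 1"
  proof
    fix s assume s: "s \<in> {0<..<s1}"
    show "1 / p (fp s) > 1" using P[OF s] p_bound[OF P(1)[OF s]] by (simp add: field_simps)
  qed
  have rangem: "\<forall>s\<in>{0<..<s1}. 1 / p (fm s) < - 1"
  proof
    fix s assume s: "s \<in> {0<..<s1}"
    show "1 / p (fm s) < -1" using M[OF s] p_bound[OF M(1)[OF s]] by (simp add: field_simps)
  qed
  have derp: "\<forall>s\<in>{0<..<s1}. (fp has_real_derivative 1 / p (fp s)) (at s)"
    and derm: "\<forall>s\<in>{0<..<s1}. (fm has_real_derivative 1 / p (fm s)) (at s)"
    using fp(3) fm(3) by blast+
  have "spindle S"
    unfolding spindle_def
    by (rule exI[of _ s1], rule conjI[OF s1], rule exI[of _ "\<lambda>s. 1 / p (fp s)"],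
        rule exI[of _ "\<lambda>s. 1 / p (fm s)"], rule exI[of _ fp], rule exI[of _ fm], rule exI[of _ t1])
       (intro conjI odep rangep wp odem rangem wm fp(4) derp fm(4) derm limp limm S_def)
  moreover have "(x, t) \<in> S \<longleftrightarrow> t \<in> J \<and> norm x = g t" if "x \<noteq> 0" for x t
  proof
    assume "(x, t) \<in> S"
    then consider "norm x < s1" "t = fp (norm x)" | "norm x < s1" "t = fm (norm x)" | "norm x = s1" "t = t1"
      by (auto simp: S_def)
    thus "t \<in> J \<and> norm x = g t"
    proof cases
      case 1 thus ?thesis using P(1,2)[of "norm x"] that by simp
    next
      case 2 thus ?thesis using M(1,2)[of "norm x"] that by simp
    next
      case 3 thus ?thesis using t1 by (simp add: s1_def)
    qed
  next
    assume *: "t \<in> J \<and> norm x = g t"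
    consider "t \<in> A" | "t = t1" | "t \<in> D" using * by (force simp: A_def D_def)
    thus "(x, t) \<in> S"
    proof cases
      case 1 thus ?thesis using fp(2)[OF 1] gA[OF 1] * unfolding S_def by simp
    next
      case 2 thus ?thesis using * unfolding S_def s1_def by simp
    next
      case 3 thus ?thesis using fm(2)[OF 3] gD[OF 3] * unfolding S_def by simp
    qed
  qed
  ultimately show thesis by (rule that)
qed

text \<open>Here the profile is a graph \<open>t = f s\<close> over all radii with slope \<open>w = 1 / p\<close>, and \<open>w\<close> has a critical point
exactly where \<open>g * p = k\<close>. This can happen only once. It does happen if \<open>g * p \<ge> k\<close> somewhere, because
\<open>g * p < g < k\<close> near the axis; otherwise \<open>p\<close> is strictly decreasing.\<close>

lemma entire_case:
  assumes k: "k = real CARD('n::finite) - 1" and pos: "\<And>t. t \<in> J \<Longrightarrow> p t > 0"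
  obtains S :: "('n::finite) minkowski set" where "ogival_paraboloid S \<or> timelike_calyx S"
    "\<And>x t. x \<noteq> 0 \<Longrightarrow> (x, t) \<in> S \<longleftrightarrow> t \<in> J \<and> norm x = g t"
proof -
  obtain t0 where t0: "t0 \<in> J" using nonempty by blast
  have bd: "bdd_below J" using rising_bdd_below[OF t0 pos[OF t0]] .
  have mono: "g s < g t" if "s \<in> J" "t \<in> J" "s < t" for s t
    using that pos in_J[OF that(1,2)] by (intro g_strict_mono_rising) auto
  have img: "g ` J = {0<..}"
  proof (intro equalityI subsetI)
    fix s assume "s \<in> g ` J" thus "s \<in> {0<..}" using g_pos by auto
  next
    fix s :: real assume s: "s \<in> {0<..}"
    obtain a where a: "a \<in> J" "g a < s" using small_values_left[OF bd _ t0, of s] s by auto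
    obtain b where b: "b \<in> J" "g b > s" using rising_unbounded[OF pos] by blast
    have ab: "a < b" using mono[OF b(1) a(1)] a b by (cases a b rule: linorder_cases) auto
    have "continuous_on {a..b} g" using in_J[OF a(1) b(1)] by (intro cont_g) auto
    then obtain z where z: "a \<le> z" "z \<le> b" "g z = s" using IVT'[of g a s b] a b ab by auto
    thus "s \<in> g ` J" using in_J[OF a(1) b(1)] by auto
  qed
  have small: "\<exists>s'\<in>{0<..}. s' < s" if "s > 0" for s :: real
    using that by (intro bexI[of _ "s / 2"]) auto
  have ins: "insert 0 {0<..} = {0::real..}" by auto
  have "\<exists>f. (\<forall>s\<in>{0<..}. f s \<in> J \<and> g (f s) = s) \<and> (\<forall>t\<in>J. f (g t) = t) \<and>
      (\<forall>s\<in>{0<..}. (f has_real_derivative 1 / p (f s)) (at s)) \<and> continuous_on (insert 0 {0<..}) f"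
  proof (rule increasing_branch_inverse[where A = J and g = g and p = p and B = "{0<..}",
        OF J_open J_interval bd nonempty dg pos img _ small])
    show "s > 0" if "s \<in> {0<..}" for s :: real using that by simp
    fix f assume f: "\<And>s. s \<in> {0<..} \<Longrightarrow> f s \<in> J \<and> g (f s) = s" "\<And>t. t \<in> J \<Longrightarrow> f (g t) = t"
      "\<And>s. s \<in> {0<..} \<Longrightarrow> (f has_real_derivative 1 / p (f s)) (at s)"
      "continuous_on (insert 0 {0<..}) f"
    show ?thesis by (intro exI[of _ f] conjI ballI f)
  qed
  then obtain f where f: "\<And>s. s \<in> {0<..} \<Longrightarrow> f s \<in> J \<and> g (f s) = s"
    "\<And>t. t \<in> J \<Longrightarrow> f (g t) = t"
    "\<And>s. s \<in> {0<..} \<Longrightarrow> (f has_real_derivative 1 / p (f s)) (at s)"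
    "continuous_on {0..} f" unfolding ins by blast
  define w where "w s = 1 / p (f s)" for s
  have wd: "(w has_real_derivative (1 - (w s)\<^sup>2) * (1 - k / s * w s)) (at s)" if s: "s > 0" for s
    unfolding w_def[abs_def]
    by (rule reciprocal_slope_solves) (use f(1,3)[of s] pos[of "f s"] s in auto)
  have ode: "solves_ode CARD('n) w {0<..}" using wd by (simp add: solves_ode_def k)
  have w1: "w s > 1" if "s > 0" for s
    using f(1)[of s] pos[of "f s"] p_bound[of "f s"] that by (simp add: w_def field_simps)
  define S :: "'n minkowski set" where "S = {(x, f (norm x)) | x. True}"
  have S: "(x, t) \<in> S \<longleftrightarrow> t \<in> J \<and> norm x = g t" if "x \<noteq> 0" for x t
    using f(1)[of "norm x"] f(2)[of t] that by (auto simp: S_def)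
  have fmono: "f a < f b" if "0 < a" "a < b" for a b
  proof -
    have *: "f a \<in> J" "g (f a) = a" "f b \<in> J" "g (f b) = b" using f(1)[of a] f(1)[of b] that by simp_all
    show ?thesis using mono[OF *(3,1)] * that by (cases "f a" "f b" rule: linorder_cases) auto
  qed
  have wall: "\<forall>s>0. w s > 1" and fall: "\<forall>s>0. (f has_real_derivative w s) (at s)"
    using w1 f(3) unfolding w_def by simp_all
  show thesis
  proof (cases "\<exists>t\<in>J. g t * p t \<ge> k")
    case False
    hence lt: "g t * p t < k" if "t \<in> J" for t using that by force
    have inc: "strict_mono_on {0<..} w"
    proof (rule strict_mono_onI)
      fix a b :: real assume ab: "a \<in> {0<..}" "b \<in> {0<..}" "a < b"
      have J: "f a \<in> J" "f b \<in> J" "f a < f b" using f(1)[of a] f(1)[of b] ab fmono by auto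
      have "p (f b) < p (f a)"
      proof (rule DERIV_neg_imp_decreasing[OF J(3)])
        fix x assume "f a \<le> x" "x \<le> f b"
        hence xJ: "x \<in> J" using in_J J by blast
        have "p x - k / g x < 0" using lt[OF xJ] g_pos[OF xJ] by (simp add: field_simps)
        hence "(1 - (p x)\<^sup>2) * (p x - k / g x) < 0" using p_square[OF xJ] by (intro mult_pos_neg) auto
        thus "\<exists>y. (p has_real_derivative y) (at x) \<and> y < 0" using dp[OF xJ] by blast
      qed
      thus "w a < w b" using pos[OF J(1)] pos[OF J(2)] by (simp add: w_def frac_less2)
    qed
    have "ogival_paraboloid S"
      unfolding ogival_paraboloid_def
      by (rule exI[of _ w], rule exI[of _ f]) (intro conjI ode wall inc fall f(4) S_def)
    hence "ogival_paraboloid S \<or> timelike_calyx S" by simp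
    thus thesis using S by (rule that)
  next
    case True
    then obtain b where b: "b \<in> J" "g b * p b \<ge> k" by blast
    obtain a where a: "a \<in> J" "a < b" "g a < k" using small_values_left[OF bd k_pos b(1)] by blast
    have "g a * p a < k"
    proof -
      have "g a * p a \<le> g a * 1" using g_pos[OF a(1)] p_bound[OF a(1)] by (intro mult_left_mono) auto
      thus ?thesis using a by simp
    qed
    moreover have "continuous_on {a..b} (\<lambda>x. g x * p x)"
      using in_J[OF a(1) b(1)] by (intro continuous_on_mult cont_g cont_p) auto
    ultimately obtain z where z: "a \<le> z" "z \<le> b" "g z * p z = k"
      using IVT'[of "\<lambda>x. g x * p x" a k b] a b by auto
    have zJ: "z \<in> J" using in_J[OF a(1) b(1)] z by blast
    have crit: "(w has_real_derivative 0) (at s) \<longleftrightarrow> s * p (f s) = k" if s: "s > 0" for s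
    proof -
      have "(w has_real_derivative 0) (at s) \<longleftrightarrow> (1 - (w s)\<^sup>2) * (1 - k / s * w s) = 0"
        using wd[OF s] DERIV_unique[OF wd[OF s], of 0] by metis
      also have "\<dots> \<longleftrightarrow> k / s * w s = 1"
      proof -
        have "1 < (w s)\<^sup>2" using w1[OF s] by (simp add: one_less_power)
        thus ?thesis by auto
      qed
      also have "\<dots> \<longleftrightarrow> s * p (f s) = k"
        using s pos[of "f s"] f(1)[of s] by (auto simp: w_def field_simps)
      finally show ?thesis .
    qed
    have uniq: "\<exists>!s. s > 0 \<and> (w has_real_derivative 0) (at s)"
    proof (rule ex1I[of _ "g z"])
      show "g z > 0 \<and> (w has_real_derivative 0) (at (g z))"
        using crit[of "g z"] g_pos[OF zJ] f(2)[OF zJ] z by simp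
      fix s assume s: "s > 0 \<and> (w has_real_derivative 0) (at s)"
      hence sk: "s * p (f s) = k" using crit by blast
      have fs: "f s \<in> J" "g (f s) = s" using f(1)[of s] s by auto
      have "f s = z"
      proof (rule ccontr)
        assume "f s \<noteq> z"
        then consider "f s < z" | "z < f s" by linarith
        thus False
        proof cases
          case 1 thus False using gp_ge_later[OF fs(1) _ zJ] sk fs z by simp
        next
          case 2 thus False using gp_ge_later[OF zJ _ fs(1)] sk fs z by simp
        qed
      qed
      thus "s = g z" using fs by simp
    qed
    have "timelike_calyx S"
      unfolding timelike_calyx_def
      by (rule exI[of _ w], rule exI[of _ f]) (intro conjI ode wall uniq fall f(4) S_def)
    hence "ogival_paraboloid S \<or> timelike_calyx S" by simp
    thus thesis using S by (rule that)
  qed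
qed

lemma exists_rotational_example:
  assumes k: "k = real CARD('n::finite) - 1"
  obtains S :: "('n::finite) minkowski set" where "ogival_paraboloid S \<or> timelike_calyx S \<or> spindle S"
    "\<And>x t. x \<noteq> 0 \<Longrightarrow> (x, t) \<in> S \<longleftrightarrow> t \<in> J \<and> norm x = g t"
proof (cases "\<exists>t\<in>J. p t \<le> 0")
  case True
  then obtain t1 where t1: "t1 \<in> J" "p t1 = 0" using zero_of_p by blast
  show thesis
  proof (rule spindle_case[OF k t1])
    fix S :: "'n minkowski set"
    assume E: "spindle S" and S: "\<And>x t. x \<noteq> 0 \<Longrightarrow> (x, t) \<in> S \<longleftrightarrow> t \<in> J \<and> norm x = g t"
    from E have "ogival_paraboloid S \<or> timelike_calyx S \<or> spindle S" by blast
    thus thesis using S by (rule that)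
  qed
next
  case False
  hence pos: "\<And>t. t \<in> J \<Longrightarrow> p t > 0" by force
  show thesis
  proof (rule entire_case[OF k pos])
    fix S :: "'n minkowski set"
    assume E: "ogival_paraboloid S \<or> timelike_calyx S"
      and S: "\<And>x t. x \<noteq> 0 \<Longrightarrow> (x, t) \<in> S \<longleftrightarrow> t \<in> J \<and> norm x = g t"
    from E have "ogival_paraboloid S \<or> timelike_calyx S \<or> spindle S" by blast
    thus thesis using S by (rule that)
  qed
qed

end

section \<open>First-order geometry of hypersurfaces\<close>

lemma lor_inner: "lor p q = (fst p, - snd p) \<bullet> q"
  by (simp add: lor_def inner_prod_def)

lemma lor_diff [simp]: "lor (a - b) c = lor a c - lor b c" "lor c (a - b) = lor c a - lor c b"
  by (simp_all add: lor_def algebra_simps)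

lemma lor_scaleR [simp]: "lor (r *\<^sub>R a) c = r * lor a c" "lor c (r *\<^sub>R a) = r * lor c a"
  by (simp_all add: lor_def algebra_simps)

lemma lor_commute: "lor a b = lor b a"
  by (simp add: lor_def inner_commute mult.commute)

lemma lor_bound: "\<bar>lor \<nu> q\<bar> \<le> norm \<nu> * norm q"
proof -
  have "norm (fst \<nu>, - snd \<nu>) = norm \<nu>" by (cases \<nu>) (simp add: norm_Pair)
  thus ?thesis unfolding lor_inner using Cauchy_Schwarz_ineq2 by metis
qed

lemma lor_nondegenerate:
  assumes "\<And>v. lor w v = 0"
  shows "w = 0"
proof -
  have "lor w (fst w, - snd w) = w \<bullet> w" by (simp add: lor_def inner_prod_def)
  thus ?thesis using assms by simp
qed

lemma smooth_on_has_derivative: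
  assumes "smooth_on V X" "u \<in> V"
  shows "(X has_derivative frechet_derivative X (at u)) (at u)"
proof -
  have "Ck_on (Suc 0) V X" using assms(1) unfolding smooth_on_def by blast
  thus ?thesis using assms(2) frechet_derivative_works by auto
qed

lemma smooth_on_directional:
  assumes "smooth_on V X"
  shows "smooth_on V (\<lambda>u. frechet_derivative X (at u) v)"
  using assms Ck_on.simps(2) unfolding smooth_on_def by blast

lemma smooth_on_continuous: "smooth_on V X \<Longrightarrow> continuous_on V X"
  unfolding smooth_on_def using Ck_on.simps(1) by blast

lemma smooth_on_isCont:
  assumes "smooth_on V X" "u \<in> V"
  shows "isCont X u"
  using has_derivative_continuous[OF smooth_on_has_derivative[OF assms]] .

text \<open>Continuity of the derivative controls differences of any two nearby points, not only differences
from the base point.\<close>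

lemma smooth_strict_derivative:
  fixes X :: "'a::euclidean_space \<Rightarrow> 'b::euclidean_space"
  assumes X: "smooth_on V X" and u0: "u0 \<in> V" and e: "e > 0"
  obtains \<delta> where "\<delta> > 0" "ball u0 \<delta> \<subseteq> V"
    "\<And>u u'. u \<in> ball u0 \<delta> \<Longrightarrow> u' \<in> ball u0 \<delta> \<Longrightarrow>
      norm (X u - X u' - frechet_derivative X (at u0) (u - u')) \<le> e * norm (u - u')"
proof -
  define D where "D u = frechet_derivative X (at u)" for u
  have der: "(X has_derivative D u) (at u)" if "u \<in> V" for u
    unfolding D_def using smooth_on_has_derivative[OF X that] .
  define e' where "e' = e / DIM('a)"
  have e': "e' > 0" using e by (simp add: e'_def)
  have "\<forall>b\<in>Basis. eventually (\<lambda>u. dist (D u b) (D u0 b) < e') (nhds u0)"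
  proof
    fix b :: 'a
    have "isCont (\<lambda>u. D u b) u0"
      unfolding D_def by (rule smooth_on_isCont[OF smooth_on_directional[OF X] u0])
    hence "eventually (\<lambda>u. dist (D u b) (D u0 b) < e') (at u0)"
      using e' unfolding isCont_def by (rule tendstoD)
    thus "eventually (\<lambda>u. dist (D u b) (D u0 b) < e') (nhds u0)"
      using e' by (simp add: eventually_nhds_conv_at)
  qed
  hence "eventually (\<lambda>u. \<forall>b\<in>Basis. dist (D u b) (D u0 b) < e') (nhds u0)"
    by (simp add: eventually_ball_finite_distrib)
  moreover have "eventually (\<lambda>u. u \<in> V) (nhds u0)"
    using X u0 unfolding smooth_on_def by (intro eventually_nhds_in_open) auto
  ultimately have "eventually (\<lambda>u. u \<in> V \<and> (\<forall>b\<in>Basis. dist (D u b) (D u0 b) < e')) (nhds u0)"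
    by eventually_elim auto
  then obtain \<delta> where \<delta>: "\<delta> > 0"
      "\<And>u. dist u u0 < \<delta> \<Longrightarrow> u \<in> V \<and> (\<forall>b\<in>Basis. dist (D u b) (D u0 b) < e')"
    unfolding eventually_nhds_metric by blast
  have on: "onorm (\<lambda>v. D u v - D u0 v) \<le> e" if "dist u u0 < \<delta>" for u
  proof (rule onorm_le)
    fix v
    have uV: "u \<in> V" using \<delta> that by blast
    have lin: "linear (\<lambda>v. D u v - D u0 v)"
      using der[OF uV] der[OF u0] by (intro linear_compose_sub has_derivative_linear)
    have "norm (D u v - D u0 v) = norm (\<Sum>b\<in>Basis. (v \<bullet> b) *\<^sub>R (D u b - D u0 b))"
    proof -
      have "D u v - D u0 v = (\<lambda>v. D u v - D u0 v) (\<Sum>b\<in>Basis. (v \<bullet> b) *\<^sub>R b)" by (simp add: euclidean_representation)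
      also have "\<dots> = (\<Sum>b\<in>Basis. (v \<bullet> b) *\<^sub>R (D u b - D u0 b))"
        unfolding linear_sum[OF lin] by (intro sum.cong refl linear_scale[OF lin])
      finally show ?thesis by simp
    qed
    also have "\<dots> \<le> (\<Sum>b\<in>(Basis::'a set). norm v * e')"
    proof (rule sum_norm_le)
      fix b :: 'a assume b: "b \<in> Basis"
      have "norm (D u b - D u0 b) \<le> e'" using \<delta>(2)[OF that] b by (simp add: dist_norm less_imp_le)
      thus "norm ((v \<bullet> b) *\<^sub>R (D u b - D u0 b)) \<le> norm v * e'"
        using Basis_le_norm[OF b, of v] by (simp add: mult_mono)
    qed
    also have "\<dots> = e * norm v" by (simp add: e'_def)
    finally show "norm (D u v - D u0 v) \<le> e * norm v" .
  qed
  show thesis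
  proof
    show "\<delta> > 0" by fact
    show "ball u0 \<delta> \<subseteq> V" using \<delta>(2) by (auto simp: dist_commute)
    fix u u' assume u: "u \<in> ball u0 \<delta>" "u' \<in> ball u0 \<delta>"
    have bound: "norm ((X u - D u0 u) - (X u' - D u0 u')) \<le> e * norm (u - u')"
    proof (rule differentiable_bound[where S = "ball u0 \<delta>" and f' = "\<lambda>x v. D x v - D u0 v"])
      fix x assume x: "x \<in> ball u0 \<delta>"
      hence xd: "dist x u0 < \<delta>" by (simp add: dist_commute)
      hence xV: "x \<in> V" using \<delta>(2) by blast
      have D0: "(D u0 has_derivative D u0) (at x)"
        using der[OF u0] by (intro bounded_linear_imp_has_derivative has_derivative_bounded_linear)
      show "((\<lambda>u. X u - D u0 u) has_derivative (\<lambda>v. D x v - D u0 v)) (at x within ball u0 \<delta>)"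
        by (rule has_derivative_at_withinI[OF has_derivative_diff[OF der[OF xV] D0]])
      show "onorm (\<lambda>v. D x v - D u0 v) \<le> e" by (rule on[OF xd])
    qed (use u in auto)
    have "D u0 (u - u') = D u0 u - D u0 u'"
      using linear_diff[OF has_derivative_linear[OF der[OF u0]]] .
    hence eq: "X u - X u' - D u0 (u - u') = (X u - D u0 u) - (X u' - D u0 u')" by simp
    show "norm (X u - X u' - frechet_derivative X (at u0) (u - u')) \<le> e * norm (u - u')"
      unfolding D_def[symmetric] eq by (rule bound)
  qed
qed

lemma local_paramD:
  assumes "local_param M V X"
  shows "open V" "smooth_on V X" "u \<in> V \<Longrightarrow> inj (frechet_derivative X (at u))"
    "openin (top_of_set M) (X ` V)" "\<exists>g. homeomorphism V (X ` V) X g"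
  using assms unfolding local_param_def by auto

lemma local_param_linear:
  assumes "local_param M V X" "u \<in> V"
  shows "linear (frechet_derivative X (at u))"
  using has_derivative_linear[OF smooth_on_has_derivative[OF local_paramD(2)[OF assms(1)] assms(2)]] .

text \<open>Chords between nearby points of \<open>M\<close> are almost tangential. The conclusion no longer mentions the
parametrization and has two uses: chords through the base point give tangency of curves in \<open>M\<close>, and
chords between two nearby points show that \<open>M\<close> meets lines in a transversal direction at most
once near the base point.\<close>

lemma local_param_flat:
  assumes X: "local_param M V X" and u0: "u0 \<in> V"
    and \<nu>: "\<And>\<tau>. \<tau> \<in> tangent X u0 \<Longrightarrow> lor \<nu> \<tau> = 0" and e: "e > 0"
  obtains \<delta> where "\<delta> > 0"
    "\<And>q q'. q \<in> M \<Longrightarrow> q' \<in> M \<Longrightarrow> dist q (X u0) < \<delta> \<Longrightarrow> dist q' (X u0) < \<delta> \<Longrightarrow>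
      \<bar>lor \<nu> (q - q')\<bar> \<le> e * norm (q - q')"
proof -
  define D where "D = frechet_derivative X (at u0)"
  obtain c where c: "c > 0" "\<And>h. c * norm h \<le> norm (D h)"
    using linear_inj_bounded_below_pos[OF local_param_linear[OF X u0] local_paramD(3)[OF X u0]]
    unfolding D_def by metis
  \<comment> \<open>the first bound makes \<open>X\<close> expand distances by at least \<open>c / 2\<close>, the second one
    yields the slope \<open>e\<close>; the summand \<open>1\<close> only guards against division by \<open>0\<close>\<close>
  define e1 where "e1 = min (c / 2) (e * c / (2 * (norm \<nu> + 1)))"
  have n1: "norm \<nu> + 1 > 0" using norm_ge_zero[of \<nu>] by linarith
  have e1: "e1 > 0" using c e n1 by (simp add: e1_def)
  obtain d where d: "d > 0" "ball u0 d \<subseteq> V"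
    "\<And>u u'. u \<in> ball u0 d \<Longrightarrow> u' \<in> ball u0 d \<Longrightarrow>
      norm (X u - X u' - D (u - u')) \<le> e1 * norm (u - u')"
    using smooth_strict_derivative[OF local_paramD(2)[OF X] u0 e1] unfolding D_def by metis
  obtain g where g: "homeomorphism V (X ` V) X g" using local_paramD(5)[OF X] by blast
  have "openin (top_of_set (X ` V)) ((X ` V) \<inter> g -` ball u0 d)"
    by (rule continuous_openin_preimage_gen[OF homeomorphism_cont2[OF g] open_ball])
  hence "openin (top_of_set M) ((X ` V) \<inter> g -` ball u0 d)"
    using local_paramD(4)[OF X] openin_trans by blast
  moreover have "X u0 \<in> (X ` V) \<inter> g -` ball u0 d"
    using u0 d(1) homeomorphism_apply1[OF g u0] by simp
  ultimately obtain \<delta> where \<delta>: "\<delta> > 0" "ball (X u0) \<delta> \<inter> M \<subseteq> (X ` V) \<inter> g -` ball u0 d"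
    unfolding openin_contains_ball by blast
  show thesis
  proof
    show "\<delta> > 0" by fact
    fix q q' assume q: "q \<in> M" "q' \<in> M" "dist q (X u0) < \<delta>" "dist q' (X u0) < \<delta>"
    define u u' where "u = g q" and "u' = g q'"
    have "q \<in> (X ` V) \<inter> g -` ball u0 d" "q' \<in> (X ` V) \<inter> g -` ball u0 d"
      using q \<delta>(2) by (auto simp: dist_commute)
    hence u: "u \<in> ball u0 d" "u' \<in> ball u0 d" "X u = q" "X u' = q'"
      unfolding u_def u'_def using homeomorphism_apply2[OF g] by auto
    have st: "norm (q - q' - D (u - u')) \<le> e1 * norm (u - u')" using d(3)[OF u(1,2)] u by simp
    have "c * norm (u - u') \<le> norm (D (u - u'))" by (rule c)
    also have "\<dots> \<le> norm (q - q') + norm (q - q' - D (u - u'))" by norm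
    also have "\<dots> \<le> norm (q - q') + c / 2 * norm (u - u')"
    proof -
      have "e1 \<le> c / 2" unfolding e1_def by (rule min.cobounded1)
      hence "e1 * norm (u - u') \<le> c / 2 * norm (u - u')" by (rule mult_right_mono) simp
      thus ?thesis using st by simp
    qed
    finally have lower: "c / 2 * norm (u - u') \<le> norm (q - q')" by (simp add: field_simps)
    have "D (u - u') \<in> tangent X u0" by (simp add: tangent_def D_def)
    hence "\<bar>lor \<nu> (q - q')\<bar> = \<bar>lor \<nu> (q - q' - D (u - u'))\<bar>" using \<nu> by simp
    also have "\<dots> \<le> norm \<nu> * norm (q - q' - D (u - u'))" by (rule lor_bound)
    also have "\<dots> \<le> (norm \<nu> + 1) * (e1 * norm (u - u'))"
      using st n1 by (intro mult_mono) auto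
    also have "\<dots> \<le> (norm \<nu> + 1) * ((e * c / (2 * (norm \<nu> + 1))) * norm (u - u'))"
      using n1 by (intro mult_left_mono mult_right_mono) (auto simp: e1_def)
    also have "\<dots> = e * (c / 2 * norm (u - u'))" using n1 by (simp add: field_simps)
    also have "\<dots> \<le> e * norm (q - q')" using lower e by (intro mult_left_mono) auto
    finally show "\<bar>lor \<nu> (q - q')\<bar> \<le> e * norm (q - q')" .
  qed
qed

lemma curve_velocity_tangent:
  assumes X: "local_param M V X" and u0: "u0 \<in> V"
    and \<nu>: "\<And>\<tau>. \<tau> \<in> tangent X u0 \<Longrightarrow> lor \<nu> \<tau> = 0"
    and \<gamma>: "eventually (\<lambda>s. \<gamma> s \<in> M) (nhds (0::real))" "\<gamma> 0 = X u0" "(\<gamma> has_vector_derivative v) (at 0)"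
  shows "lor \<nu> v = 0"
proof -
  define Q where "Q s = (\<gamma> s - \<gamma> 0) /\<^sub>R s" for s
  have Q: "(Q \<longlongrightarrow> v) (at 0)"
  proof -
    have "((\<lambda>s. norm (\<gamma> (0 + s) - \<gamma> 0 - s *\<^sub>R v) / norm s) \<longlongrightarrow> 0) (at 0)"
      using \<gamma>(3) unfolding has_vector_derivative_def has_derivative_at by blast
    moreover have "eventually (\<lambda>s. norm (\<gamma> (0 + s) - \<gamma> 0 - s *\<^sub>R v) / norm s = norm (Q s - v)) (at 0)"
      unfolding eventually_at_filter
    proof (rule always_eventually, intro allI impI)
      fix s :: real assume "s \<noteq> 0"
      hence "Q s - v = (\<gamma> (0 + s) - \<gamma> 0 - s *\<^sub>R v) /\<^sub>R s" by (simp add: Q_def algebra_simps)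
      thus "norm (\<gamma> (0 + s) - \<gamma> 0 - s *\<^sub>R v) / norm s = norm (Q s - v)" by (simp add: divide_inverse_commute)
    qed
    ultimately have "((\<lambda>s. norm (Q s - v)) \<longlongrightarrow> 0) (at 0)" by (rule Lim_transform_eventually)
    thus ?thesis by (rule LIM_zero_cancel[OF tendsto_norm_zero_cancel])
  qed
  have M0: "X u0 \<in> M" using eventually_nhds_x_imp_x[OF \<gamma>(1)] \<gamma>(2) by simp
  have le: "\<bar>lor \<nu> v\<bar> \<le> e * norm v" if e: "e > 0" for e
  proof -
    obtain \<delta> where \<delta>: "\<delta> > 0" "\<And>q q'. q \<in> M \<Longrightarrow> q' \<in> M \<Longrightarrow> dist q (X u0) < \<delta> \<Longrightarrow> dist q' (X u0) < \<delta> \<Longrightarrow>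
      \<bar>lor \<nu> (q - q')\<bar> \<le> e * norm (q - q')"
      using local_param_flat[OF X u0 \<nu> e] by metis
    have "(\<gamma> \<longlongrightarrow> \<gamma> 0) (at 0)" using has_vector_derivative_continuous[OF \<gamma>(3)] by (simp add: continuous_at)
    hence "eventually (\<lambda>s. dist (\<gamma> s) (X u0) < \<delta>) (at 0)" using \<delta>(1) \<gamma>(2) tendstoD by metis
    moreover have "eventually (\<lambda>s. \<gamma> s \<in> M) (at 0)" using \<gamma>(1) by (simp add: eventually_nhds_conv_at)
    moreover have "eventually (\<lambda>s. s \<noteq> 0) (at (0::real))" by (simp add: eventually_at_filter)
    ultimately have ev: "eventually (\<lambda>s. \<bar>lor \<nu> (Q s)\<bar> \<le> e * norm (Q s)) (at 0)"
    proof eventually_elim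
      case (elim s)
      have "\<bar>lor \<nu> (\<gamma> s - X u0)\<bar> \<le> e * norm (\<gamma> s - X u0)"
        by (rule \<delta>(2)[OF elim(2) M0 elim(1)]) (use \<delta>(1) in simp)
      hence "\<bar>inverse s\<bar> * \<bar>lor \<nu> (\<gamma> s - X u0)\<bar> \<le> \<bar>inverse s\<bar> * (e * norm (\<gamma> s - X u0))"
        by (intro mult_left_mono) auto
      thus ?case unfolding Q_def \<gamma>(2) lor_scaleR norm_scaleR abs_mult by (simp only: mult.left_commute)
    qed
    have 1: "((\<lambda>s. \<bar>lor \<nu> (Q s)\<bar>) \<longlongrightarrow> \<bar>lor \<nu> v\<bar>) (at 0)"
      unfolding lor_inner by (intro tendsto_intros Q)
    have 2: "((\<lambda>s. e * norm (Q s)) \<longlongrightarrow> e * norm v) (at 0)" by (intro tendsto_intros Q)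
    show ?thesis by (rule tendsto_le[OF trivial_limit_at 2 1 ev])
  qed
  show ?thesis
  proof (rule ccontr)
    assume "lor \<nu> v \<noteq> 0"
    hence "v \<noteq> 0" by (auto simp: lor_def)
    hence v: "norm v > 0" by simp
    have "\<bar>lor \<nu> v\<bar> \<le> (\<bar>lor \<nu> v\<bar> / (2 * norm v)) * norm v"
      using le[of "\<bar>lor \<nu> v\<bar> / (2 * norm v)"] \<open>lor \<nu> v \<noteq> 0\<close> v by simp
    thus False using v \<open>lor \<nu> v \<noteq> 0\<close> by simp
  qed
qed

text \<open>Both sides are subspaces of dimension \<open>n\<close>.\<close>

lemma tangent_eq_orthogonal:
  fixes X :: "real^'n \<Rightarrow> ('n::finite) minkowski"
  assumes X: "local_param M V X" and u0: "u0 \<in> V"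
    and \<nu>: "\<And>\<tau>. \<tau> \<in> tangent X u0 \<Longrightarrow> lor \<nu> \<tau> = 0" "lor \<nu> \<nu> = 1"
  shows "tangent X u0 = {v. lor \<nu> v = 0}"
proof -
  let ?D = "frechet_derivative X (at u0)"
  have lin: "linear ?D" by (rule local_param_linear[OF X u0])
  have "\<nu> \<noteq> 0" using \<nu>(2) by (auto simp: lor_def)
  hence nz: "(fst \<nu>, - snd \<nu>) \<noteq> 0" by (cases \<nu>) (auto simp: zero_prod_def)
  have "dim (range ?D) = DIM(real^'n)"
    using dim_image_eq[OF lin, of UNIV] local_paramD(3)[OF X u0] by simp
  moreover have "dim {v. (fst \<nu>, - snd \<nu>) \<bullet> v = 0} = DIM('n minkowski) - 1"
    by (rule dim_hyperplane[OF nz])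
  moreover have "subspace (range ?D)" using lin by (simp add: subspace_UNIV linear_subspace_image)
  moreover have "subspace {v. (fst \<nu>, - snd \<nu>) \<bullet> v = 0}" by (rule subspace_hyperplane)
  moreover have "range ?D \<subseteq> {v. (fst \<nu>, - snd \<nu>) \<bullet> v = 0}"
    using \<nu>(1) unfolding tangent_def lor_inner by blast
  ultimately show ?thesis
    unfolding tangent_def lor_inner by (intro subspace_dim_equal) auto
qed

lemma normal_part_eq:
  assumes \<nu>: "lor \<nu> \<nu> = 1"
  shows "normal_part {v. lor \<nu> v = 0} v = lor v \<nu> *\<^sub>R \<nu>"
  unfolding normal_part_def
proof (rule the_equality)
  show "v - lor v \<nu> *\<^sub>R \<nu> \<in> {v. lor \<nu> v = 0} \<and> (\<forall>\<tau>\<in>{v. lor \<nu> v = 0}. lor (lor v \<nu> *\<^sub>R \<nu>) \<tau> = 0)"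
    using \<nu> by (simp add: lor_commute)
next
  fix w assume w: "v - w \<in> {v. lor \<nu> v = 0} \<and> (\<forall>\<tau>\<in>{v. lor \<nu> v = 0}. lor w \<tau> = 0)"
  hence 1: "lor \<nu> w = lor \<nu> v" by simp
  have "lor (w - lor v \<nu> *\<^sub>R \<nu>) z = 0" for z
  proof -
    have "z - lor \<nu> z *\<^sub>R \<nu> \<in> {v. lor \<nu> v = 0}" using \<nu> by simp
    hence "lor w (z - lor \<nu> z *\<^sub>R \<nu>) = 0" using w by blast
    hence "lor w z = lor \<nu> z * lor w \<nu>" by simp
    thus ?thesis using 1 by (simp add: lor_commute)
  qed
  thus "w = lor v \<nu> *\<^sub>R \<nu>" using lor_nondegenerate by fastforce
qed

section \<open>The soliton condition in terms of the profile\<close>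

lemma locally_zero_derivative:
  assumes "open N" "u \<in> N" "\<And>x. x \<in> N \<Longrightarrow> f x = 0" "(f has_derivative f') (at u)"
  shows "f' h = 0"
proof -
  have "((\<lambda>x. 0) has_derivative f') (at u)"
    by (rule has_derivative_transform_within_open[OF assms(4,1,2)]) (rule assms(3))
  hence "f' = (\<lambda>h. 0)" using has_derivative_unique has_derivative_const by blast
  thus ?thesis by simp
qed

text \<open>Differentiating \<open>norm (fst (X u)) = g (snd (X u))\<close>, or rather its square, once shows that
\<open>n = (x0, g g')\<close> is normal to \<open>M\<close>. A second differentiation gives the second fundamental form in
the direction of \<open>n\<close>: it is \<open>- (G + (1 - c) b b\<^sup>T)\<close>, where \<open>G\<close> is the first fundamental form,
\<open>b\<close> consists of the time components of the coordinate vectors and \<open>c = (g g')'\<close>. Its trace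
with respect to \<open>G\<close> is computed without any choice of coordinates: \<open>G\<close> itself contributes the dimension, and
\<open>b b\<^sup>T\<close> contributes the squared length of the tangential part of \<open>e_t\<close>, which is
\<open>- 1 / (1 - g'\<^sup>2)\<close>. Comparing this trace with the product of \<open>e_t\<close> and \<open>n\<close>, which is \<open>- g g'\<close>, yields the
equation.\<close>

lemma soliton_profile_equation:
  fixes X :: "real^'n \<Rightarrow> ('n::finite) minkowski"
  assumes X: "local_param M V X" and u0: "u0 \<in> V" and X0: "X u0 = (x0, t0)" "x0 \<noteq> 0"
    and \<nu>: "\<And>\<tau>. \<tau> \<in> tangent X u0 \<Longrightarrow> lor \<nu> \<tau> = 0" "lor \<nu> \<nu> = 1"
    and inv: "invertible (first_ff X u0)"
    and H: "mean_curvature_vector X u0 = normal_part (tangent X u0) e_t"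
    and I: "open I" "t0 \<in> I" and g: "\<And>t. t \<in> I \<Longrightarrow> (g has_real_derivative g1 t) (at t)"
    and g2: "(g1 has_real_derivative g2) (at t0)"
    and N: "open N" "u0 \<in> N" "N \<subseteq> V" "\<And>u. u \<in> N \<Longrightarrow> snd (X u) \<in> I \<and> norm (fst (X u)) = g (snd (X u))"
  shows "\<bar>g1 t0\<bar> < 1" "g2 = (1 - (g1 t0)\<^sup>2) * (g1 t0 - (real CARD('n) - 1) / g t0)"
proof -
  define D where "D u = frechet_derivative X (at u)" for u
  define E where "E j = frechet_derivative (pderiv_at j X) (at u0)" for j
  define Y where "Y j u = pderiv_at j X u" for j u
  have Y: "Y j u = D u (axis j 1)" for j u by (simp add: Y_def D_def pderiv_at_def)
  note sm = local_paramD(2)[OF X]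
  have dX: "(X has_derivative D u) (at u)" if "u \<in> V" for u
    unfolding D_def by (rule smooth_on_has_derivative[OF sm that])
  have dY: "(Y j has_derivative E j) (at u0)" for j
  proof -
    have "pderiv_at j X = (\<lambda>u. frechet_derivative X (at u) (axis j 1))" by (simp add: fun_eq_iff pderiv_at_def)
    hence "smooth_on V (pderiv_at j X)" using smooth_on_directional[OF sm, of "axis j 1"] by simp
    from smooth_on_has_derivative[OF this u0] show ?thesis unfolding E_def Y_def .
  qed
  have linD: "linear (D u0)" using dX[OF u0] by (rule has_derivative_linear)
  define s0 where "s0 = g t0"
  have g0: "norm x0 = s0" using N(4)[OF N(2)] X0 by (simp add: s0_def)
  hence s0: "s0 > 0" using X0(2) by auto
  define p where "p = g1 t0"
  have first: "fst (X u) \<bullet> fst (D u h) - g (snd (X u)) * g1 (snd (X u)) * snd (D u h) = 0" if u: "u \<in> N" for u h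
  proof -
    have uV: "u \<in> V" and uI: "snd (X u) \<in> I" using u N by auto
    have dg: "((\<lambda>x. g (snd (X x))) has_derivative (\<lambda>h. g1 (snd (X u)) * snd (D u h))) (at u)"
    proof -
      have "((\<lambda>x. snd (X x)) has_derivative (\<lambda>h. snd (D u h))) (at u)"
        by (rule has_derivative_snd[OF dX[OF uV]])
      from has_derivative_compose[OF this, of g "(*) (g1 (snd (X u)))"] g[OF uI]
      show ?thesis by (simp add: has_field_derivative_def)
    qed
    have dn: "((\<lambda>x. fst (X x)) has_derivative (\<lambda>h. fst (D u h))) (at u)"
      by (rule has_derivative_fst[OF dX[OF uV]])
    have der: "((\<lambda>x. fst (X x) \<bullet> fst (X x) - g (snd (X x)) * g (snd (X x))) has_derivative
        (\<lambda>h. (fst (X u) \<bullet> fst (D u h) + fst (D u h) \<bullet> fst (X u)) -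
          (g (snd (X u)) * (g1 (snd (X u)) * snd (D u h)) + g1 (snd (X u)) * snd (D u h) * g (snd (X u))))) (at u)"
      by (rule has_derivative_diff[OF has_derivative_inner[OF dn dn] has_derivative_mult[OF dg dg]])
    have zero: "fst (X x) \<bullet> fst (X x) - g (snd (X x)) * g (snd (X x)) = 0" if "x \<in> N" for x
      using N(4)[OF that] by (simp add: dot_square_norm power2_eq_square)
    have "(fst (X u) \<bullet> fst (D u h) + fst (D u h) \<bullet> fst (X u)) -
          (g (snd (X u)) * (g1 (snd (X u)) * snd (D u h)) + g1 (snd (X u)) * snd (D u h) * g (snd (X u))) = 0"
      by (rule locally_zero_derivative[OF N(1) u _ der]) (rule zero)
    thus ?thesis by (simp add: inner_commute)
  qed
  define c where "c = p * p + s0 * g2"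
  have second: "fst (Y i u0) \<bullet> fst (Y j u0) + x0 \<bullet> fst (E j (axis i 1))
      - (c * snd (Y i u0) * snd (Y j u0) + s0 * p * snd (E j (axis i 1))) = 0" for i j
  proof -
    have dg: "((\<lambda>x. g (snd (X x))) has_derivative (\<lambda>h. p * snd (D u0 h))) (at u0)"
    proof -
      have "((\<lambda>x. snd (X x)) has_derivative (\<lambda>h. snd (D u0 h))) (at u0)"
        by (rule has_derivative_snd[OF dX[OF u0]])
      from has_derivative_compose[OF this, of g "(*) p"] g[OF I(2)]
      show ?thesis by (simp add: has_field_derivative_def X0 p_def)
    qed
    have dg1: "((\<lambda>x. g1 (snd (X x))) has_derivative (\<lambda>h. g2 * snd (D u0 h))) (at u0)"
    proof -
      have "((\<lambda>x. snd (X x)) has_derivative (\<lambda>h. snd (D u0 h))) (at u0)"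
        by (rule has_derivative_snd[OF dX[OF u0]])
      from has_derivative_compose[OF this, of g1 "(*) g2"] g2
      show ?thesis by (simp add: has_field_derivative_def X0)
    qed
    have dn: "((\<lambda>x. fst (X x)) has_derivative (\<lambda>h. fst (D u0 h))) (at u0)"
      by (rule has_derivative_fst[OF dX[OF u0]])
    have dYf: "((\<lambda>x. fst (Y j x)) has_derivative (\<lambda>h. fst (E j h))) (at u0)"
      by (rule has_derivative_fst[OF dY])
    have dYs: "((\<lambda>x. snd (Y j x)) has_derivative (\<lambda>h. snd (E j h))) (at u0)"
      by (rule has_derivative_snd[OF dY])
    have der: "((\<lambda>x. fst (X x) \<bullet> fst (Y j x) - g (snd (X x)) * g1 (snd (X x)) * snd (Y j x)) has_derivative
        (\<lambda>h. (fst (X u0) \<bullet> fst (E j h) + fst (D u0 h) \<bullet> fst (Y j u0)) -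
          (g (snd (X u0)) * g1 (snd (X u0)) * snd (E j h) +
            (g (snd (X u0)) * (g2 * snd (D u0 h)) + p * snd (D u0 h) * g1 (snd (X u0))) * snd (Y j u0)))) (at u0)"
      by (rule has_derivative_diff[OF has_derivative_inner[OF dn dYf]
            has_derivative_mult[OF has_derivative_mult[OF dg dg1] dYs]])
    have zero: "fst (X x) \<bullet> fst (Y j x) - g (snd (X x)) * g1 (snd (X x)) * snd (Y j x) = 0" if "x \<in> N" for x
      using first[OF that, of "axis j 1"] by (simp add: Y)
    have "(fst (X u0) \<bullet> fst (E j (axis i 1)) + fst (D u0 (axis i 1)) \<bullet> fst (Y j u0)) -
          (g (snd (X u0)) * g1 (snd (X u0)) * snd (E j (axis i 1)) +
            (g (snd (X u0)) * (g2 * snd (D u0 (axis i 1))) + p * snd (D u0 (axis i 1)) * g1 (snd (X u0))) * snd (Y j u0)) = 0"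
      by (rule locally_zero_derivative[OF N(1,2) _ der]) (rule zero)
    thus ?thesis unfolding Y[symmetric] by (simp add: X0 c_def p_def s0_def algebra_simps)
  qed
  define n where "n = (x0, s0 * p)"
  have nT: "lor n (D u0 h) = 0" for h
    using first[OF N(2), of h] by (simp add: n_def lor_def X0 p_def s0_def)
  have nE: "lor n (E j (axis i 1)) = - (lor (Y i u0) (Y j u0) + (1 - c) * (snd (Y i u0) * snd (Y j u0)))" for i j
    using second[of i j] by (simp add: n_def lor_def algebra_simps)
  have T: "tangent X u0 = {v. lor \<nu> v = 0}" by (rule tangent_eq_orthogonal[OF X u0 \<nu>])
  define a where "a = lor n \<nu>"
  have n_eq: "n = a *\<^sub>R \<nu>"
  proof -
    have "lor (n - a *\<^sub>R \<nu>) v = 0" for v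
    proof -
      have "v - lor \<nu> v *\<^sub>R \<nu> \<in> tangent X u0" unfolding T using \<nu>(2) by simp
      then obtain h where h: "v - lor \<nu> v *\<^sub>R \<nu> = D u0 h" by (auto simp: tangent_def D_def)
      have "lor n (v - lor \<nu> v *\<^sub>R \<nu>) = 0" unfolding h by (rule nT)
      thus ?thesis by (simp add: a_def mult.commute)
    qed
    from lor_nondegenerate[OF this] show ?thesis by simp
  qed
  have "n \<noteq> 0" using X0(2) by (simp add: n_def zero_prod_def)
  hence a0: "a \<noteq> 0" using n_eq by auto
  have nn: "lor n n = a\<^sup>2"
  proof -
    have "lor n n = a * lor n \<nu>" by (subst (2) n_eq) simp
    thus ?thesis by (simp add: a_def power2_eq_square)
  qed
  have nn': "lor n n = s0\<^sup>2 * (1 - p\<^sup>2)"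
    by (simp add: n_def lor_def dot_square_norm g0 power2_eq_square algebra_simps)
  have a2: "a\<^sup>2 > 0" using a0 by simp
  have p1: "p\<^sup>2 < 1"
  proof -
    have "s0\<^sup>2 * (1 - p\<^sup>2) > 0" using nn nn' a2 by simp
    thus ?thesis using s0 by (simp add: zero_less_mult_iff)
  qed
  thus "\<bar>g1 t0\<bar> < 1" by (simp add: p_def abs_square_less_1)
  have snd\<nu>: "(snd \<nu>)\<^sup>2 = p\<^sup>2 / (1 - p\<^sup>2)"
  proof -
    have "s0 * p = a * snd \<nu>" using arg_cong[OF n_eq, of snd] by (simp add: n_def)
    hence "(s0 * p)\<^sup>2 = (a * snd \<nu>)\<^sup>2" by simp
    hence "s0\<^sup>2 * p\<^sup>2 = s0\<^sup>2 * (1 - p\<^sup>2) * (snd \<nu>)\<^sup>2" using nn nn' by (simp add: power_mult_distrib)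
    hence "p\<^sup>2 = (1 - p\<^sup>2) * (snd \<nu>)\<^sup>2" using s0 by simp
    thus ?thesis using p1 by (simp add: field_simps)
  qed
  define G where "G = first_ff X u0"
  define A where "A = matrix_inv G"
  have AG: "A ** G = mat 1"
    using inv unfolding G_def[symmetric] A_def matrix_inv_def invertible_def by (metis (mono_tags, lifting) someI_ex)
  have G: "G $ i $ j = lor (Y i u0) (Y j u0)" for i j by (simp add: G_def first_ff_def Y_def)
  define b :: "real^'n" where "b = (\<chi> i. snd (Y i u0))"
  have sff: "second_ff X u0 i j = lor (E j (axis i 1)) \<nu> *\<^sub>R \<nu>" for i j
    unfolding second_ff_def T by (subst normal_part_eq[OF \<nu>(2)]) (simp add: pderiv_at_def E_def)
  have "(\<Sum>i\<in>UNIV. \<Sum>j\<in>UNIV. A $ i $ j * lor (E j (axis i 1)) \<nu>) *\<^sub>R \<nu> = lor e_t \<nu> *\<^sub>R \<nu>"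
    using H unfolding mean_curvature_vector_def sff T normal_part_eq[OF \<nu>(2)] G_def[symmetric] A_def[symmetric]
    by (simp add: scaleR_sum_left)
  moreover have "\<nu> \<noteq> 0" using \<nu>(2) by (auto simp: lor_def)
  ultimately have sum\<nu>: "(\<Sum>i\<in>UNIV. \<Sum>j\<in>UNIV. A $ i $ j * lor (E j (axis i 1)) \<nu>) = lor e_t \<nu>" by simp
  have "(\<Sum>i\<in>UNIV. \<Sum>j\<in>UNIV. A $ i $ j * lor n (E j (axis i 1))) = lor n e_t"
  proof -
    have "(\<Sum>i\<in>UNIV. \<Sum>j\<in>UNIV. A $ i $ j * lor n (E j (axis i 1))) =
        a * (\<Sum>i\<in>UNIV. \<Sum>j\<in>UNIV. A $ i $ j * lor (E j (axis i 1)) \<nu>)"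
      unfolding sum_distrib_left n_eq by (intro sum.cong refl) (simp add: lor_commute)
    thus ?thesis unfolding sum\<nu> n_eq by (simp add: lor_commute)
  qed
  hence trace: "(\<Sum>i\<in>UNIV. \<Sum>j\<in>UNIV. A $ i $ j * (G $ i $ j + (1 - c) * (b $ i * b $ j))) = s0 * p"
  proof -
    assume *: "(\<Sum>i\<in>UNIV. \<Sum>j\<in>UNIV. A $ i $ j * lor n (E j (axis i 1))) = lor n e_t"
    have "A $ i $ j * lor n (E j (axis i 1)) = - (A $ i $ j * (G $ i $ j + (1 - c) * (b $ i * b $ j)))" for i j
      unfolding nE G b_def by (simp add: algebra_simps)
    hence "- (\<Sum>i\<in>UNIV. \<Sum>j\<in>UNIV. A $ i $ j * (G $ i $ j + (1 - c) * (b $ i * b $ j))) = lor n e_t"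
      using * by (simp only: sum_negf)
    thus ?thesis by (simp add: n_def lor_def e_t_def)
  qed
  have tr1: "(\<Sum>i\<in>UNIV. \<Sum>j\<in>UNIV. A $ i $ j * G $ i $ j) = real CARD('n)"
  proof -
    have "(\<Sum>j\<in>UNIV. A $ i $ j * G $ i $ j) = (A ** G) $ i $ i" for i
      unfolding matrix_matrix_mult_def by (simp add: G lor_commute)
    thus ?thesis unfolding AG by (simp add: mat_def)
  qed
  have tr2: "(\<Sum>i\<in>UNIV. \<Sum>j\<in>UNIV. A $ i $ j * (b $ i * b $ j)) = - 1 / (1 - p\<^sup>2)"
  proof -
    \<comment> \<open>the tangential part of \<open>e_t\<close> has coordinate vector \<open>h = - (A *v b)\<close>\<close>
    define \<tau> where "\<tau> = e_t - lor e_t \<nu> *\<^sub>R \<nu>"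
    have "\<tau> \<in> tangent X u0" unfolding T \<tau>_def using \<nu>(2) by (simp add: lor_commute)
    then obtain h where h: "\<tau> = D u0 h" by (auto simp: tangent_def D_def)
    have "h = (\<Sum>j\<in>UNIV. h $ j *\<^sub>R axis j 1)" by (simp add: basis_expansion flip: scalar_mult_eq_scaleR)
    hence "D u0 h = D u0 (\<Sum>j\<in>UNIV. h $ j *\<^sub>R axis j 1)" by simp
    also have "\<dots> = (\<Sum>j\<in>UNIV. h $ j *\<^sub>R Y j u0)"
      unfolding linear_sum[OF linD] Y by (intro sum.cong refl linear_scale[OF linD])
    finally have \<tau>h: "\<tau> = (\<Sum>j\<in>UNIV. h $ j *\<^sub>R Y j u0)" using h by simp
    have "G *v h = - b"
      unfolding vec_eq_iff
    proof
      fix i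
      have "lor \<nu> (Y i u0) = 0" using \<nu>(1) unfolding Y by (simp add: tangent_def D_def)
      hence "lor (Y i u0) \<tau> = - snd (Y i u0)" by (simp add: \<tau>_def lor_commute) (simp add: e_t_def lor_def)
      moreover have "lor (Y i u0) \<tau> = (\<Sum>j\<in>UNIV. h $ j * lor (Y i u0) (Y j u0))"
        unfolding \<tau>h lor_inner inner_sum_right by simp
      ultimately show "(G *v h) $ i = (- b) $ i"
        by (simp add: matrix_vector_mult_def G b_def mult.commute)
    qed
    hence "A *v (G *v h) = - (A *v b)" by (simp add: vec.neg)
    hence hA: "h = - (A *v b)" using AG by (simp add: matrix_vector_mul_assoc)
    have "(\<Sum>i\<in>UNIV. \<Sum>j\<in>UNIV. A $ i $ j * (b $ i * b $ j)) = (\<Sum>i\<in>UNIV. b $ i * (A *v b) $ i)"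
      unfolding matrix_vector_mult_def by (simp add: sum_distrib_left mult_ac)
    also have "\<dots> = - (\<Sum>i\<in>UNIV. h $ i * snd (Y i u0))" unfolding hA b_def by (simp add: sum_negf mult.commute)
    also have "\<dots> = - snd \<tau>" unfolding \<tau>h snd_sum by simp
    also have "\<dots> = - (1 + (snd \<nu>)\<^sup>2)" by (simp add: \<tau>_def e_t_def lor_def power2_eq_square)
    also have "\<dots> = - 1 / (1 - p\<^sup>2)" unfolding snd\<nu> using p1 by (simp add: field_simps)
    finally show ?thesis .
  qed
  have "(\<Sum>i\<in>UNIV. \<Sum>j\<in>UNIV. A $ i $ j * (G $ i $ j + (1 - c) * (b $ i * b $ j)))
      = real CARD('n) + (1 - c) * (- 1 / (1 - p\<^sup>2))"
  proof -
    have "(\<Sum>i\<in>UNIV. \<Sum>j\<in>UNIV. A $ i $ j * (G $ i $ j + (1 - c) * (b $ i * b $ j)))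
        = (\<Sum>i\<in>UNIV. \<Sum>j\<in>UNIV. A $ i $ j * G $ i $ j) + (1 - c) * (\<Sum>i\<in>UNIV. \<Sum>j\<in>UNIV. A $ i $ j * (b $ i * b $ j))"
      unfolding sum_distrib_left sum.distrib[symmetric] by (intro sum.cong refl) (simp add: algebra_simps)
    thus ?thesis unfolding tr1 tr2 .
  qed
  hence "real CARD('n) + (1 - c) * (- 1 / (1 - p\<^sup>2)) = s0 * p" using trace by simp
  hence "real CARD('n) * (1 - p\<^sup>2) - (1 - c) = s0 * p * (1 - p\<^sup>2)" using p1 by (simp add: field_simps)
  hence "s0 * g2 = (1 - p\<^sup>2) * (s0 * p - (real CARD('n) - 1))"
    unfolding c_def by (simp add: algebra_simps power2_eq_square)
  also have "\<dots> = s0 * ((1 - p\<^sup>2) * (p - (real CARD('n) - 1) / s0))" using s0 by (simp add: field_simps)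
  finally have "g2 = (1 - p\<^sup>2) * (p - (real CARD('n) - 1) / s0)" using s0 by simp
  thus "g2 = (1 - (g1 t0)\<^sup>2) * (g1 t0 - (real CARD('n) - 1) / g t0)" by (simp add: p_def s0_def)
qed

section \<open>Local shape of a rotationally invariant soliton\<close>

locale rotational_soliton =
  fixes M :: "('n::finite) minkowski set"
  assumes card: "CARD('n) \<ge> 2"
    and soliton: "translating_soliton M"
    and timelike: "timelike M"
    and invariant: "SO_invariant M"
begin

lemma rotate_mem:
  assumes "(x, t) \<in> M" "norm y = norm x"
  shows "(y, t) \<in> M"
proof -
  obtain f where f: "orthogonal_transformation f" "det (matrix f) = 1" "f x = y"
    using rotation_exists[OF card, of x y] assms(2) by metis
  have "rotation_matrix (matrix f)"
    using f orthogonal_transformation_matrix rotation_matrix_def by blast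
  hence "(\<lambda>(x, t). (matrix f *v x, t)) ` M = M"
    using invariant unfolding SO_invariant_def by blast
  moreover have "matrix f *v x = y"
    using fun_cong[OF matrix_vector_mul(2)[OF orthogonal_transformation_linear[OF f(1)]], of x] f(3) by simp
  ultimately show ?thesis using assms(1) by force
qed

lemma local_frame:
  assumes "q \<in> M"
  obtains V X u \<nu> where "local_param M V X" "u \<in> V" "X u = q"
    "\<And>\<tau>. \<tau> \<in> tangent X u \<Longrightarrow> lor \<nu> \<tau> = 0" "lor \<nu> \<nu> = 1"
proof -
  obtain V X where X: "local_param M V X" "q \<in> X ` V"
    using soliton assms unfolding translating_soliton_def hypersurface_def by blast
  then obtain u where u: "u \<in> V" "X u = q" by blast
  obtain \<nu> where "\<forall>\<tau>\<in>tangent X u. lor \<nu> \<tau> = 0" "lor \<nu> \<nu> = 1"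
    using timelike X(1) u(1) unfolding timelike_def by blast
  thus thesis using that X(1) u by blast
qed

lemma exists_orthogonal:
  fixes a :: "real^'n"
  assumes "r \<ge> 0"
  obtains y where "y \<bullet> a = 0" "norm y = r"
proof -
  have "dim {a} < DIM(real^'n)"
    using dim_le_card'[of "{a}"] card by simp
  then obtain z where z: "z \<noteq> 0" "\<And>w. w \<in> span {a} \<Longrightarrow> orthogonal z w"
    using orthogonal_to_subspace_exists by blast
  have "z \<bullet> a = 0" using z(2)[of a] span_base[of a "{a}"] by (simp add: orthogonal_def)
  thus thesis using z(1) assms by (intro that[of "(r / norm z) *\<^sub>R z"]) auto
qed

text \<open>At a point of the axis the tangent hyperplane, the orthogonal complement of \<open>\<nu> = (a, b)\<close>, is invariant under
rotations, and \<open>a \<noteq> 0\<close> because \<open>\<nu>\<close> is spacelike. Rotating the tangent vector \<open>(b a, a \<bullet> a)\<close> so that \<open>a\<close> becomes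
\<open>- a\<close> forces \<open>b = 0\<close>. Then every \<open>(y, 0)\<close> with \<open>y\<close> orthogonal to \<open>a\<close> is tangent, and
rotating \<open>y\<close> into the direction of \<open>a\<close> gives a contradiction.\<close>

lemma avoids_axis: "(0, t) \<notin> M"
proof
  assume M0: "(0, t) \<in> M"
  obtain V X u \<nu> where X: "local_param M V X" "u \<in> V" "X u = (0, t)"
    and \<nu>: "\<And>\<tau>. \<tau> \<in> tangent X u \<Longrightarrow> lor \<nu> \<tau> = 0" "lor \<nu> \<nu> = 1"
    using local_frame[OF M0] by metis
  define a b where "a = fst \<nu>" and "b = snd \<nu>"
  have ab: "a \<bullet> a - b * b = 1" using \<nu>(2) by (simp add: lor_def a_def b_def)
  have a0: "a \<bullet> a > 0" using ab zero_le_square[of b] by linarith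
  have lor\<nu>: "lor \<nu> (y, z) = a \<bullet> y - b * z" for y z by (simp add: lor_def a_def b_def)
  have T: "tangent X u = {v. lor \<nu> v = 0}" by (rule tangent_eq_orthogonal[OF X(1,2) \<nu>])
  have rot: "a \<bullet> y' - b * z = 0" if v: "a \<bullet> y - b * z = 0" and n: "norm y' = norm y" for y y' z
  proof -
    have "(y, z) \<in> tangent X u" unfolding T mem_Collect_eq lor\<nu> by (rule v)
    then obtain h where h: "(y, z) = frechet_derivative X (at u) h" by (auto simp: tangent_def)
    obtain f where f: "orthogonal_transformation f" "f y = y'"
      using rotation_exists[OF card, of y y'] n by metis
    note linf = orthogonal_transformation_linear[OF f(1)]
    define \<gamma> where "\<gamma> s = X (u + s *\<^sub>R h)" for s :: real
    have d\<gamma>: "(\<gamma> has_vector_derivative (y, z)) (at 0)"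
    proof -
      have "((\<lambda>s. u + s *\<^sub>R h) has_derivative (\<lambda>s. s *\<^sub>R h)) (at 0)"
        by (auto intro!: derivative_eq_intros)
      moreover have "(X has_derivative frechet_derivative X (at u)) (at (u + 0 *\<^sub>R h))"
        using smooth_on_has_derivative[OF local_paramD(2)[OF X(1)] X(2)] by simp
      ultimately have "((\<lambda>s. X (u + s *\<^sub>R h)) has_derivative (\<lambda>s. frechet_derivative X (at u) (s *\<^sub>R h))) (at 0)"
        by (rule has_derivative_compose)
      moreover have "frechet_derivative X (at u) (s *\<^sub>R h) = s *\<^sub>R (y, z)" for s
        unfolding h by (rule linear_scale[OF local_param_linear[OF X(1,2)]])
      ultimately show ?thesis unfolding has_vector_derivative_def \<gamma>_def[abs_def] by simp
    qed
    have "((\<lambda>s. (f (fst (\<gamma> s)), snd (\<gamma> s))) has_vector_derivative (f y, z)) (at 0)"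
    proof (rule has_vector_derivative_Pair)
      have 1: "((\<lambda>s. fst (\<gamma> s)) has_derivative (\<lambda>s. fst (s *\<^sub>R (y, z)))) (at 0)"
        using has_derivative_fst[OF d\<gamma>[unfolded has_vector_derivative_def]] .
      have 2: "(f has_derivative f) (at (fst (\<gamma> 0)))"
        using linf by (intro bounded_linear_imp_has_derivative linear_conv_bounded_linear[THEN iffD1])
      show "((\<lambda>s. f (fst (\<gamma> s))) has_vector_derivative f y) (at 0)"
        unfolding has_vector_derivative_def using has_derivative_compose[OF 1 2] linear_scale[OF linf] by simp
      show "((\<lambda>s. snd (\<gamma> s)) has_vector_derivative z) (at 0)"
        using has_derivative_snd[OF d\<gamma>[unfolded has_vector_derivative_def]]
        unfolding has_vector_derivative_def by simp
    qed
    moreover have "eventually (\<lambda>s. (f (fst (\<gamma> s)), snd (\<gamma> s)) \<in> M) (nhds 0)"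
    proof -
      have "isCont (\<lambda>s. u + s *\<^sub>R h) 0" by (intro continuous_intros)
      hence "((\<lambda>s. u + s *\<^sub>R h) \<longlongrightarrow> u) (at 0)" by (simp add: isCont_def)
      hence "eventually (\<lambda>s. u + s *\<^sub>R h \<in> V) (at 0)"
        using topological_tendstoD local_paramD(1)[OF X(1)] X(2) by blast
      hence "eventually (\<lambda>s. u + s *\<^sub>R h \<in> V) (nhds 0)" using X(2) by (simp add: eventually_nhds_conv_at)
      thus ?thesis
      proof eventually_elim
        case (elim s)
        have "\<gamma> s \<in> M" using openin_imp_subset[OF local_paramD(4)[OF X(1)]] elim unfolding \<gamma>_def by blast
        thus ?case using rotate_mem[of "fst (\<gamma> s)" "snd (\<gamma> s)" "f (fst (\<gamma> s))"]
            orthogonal_transformation_norm[OF f(1)] by simp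
      qed
    qed
    moreover have "(f (fst (\<gamma> 0)), snd (\<gamma> 0)) = X u" using X(3) linear_0[OF linf] by (simp add: \<gamma>_def)
    ultimately have "lor \<nu> (f y, z) = 0" by - (rule curve_velocity_tangent[OF X(1,2) \<nu>(1)])
    thus ?thesis using lor\<nu> f(2) by simp
  qed
  have "a \<bullet> (- b *\<^sub>R a) - b * (a \<bullet> a) = 0"
    by (rule rot[of "b *\<^sub>R a"]) auto
  hence "b = 0" using a0 by simp
  obtain y where "y \<bullet> a = 0" "norm y = norm a" using exists_orthogonal[of "norm a" a] by auto
  hence "a \<bullet> a - b * 0 = 0" using rot[of y 0 a] by (simp add: inner_commute)
  thus False using a0 by simp
qed

text \<open>The orbit of \<open>(x0, t0)\<close> is a sphere contained in \<open>M\<close>, and its great circles through this point have all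
horizontal directions orthogonal to \<open>x0\<close> as velocities.\<close>

lemma normal_radial:
  assumes X: "local_param M V X" "u \<in> V" "X u = (x0, t0)"
    and \<nu>: "\<And>\<tau>. \<tau> \<in> tangent X u \<Longrightarrow> lor \<nu> \<tau> = 0"
  shows "\<exists>l. fst \<nu> = l *\<^sub>R x0"
proof -
  have M0: "(x0, t0) \<in> M" using X openin_imp_subset[OF local_paramD(4)[OF X(1)]] by force
  hence x0: "x0 \<noteq> 0" using avoids_axis by blast
  define a where "a = fst \<nu>"
  have orth: "a \<bullet> y = 0" if y: "y \<bullet> x0 = 0" "norm y = norm x0" for y
  proof -
    define \<gamma> where "\<gamma> s = (cos s *\<^sub>R x0 + sin s *\<^sub>R y, t0)" for s :: real
    have "norm (cos s *\<^sub>R x0 + sin s *\<^sub>R y) = norm x0" for s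
    proof -
      have "(norm (cos s *\<^sub>R x0 + sin s *\<^sub>R y))\<^sup>2 = (cos s)\<^sup>2 * (norm x0)\<^sup>2 + (sin s)\<^sup>2 * (norm y)\<^sup>2"
        using y(1) unfolding power2_norm_eq_inner by (simp add: inner_add inner_commute power2_eq_square algebra_simps)
      also have "\<dots> = (norm x0)\<^sup>2" unfolding y(2) by (simp flip: distrib_right)
      finally show ?thesis by simp
    qed
    hence "\<gamma> s \<in> M" for s unfolding \<gamma>_def using rotate_mem[OF M0] by blast
    hence "eventually (\<lambda>s. \<gamma> s \<in> M) (nhds 0)" by simp
    moreover have "\<gamma> 0 = X u" by (simp add: \<gamma>_def X)
    moreover have "(\<gamma> has_vector_derivative (y, 0)) (at 0)"
      unfolding \<gamma>_def by (auto intro!: derivative_eq_intros has_vector_derivative_Pair simp: has_vector_derivative_def)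
    ultimately have "lor \<nu> (y, 0) = 0" by - (rule curve_velocity_tangent[OF X(1,2) \<nu>])
    thus ?thesis by (simp add: lor_def a_def)
  qed
  define z where "z = a - (a \<bullet> x0 / (x0 \<bullet> x0)) *\<^sub>R x0"
  have zx: "z \<bullet> x0 = 0" using x0 by (simp add: z_def inner_diff_left)
  have "z = 0"
  proof (rule ccontr)
    assume z0: "z \<noteq> 0"
    have "a \<bullet> ((norm x0 / norm z) *\<^sub>R z) = 0" by (rule orth) (use zx z0 in auto)
    hence "a \<bullet> z = 0" using x0 z0 by simp
    hence "z \<bullet> z = 0" using zx by (simp add: z_def inner_diff_left inner_commute)
    thus False using z0 by simp
  qed
  thus ?thesis unfolding z_def a_def by auto
qed

text \<open>Since \<open>\<nu>\<close> is radial and spacelike, the hyperplane orthogonal to it contains a vector of the plane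
spanned by \<open>x0\<close> and \<open>e_t\<close> with nonzero time component. A curve in \<open>M\<close> with this velocity can be parametrized by
time, and rotating it gives the points \<open>norm x = g t\<close> of \<open>M\<close>. There are no others nearby: two points of \<open>M\<close> on one
radial line at the same time differ by a multiple of a transversal direction.\<close>

lemma local_graph:
  assumes M0: "(x0, t0) \<in> M"
  obtains g g1 g2 r where "r > 0" "g t0 = norm x0"
    "\<And>t. \<bar>t - t0\<bar> < r \<Longrightarrow> g t > 0"
    "\<And>t. \<bar>t - t0\<bar> < r \<Longrightarrow> (g has_real_derivative g1 t) (at t)"
    "\<And>t. \<bar>t - t0\<bar> < r \<Longrightarrow> (g1 has_real_derivative g2 t) (at t)"
    "\<And>x t. \<bar>t - t0\<bar> < r \<Longrightarrow> norm x = g t \<Longrightarrow> (x, t) \<in> M"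
    "\<And>x t. (x, t) \<in> M \<Longrightarrow> \<bar>t - t0\<bar> < r \<Longrightarrow> \<bar>norm x - norm x0\<bar> < r \<Longrightarrow> norm x = g t"
proof -
  obtain V X u \<nu> where X: "local_param M V X" "u \<in> V" "X u = (x0, t0)"
    and \<nu>: "\<And>\<tau>. \<tau> \<in> tangent X u \<Longrightarrow> lor \<nu> \<tau> = 0" "lor \<nu> \<nu> = 1"
    using local_frame[OF M0] by metis
  note sm = local_paramD(2)[OF X(1)]
  have T: "tangent X u = {v. lor \<nu> v = 0}" by (rule tangent_eq_orthogonal[OF X(1,2) \<nu>])
  have x0: "x0 \<noteq> 0" using M0 avoids_axis by blast
  define s0 where "s0 = norm x0"
  have s0: "s0 > 0" using x0 by (simp add: s0_def)
  define e where "e = x0 /\<^sub>R s0"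
  have e1: "norm e = 1" and x0e: "x0 = s0 *\<^sub>R e" using s0 by (auto simp: e_def s0_def)
  have ee: "e \<bullet> e = 1" using e1 by (simp add: dot_square_norm)
  obtain l where l: "fst \<nu> = l *\<^sub>R x0" using normal_radial[OF X \<nu>(1)] by blast
  define \<kappa> \<mu> where "\<kappa> = l * s0" and "\<mu> = snd \<nu>"
  have lor\<nu>: "lor \<nu> (y, z) = \<kappa> * (e \<bullet> y) - \<mu> * z" for y z
    by (simp add: lor_def l x0e \<kappa>_def \<mu>_def)
  have "\<kappa> * \<kappa> - \<mu> * \<mu> = 1"
    using \<nu>(2) by (simp add: lor_def l x0e ee \<kappa>_def \<mu>_def algebra_simps)
  hence l0: "\<kappa> \<noteq> 0" using zero_le_square[of \<mu>] by (intro notI) simp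
  have "(\<mu> *\<^sub>R e, \<kappa>) \<in> tangent X u" unfolding T mem_Collect_eq lor\<nu> by (simp add: ee)
  then obtain h where h: "frechet_derivative X (at u) h = (\<mu> *\<^sub>R e, \<kappa>)" by (auto simp: tangent_def)
  define Y where "Y v = frechet_derivative X (at v) h" for v
  have smY: "smooth_on V Y" unfolding Y_def by (rule smooth_on_directional[OF sm])
  define \<alpha> \<beta> \<beta>' where "\<alpha> s = X (u + s *\<^sub>R h)" and "\<beta> s = Y (u + s *\<^sub>R h)"
    and "\<beta>' s = frechet_derivative Y (at (u + s *\<^sub>R h)) h" for s :: real
  have path: "((\<lambda>s. Z (u + s *\<^sub>R h)) has_vector_derivative frechet_derivative Z (at (u + s *\<^sub>R h)) h) (at s)"
    if Z: "smooth_on V Z" "u + s *\<^sub>R h \<in> V" for Z :: "real^'n \<Rightarrow> 'n minkowski" and s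
  proof -
    have 1: "((\<lambda>s. u + s *\<^sub>R h) has_derivative (\<lambda>s. s *\<^sub>R h)) (at s)"
      by (auto intro!: derivative_eq_intros)
    note d = smooth_on_has_derivative[OF Z]
    show ?thesis using has_derivative_compose[OF 1 d] linear_scale[OF has_derivative_linear[OF d]]
      unfolding has_vector_derivative_def by simp
  qed
  have \<alpha>0: "\<alpha> 0 = (x0, t0)" "\<beta> 0 = (\<mu> *\<^sub>R e, \<kappa>)" by (simp_all add: \<alpha>_def \<beta>_def Y_def X(3) h)
  have line: "isCont (\<lambda>s. u + s *\<^sub>R h) s" for s :: real by (intro continuous_intros)
  have cont\<alpha>: "isCont \<alpha> 0" unfolding \<alpha>_def
    by (rule isCont_o2[OF line]) (use smooth_on_isCont[OF sm X(2)] in simp)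
  have cont\<beta>: "isCont \<beta> 0" unfolding \<beta>_def
    by (rule isCont_o2[OF line]) (use smooth_on_isCont[OF smY X(2)] in simp)
  have ev1: "eventually (\<lambda>s. u + s *\<^sub>R h \<in> V) (nhds 0)"
  proof -
    have "((\<lambda>s. u + s *\<^sub>R h) \<longlongrightarrow> u) (at 0)" using line[of 0] by (simp add: isCont_def)
    hence "eventually (\<lambda>s. u + s *\<^sub>R h \<in> V) (at 0)"
      by (rule topological_tendstoD[OF _ local_paramD(1)[OF X(1)] X(2)])
    thus ?thesis using X(2) by (simp add: eventually_nhds_conv_at)
  qed
  have ev2: "eventually (\<lambda>s. snd (\<beta> s) \<noteq> 0) (nhds 0)"
  proof -
    have "((\<lambda>s. snd (\<beta> s)) \<longlongrightarrow> \<kappa>) (at 0)" using tendsto_snd[OF cont\<beta>[unfolded isCont_def]] by (simp add: \<alpha>0)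
    hence "eventually (\<lambda>s. snd (\<beta> s) \<noteq> 0) (at 0)" using l0 by (rule tendsto_imp_eventually_ne)
    thus ?thesis using l0 by (simp add: eventually_nhds_conv_at \<alpha>0)
  qed
  have ev3: "eventually (\<lambda>s. fst (\<alpha> s) \<noteq> 0) (nhds 0)"
  proof -
    have "((\<lambda>s. fst (\<alpha> s)) \<longlongrightarrow> x0) (at 0)" using tendsto_fst[OF cont\<alpha>[unfolded isCont_def]] by (simp add: \<alpha>0)
    hence "eventually (\<lambda>s. fst (\<alpha> s) \<noteq> 0) (at 0)" using x0 by (rule tendsto_imp_eventually_ne)
    thus ?thesis using x0 by (simp add: eventually_nhds_conv_at \<alpha>0)
  qed
  obtain d where d: "d > 0" "\<And>s. \<bar>s\<bar> < d \<Longrightarrow> u + s *\<^sub>R h \<in> V \<and> snd (\<beta> s) \<noteq> 0 \<and> fst (\<alpha> s) \<noteq> 0"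
    using eventually_conj[OF ev1 eventually_conj[OF ev2 ev3]]
    unfolding eventually_nhds_metric by (auto simp: dist_real_def)
  define I where "I = {-d<..<d}"
  have I: "s \<in> I \<longleftrightarrow> \<bar>s\<bar> < d" for s by (auto simp: I_def)
  have d\<alpha>: "(\<alpha> has_vector_derivative \<beta> s) (at s)" if "s \<in> I" for s
    unfolding \<alpha>_def \<beta>_def Y_def by (rule path[OF sm]) (use d(2)[of s] that in \<open>simp add: I\<close>)
  have d\<beta>: "(\<beta> has_vector_derivative \<beta>' s) (at s)" if "s \<in> I" for s
    unfolding \<beta>_def \<beta>'_def by (rule path[OF smY]) (use d(2)[of s] that in \<open>simp add: I\<close>)
  have dsnd: "((\<lambda>s. snd (\<alpha> s)) has_real_derivative snd (\<beta> s)) (at s)"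
      "((\<lambda>s. snd (\<beta> s)) has_real_derivative snd (\<beta>' s)) (at s)" if "s \<in> I" for s
    using has_derivative_snd[OF d\<alpha>[OF that, unfolded has_vector_derivative_def]]
      has_derivative_snd[OF d\<beta>[OF that, unfolded has_vector_derivative_def]]
    unfolding has_real_derivative_iff_has_vector_derivative has_vector_derivative_def by simp_all
  have dfst: "((\<lambda>s. fst (\<alpha> s)) has_derivative (\<lambda>r. r *\<^sub>R fst (\<beta> s))) (at s)"
      "((\<lambda>s. fst (\<beta> s)) has_derivative (\<lambda>r. r *\<^sub>R fst (\<beta>' s))) (at s)" if "s \<in> I" for s
    using has_derivative_fst[OF d\<alpha>[OF that, unfolded has_vector_derivative_def]]
      has_derivative_fst[OF d\<beta>[OF that, unfolded has_vector_derivative_def]] by simp_all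
  define P where "P s = fst (\<alpha> s) \<bullet> fst (\<beta> s)" for s
  define P' where "P' s = fst (\<alpha> s) \<bullet> fst (\<beta>' s) + fst (\<beta> s) \<bullet> fst (\<beta> s)" for s
  define R where "R s = norm (fst (\<alpha> s))" for s
  have R0: "R s > 0" if "s \<in> I" for s using d(2)[of s] that by (simp add: I R_def)
  have dP: "(P has_real_derivative P' s) (at s)" if "s \<in> I" for s
  proof -
    have "(P has_derivative (\<lambda>r. fst (\<alpha> s) \<bullet> (r *\<^sub>R fst (\<beta>' s)) + (r *\<^sub>R fst (\<beta> s)) \<bullet> fst (\<beta> s))) (at s)"
      unfolding P_def by (rule has_derivative_inner[OF dfst[OF that]])
    thus ?thesis unfolding has_field_derivative_def by (rule has_derivative_eq_rhs) (simp add: P'_def fun_eq_iff algebra_simps)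
  qed
  have dR: "(R has_real_derivative P s / R s) (at s)" if s: "s \<in> I" for s
  proof -
    have "((\<lambda>s. fst (\<alpha> s) \<bullet> fst (\<alpha> s)) has_derivative
        (\<lambda>r. fst (\<alpha> s) \<bullet> (r *\<^sub>R fst (\<beta> s)) + (r *\<^sub>R fst (\<beta> s)) \<bullet> fst (\<alpha> s))) (at s)"
      by (rule has_derivative_inner[OF dfst(1)[OF s] dfst(1)[OF s]])
    hence "((\<lambda>s. fst (\<alpha> s) \<bullet> fst (\<alpha> s)) has_real_derivative 2 * P s) (at s)"
      unfolding has_field_derivative_def
      by (rule has_derivative_eq_rhs) (simp add: P_def fun_eq_iff algebra_simps inner_commute)
    moreover have "fst (\<alpha> s) \<bullet> fst (\<alpha> s) > 0" using d(2)[of s] s by (simp add: I)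
    ultimately have "((\<lambda>s. sqrt (fst (\<alpha> s) \<bullet> fst (\<alpha> s))) has_real_derivative
        inverse (sqrt (fst (\<alpha> s) \<bullet> fst (\<alpha> s))) / 2 * (2 * P s)) (at s)"
      by - (rule DERIV_chain2[where f = sqrt, OF DERIV_real_sqrt])
    hence "(R has_real_derivative inverse (sqrt (fst (\<alpha> s) \<bullet> fst (\<alpha> s))) / 2 * (2 * P s)) (at s)"
      unfolding R_def[abs_def] norm_eq_sqrt_inner .
    moreover have "inverse b / 2 * (2 * c) = c / b" for b c :: real by (cases "b = 0") (simp_all add: field_simps)
    ultimately show ?thesis unfolding R_def[of s] norm_eq_sqrt_inner by (rule DERIV_cong)
  qed
  define W where "W s = snd (\<alpha> s)" for s
  have W0: "W 0 = t0" "0 \<in> I" using d(1) by (simp_all add: W_def \<alpha>0 I)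
  obtain \<theta> where \<theta>: "open (W ` I)" "\<And>s. s \<in> I \<Longrightarrow> \<theta> (W s) = s"
    "\<And>t. t \<in> W ` I \<Longrightarrow> (\<theta> has_real_derivative 1 / snd (\<beta> (\<theta> t))) (at t)"
  proof (rule inverse_function_interval[where J = I and h = W and h' = "\<lambda>s. snd (\<beta> s)"])
    show "open I" "is_interval I" by (simp_all add: I_def is_interval_oo)
    show "(W has_real_derivative snd (\<beta> s)) (at s)" if "s \<in> I" for s unfolding W_def by (rule dsnd(1)[OF that])
    show "snd (\<beta> s) \<noteq> 0" if "s \<in> I" for s using d(2)[of s] that by (simp add: I)
  qed blast
  have \<theta>I: "\<theta> t \<in> I" "W (\<theta> t) = t" if "t \<in> W ` I" for t using that \<theta>(2) by auto
  define g where "g t = R (\<theta> t)" for t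
  define Q where "Q s = P s / R s / snd (\<beta> s)" for s
  define g1 where "g1 t = Q (\<theta> t)" for t
  have dg: "(g has_real_derivative g1 t) (at t)" if t: "t \<in> W ` I" for t
    using DERIV_chain2[where f = R and g = \<theta>, OF dR[OF \<theta>I(1)[OF t]] \<theta>(3)[OF t]]
    unfolding g_def g1_def Q_def by simp
  have "\<exists>z. (g1 has_real_derivative z) (at t)" if t: "t \<in> W ` I" for t
  proof -
    note s = \<theta>I(1)[OF t]
    have nz: "R (\<theta> t) \<noteq> 0" "snd (\<beta> (\<theta> t)) \<noteq> 0" using R0[OF s] d(2)[of "\<theta> t"] s by (auto simp: I)
    have "\<exists>z. (Q has_real_derivative z) (at (\<theta> t))"
      unfolding Q_def by (rule exI, rule DERIV_divide[OF DERIV_divide[OF dP[OF s] dR[OF s] nz(1)] dsnd(2)[OF s] nz(2)])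
    then obtain z where z: "(Q has_real_derivative z) (at (\<theta> t))" by blast
    show ?thesis unfolding g1_def
      by (rule exI, rule DERIV_chain2[where f = Q and g = \<theta>, OF z \<theta>(3)[OF t]])
  qed
  then obtain g2 where dg1: "\<And>t. t \<in> W ` I \<Longrightarrow> (g1 has_real_derivative g2 t) (at t)" by metis
  have graph: "(x, t) \<in> M" if t: "t \<in> W ` I" and x: "norm x = g t" for x t
  proof -
    have "\<alpha> (\<theta> t) \<in> M"
      using openin_imp_subset[OF local_paramD(4)[OF X(1)]] d(2)[of "\<theta> t"] \<theta>I(1)[OF t] unfolding \<alpha>_def I by blast
    moreover have "\<alpha> (\<theta> t) = (fst (\<alpha> (\<theta> t)), t)" using \<theta>I(2)[OF t] by (simp add: W_def prod_eq_iff)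
    ultimately show ?thesis using rotate_mem[of "fst (\<alpha> (\<theta> t))" t x] x by (simp add: g_def R_def)
  qed
  have t0I: "t0 \<in> W ` I" using W0 by force
  have gt0: "g t0 = s0" using \<theta>(2)[OF W0(2)] W0(1) by (simp add: g_def R_def \<alpha>0 s0_def)
  \<comment> \<open>chords of \<open>M\<close> along the radial direction \<open>e\<close> have slope \<open>\<bar>\<kappa>\<bar>\<close> against \<open>\<nu>\<close>; flatness
    with half this slope excludes them\<close>
  have "\<bar>\<kappa>\<bar> / 2 > 0" using l0 by simp
  then obtain \<delta> where \<delta>: "\<delta> > 0" "\<And>q q'. q \<in> M \<Longrightarrow> q' \<in> M \<Longrightarrow> dist q (x0, t0) < \<delta> \<Longrightarrow> dist q' (x0, t0) < \<delta> \<Longrightarrow>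
      \<bar>lor \<nu> (q - q')\<bar> \<le> \<bar>\<kappa>\<bar> / 2 * norm (q - q')"
    using local_param_flat[OF X(1,2) \<nu>(1), unfolded X(3)] by metis
  have near: "dist (a *\<^sub>R e, t) (x0, t0) < \<delta>" if "\<bar>a - s0\<bar> < \<delta> / 2" "\<bar>t - t0\<bar> < \<delta> / 2" for a t
  proof -
    have "a *\<^sub>R e - x0 = (a - s0) *\<^sub>R e" by (simp add: x0e algebra_simps)
    hence "dist (a *\<^sub>R e) x0 = \<bar>a - s0\<bar>" by (simp add: dist_norm e1)
    moreover have "dist (a *\<^sub>R e, t) (x0, t0) \<le> dist (a *\<^sub>R e) x0 + dist t t0"
      unfolding dist_Pair_Pair by (rule sqrt_sum_squares_le_sum) auto
    ultimately show ?thesis using that by (simp add: dist_real_def)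
  qed
  have uniq: "a = b" if ab: "(a *\<^sub>R e, t) \<in> M" "(b *\<^sub>R e, t) \<in> M" "\<bar>a - s0\<bar> < \<delta> / 2" "\<bar>b - s0\<bar> < \<delta> / 2" "\<bar>t - t0\<bar> < \<delta> / 2" for a b t
  proof -
    have diff: "(a *\<^sub>R e, t) - (b *\<^sub>R e, t) = ((a - b) *\<^sub>R e, 0)" by (simp add: algebra_simps)
    have "\<bar>lor \<nu> ((a *\<^sub>R e, t) - (b *\<^sub>R e, t))\<bar> \<le> \<bar>\<kappa>\<bar> / 2 * norm ((a *\<^sub>R e, t) - (b *\<^sub>R e, t))"
      by (rule \<delta>(2)) (use ab near in auto)
    hence "\<bar>\<kappa>\<bar> * \<bar>a - b\<bar> \<le> \<bar>\<kappa>\<bar> / 2 * \<bar>a - b\<bar>"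
      unfolding diff lor\<nu> by (simp add: ee abs_mult e1 norm_Pair)
    hence "\<bar>\<kappa>\<bar> * \<bar>a - b\<bar> \<le> 0" by simp
    thus ?thesis using l0 by (simp add: mult_le_0_iff)
  qed
  have "isCont g t0" using dg[OF t0I] by (rule DERIV_isCont)
  hence "eventually (\<lambda>t. dist (g t) (g t0) < \<delta> / 2) (at t0)"
    unfolding isCont_def using \<delta>(1) by (intro tendstoD) auto
  hence "eventually (\<lambda>t. dist (g t) s0 < \<delta> / 2) (nhds t0)"
    using \<delta>(1) by (simp add: eventually_nhds_conv_at gt0)
  moreover have "eventually (\<lambda>t. t \<in> W ` I) (nhds t0)" using \<theta>(1) t0I by (rule eventually_nhds_in_open)
  ultimately obtain r0 where r0: "r0 > 0" "\<And>t. \<bar>t - t0\<bar> < r0 \<Longrightarrow> \<bar>g t - s0\<bar> < \<delta> / 2 \<and> t \<in> W ` I"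
    using eventually_conj unfolding eventually_nhds_metric dist_real_def by (metis (no_types, lifting) min_less_iff_conj)
  show thesis
  proof
    show "min r0 (\<delta> / 2) > 0" using r0 \<delta> by simp
    show "g t0 = norm x0" using gt0 by (simp add: s0_def)
    show "g t > 0" if "\<bar>t - t0\<bar> < min r0 (\<delta> / 2)" for t
      using r0(2)[of t] that R0[OF \<theta>I(1)[of t]] by (simp add: g_def)
    show "(g has_real_derivative g1 t) (at t)" if "\<bar>t - t0\<bar> < min r0 (\<delta> / 2)" for t
      using dg r0(2)[of t] that by simp
    show "(g1 has_real_derivative g2 t) (at t)" if "\<bar>t - t0\<bar> < min r0 (\<delta> / 2)" for t
      using dg1 r0(2)[of t] that by simp
    show "(x, t) \<in> M" if "\<bar>t - t0\<bar> < min r0 (\<delta> / 2)" "norm x = g t" for x t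
      using graph r0(2)[of t] that by simp
    show "norm x = g t" if x: "(x, t) \<in> M" "\<bar>t - t0\<bar> < min r0 (\<delta> / 2)" "\<bar>norm x - norm x0\<bar> < min r0 (\<delta> / 2)" for x t
    proof (rule uniq)
      have rt: "\<bar>g t - s0\<bar> < \<delta> / 2" "t \<in> W ` I" using r0(2)[of t] x by auto
      have gpos: "g t > 0" using R0[OF \<theta>I(1)[OF rt(2)]] by (simp add: g_def)
      show "(norm x *\<^sub>R e, t) \<in> M" by (rule rotate_mem[OF x(1)]) (simp add: e1)
      show "(g t *\<^sub>R e, t) \<in> M" by (rule graph[OF rt(2)]) (use gpos in \<open>simp add: e1\<close>)
      show "\<bar>g t - s0\<bar> < \<delta> / 2" by (rule rt(1))
    qed (use x in \<open>simp_all add: s0_def\<close>)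
  qed
qed

text \<open>The local graph describes \<open>M\<close> near each of its own points whose radius is close to \<open>norm x0\<close>, so
the equation holds at all times near \<open>t0\<close>.\<close>

lemma local_profile:
  assumes M0: "(x0, t0) \<in> M"
  obtains g p r where "r > 0" "g t0 = norm x0"
    "profile_solution (real CARD('n) - 1) {t0 - r<..<t0 + r} g p"
    "\<And>x t. \<bar>t - t0\<bar> < r \<Longrightarrow> \<bar>norm x - norm x0\<bar> < r \<Longrightarrow> (x, t) \<in> M \<longleftrightarrow> norm x = g t"
    "\<And>x t. \<bar>t - t0\<bar> < r \<Longrightarrow> norm x = g t \<Longrightarrow> (x, t) \<in> M"
proof (rule local_graph[OF M0])
  fix g g1 g2 :: "real \<Rightarrow> real" and r :: real
  assume r: "r > 0" and gt0: "g t0 = norm x0"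
    and pos: "\<And>t. \<bar>t - t0\<bar> < r \<Longrightarrow> g t > 0"
    and dg: "\<And>t. \<bar>t - t0\<bar> < r \<Longrightarrow> (g has_real_derivative g1 t) (at t)"
    and dg1: "\<And>t. \<bar>t - t0\<bar> < r \<Longrightarrow> (g1 has_real_derivative g2 t) (at t)"
    and mem: "\<And>x t. \<bar>t - t0\<bar> < r \<Longrightarrow> norm x = g t \<Longrightarrow> (x, t) \<in> M"
    and eq: "\<And>x t. (x, t) \<in> M \<Longrightarrow> \<bar>t - t0\<bar> < r \<Longrightarrow> \<bar>norm x - norm x0\<bar> < r \<Longrightarrow> norm x = g t"
  have "isCont g t0" using dg[of t0] r by (intro DERIV_isCont) auto
  hence "eventually (\<lambda>t. dist (g t) (g t0) < r) (at t0)"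
    unfolding isCont_def using r by (rule tendstoD)
  hence "eventually (\<lambda>t. dist (g t) (g t0) < r) (nhds t0)" using r by (simp add: eventually_nhds_conv_at)
  then obtain r' where r': "r' > 0" "\<And>t. \<bar>t - t0\<bar> < r' \<Longrightarrow> \<bar>g t - norm x0\<bar> < r"
    unfolding eventually_nhds_metric dist_real_def gt0 by blast
  define \<rho> where "\<rho> = min r r'"
  have \<rho>: "\<rho> > 0" using r r' by (simp add: \<rho>_def)
  have both: "\<bar>g1 t\<bar> < 1 \<and> g2 t = (1 - (g1 t)\<^sup>2) * (g1 t - (real CARD('n) - 1) / g t)" if t: "\<bar>t - t0\<bar> < \<rho>" for t
  proof -
    have tr: "\<bar>t - t0\<bar> < r" "\<bar>g t - norm x0\<bar> < r" using t r'(2)[of t] by (auto simp: \<rho>_def)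
    obtain x :: "real^'n" where x: "norm x = g t" using vector_choose_size pos[OF tr(1)] less_imp_le by metis
    have xM: "(x, t) \<in> M" using mem[OF tr(1) x] .
    obtain V X u \<nu> where X: "local_param M V X" "u \<in> V" "X u = (x, t)"
      and \<nu>: "\<And>\<tau>. \<tau> \<in> tangent X u \<Longrightarrow> lor \<nu> \<tau> = 0" "lor \<nu> \<nu> = 1"
      using local_frame[OF xM] by metis
    define O' :: "'n minkowski set" where "O' = {q. \<bar>snd q - t0\<bar> < r \<and> \<bar>norm (fst q) - norm x0\<bar> < r}"
    have "open O'" unfolding O'_def
      by (intro open_Collect_conj open_Collect_less continuous_intros)
    define N where "N = V \<inter> X -` O'"
    have "open N" unfolding N_def
      by (rule continuous_open_preimage[OF smooth_on_continuous[OF local_paramD(2)[OF X(1)]] local_paramD(1)[OF X(1)] \<open>open O'\<close>])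
    have sol: "invertible (first_ff X u)" "mean_curvature_vector X u = normal_part (tangent X u) e_t"
      using soliton X(1,2) unfolding translating_soliton_def by blast+
    have XM: "X v \<in> M" if "v \<in> V" for v
      using openin_imp_subset[OF local_paramD(4)[OF X(1)]] that by blast
    have IO: "snd (X v) \<in> {t0 - r<..<t0 + r} \<and> norm (fst (X v)) = g (snd (X v))" if "v \<in> N" for v
    proof -
      have "X v \<in> O'" "(fst (X v), snd (X v)) \<in> M" using that XM by (auto simp: N_def)
      thus ?thesis using eq[of "fst (X v)" "snd (X v)"] unfolding O'_def by auto
    qed
    have dgI: "(g has_real_derivative g1 t) (at t)" if "t \<in> {t0 - r<..<t0 + r}" for t
      by (rule dg) (use that in auto)
    have "x \<noteq> 0" using x pos[OF tr(1)] by auto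
    have uN: "u \<in> N" using X tr x by (simp add: N_def O'_def)
    have NV: "N \<subseteq> V" by (simp add: N_def)
    have tI: "t \<in> {t0 - r<..<t0 + r}" using tr by auto
    show ?thesis
      using soliton_profile_equation[OF X \<open>x \<noteq> 0\<close> \<nu> sol open_greaterThanLessThan tI dgI dg1[OF tr(1)] \<open>open N\<close> uN NV IO]
      by blast
  qed
  have ode: "\<bar>g1 t\<bar> < 1" "g2 t = (1 - (g1 t)\<^sup>2) * (g1 t - (real CARD('n) - 1) / g t)" if "\<bar>t - t0\<bar> < \<rho>" for t
    using both[OF that] by (rule conjunct1, rule conjunct2)
  show thesis
  proof
    show "\<rho> > 0" "g t0 = norm x0" by (rule \<rho>, rule gt0)
    show "profile_solution (real CARD('n) - 1) {t0 - \<rho><..<t0 + \<rho>} g g1"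
      unfolding profile_solution_def
    proof (intro conjI ballI)
      fix t assume "t \<in> {t0 - \<rho><..<t0 + \<rho>}"
      hence t: "\<bar>t - t0\<bar> < \<rho>" "\<bar>t - t0\<bar> < r" by (auto simp: \<rho>_def)
      show "g t > 0" "\<bar>g1 t\<bar> < 1" "(g has_real_derivative g1 t) (at t)"
        by (rule pos[OF t(2)], rule ode(1)[OF t(1)], rule dg[OF t(2)])
      show "(g1 has_real_derivative (1 - (g1 t)\<^sup>2) * (g1 t - (real CARD('n) - 1) / g t)) (at t)"
        using dg1[OF t(2)] unfolding ode(2)[OF t(1)] .
    qed (simp_all add: is_interval_oo)
    show "(x, t) \<in> M \<longleftrightarrow> norm x = g t" if "\<bar>t - t0\<bar> < \<rho>" "\<bar>norm x - norm x0\<bar> < \<rho>" for x t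
      using eq[of x t] mem[of t x] that by (auto simp: \<rho>_def)
    show "(x, t) \<in> M" if "\<bar>t - t0\<bar> < \<rho>" "norm x = g t" for x t
      using mem[of t x] that by (simp add: \<rho>_def)
  qed
qed

end

section \<open>From local to global\<close>

lemma Ck_on_const: "Ck_on k S (\<lambda>_. c)"
proof (induction k arbitrary: c)
  case (Suc k)
  thus ?case by (simp add: frechet_derivative_const)
qed simp

lemma lor_isometry_id: "lor_isometry (\<lambda>p :: ('n::finite) minkowski. p)"
proof -
  have fd: "frechet_derivative (\<lambda>p. p) (at p) v = v" for p v :: "('n::finite) minkowski"
    by (simp flip: id_def)
  have "Ck_on k UNIV (\<lambda>p :: ('n::finite) minkowski. p)" for k
    by (cases k) (simp_all add: fd Ck_on_const)
  hence "smooth_on UNIV (\<lambda>p :: ('n::finite) minkowski. p)" by (simp add: smooth_on_def)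
  moreover have "inv (\<lambda>p :: ('n::finite) minkowski. p) = (\<lambda>p. p)" using inv_id by (simp add: id_def)
  moreover have "bij (\<lambda>p :: ('n::finite) minkowski. p)" using bij_id by (simp add: id_def)
  ultimately show ?thesis by (simp add: lor_isometry_def fd)
qed

lemma exists_example:
  assumes "k = real CARD('n::finite) - 1" "k > 0" and "g0 > 0" "\<bar>p0\<bar> < 1"
  obtains J g p and S :: "('n::finite) minkowski set"
  where "maximal_solution k J g p" "t0 \<in> J" "g t0 = g0" "p t0 = p0"
    "ogival_paraboloid S \<or> timelike_calyx S \<or> spindle S"
    "\<And>x t. x \<noteq> 0 \<Longrightarrow> (x, t) \<in> S \<longleftrightarrow> t \<in> J \<and> norm x = g t"
proof (rule exists_maximal_solution[where k = k and ?g0.0 = g0 and ?p0.0 = p0 and ?t0.0 = t0])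
  fix J g p assume J: "maximal_solution k J g p" "t0 \<in> J" "g t0 = g0" "p t0 = p0"
  interpret maximal_profile k J g p
    by unfold_locales (use J assms(2) in auto)
  show thesis
  proof (rule exists_rotational_example[OF assms(1)])
    fix S :: "'n minkowski set"
    assume "ogival_paraboloid S \<or> timelike_calyx S \<or> spindle S"
      "\<And>x t. x \<noteq> 0 \<Longrightarrow> (x, t) \<in> S \<longleftrightarrow> t \<in> J \<and> norm x = g t"
    thus thesis by (rule that[OF J])
  qed
qed (use assms in auto)

context rotational_soliton
begin

text \<open>Coincidence of \<open>M\<close> with the rotated graph of \<open>G\<close> near the whole orbit of \<open>q\<close>.\<close>

definition matches_near :: "real set \<Rightarrow> (real \<Rightarrow> real) \<Rightarrow> (real^'n) \<times> real \<Rightarrow> real \<Rightarrow> bool" where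
  "matches_near J G q r \<longleftrightarrow> (\<forall>y \<tau>. \<bar>\<tau> - snd q\<bar> < r \<longrightarrow> \<bar>norm y - norm (fst q)\<bar> < r \<longrightarrow>
     ((y, \<tau>) \<in> M \<longleftrightarrow> \<tau> \<in> J \<and> norm y = G \<tau>))"

text \<open>A contact of first order between the local profile at \<open>(x, t)\<close> and a maximal solution makes them agree.
The contact time \<open>t'\<close> is only close to \<open>t\<close>, and the extension time of the maximal solution, which is uniform for
radii above \<open>g t / 2\<close>, ensures that \<open>J\<close> contains a neighbourhood of \<open>t\<close>.\<close>

lemma matches_near_if_tangent:
  assumes max: "maximal_solution k J G P" and k: "k \<ge> 0"
    and sol: "profile_solution k {t - r<..<t + r} g p" and r: "r > 0"
    and M: "\<And>y \<tau>. \<bar>\<tau> - t\<bar> < r \<Longrightarrow> \<bar>norm y - norm x\<bar> < r \<Longrightarrow> (y, \<tau>) \<in> M \<longleftrightarrow> norm y = g \<tau>"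
  obtains d where "d > 0" "d \<le> r"
    "\<And>t'. \<bar>t' - t\<bar> < d \<Longrightarrow> t' \<in> J \<Longrightarrow> g t' = G t' \<Longrightarrow> p t' = P t' \<Longrightarrow> \<exists>\<rho>>0. matches_near J G (x, t) \<rho>"
proof -
  note sol' = max[unfolded maximal_solution_def, THEN conjunct1]
  have tI: "t \<in> {t - r<..<t + r}" using r by simp
  define c where "c = g t / 2"
  have c: "c > 0" using profile_solutionD(3)[OF sol tI] by (simp add: c_def)
  obtain \<eta> where \<eta>: "\<eta> > 0" "\<And>s. s \<in> J \<Longrightarrow> G s \<ge> c \<Longrightarrow> {s - \<eta>..s + \<eta>} \<subseteq> J"
    using max c unfolding maximal_solution_def by blast
  have "isCont g t" using profile_solutionD(5)[OF sol tI] by (rule DERIV_isCont)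
  hence "eventually (\<lambda>s. dist (g s) (g t) < c) (at t)" unfolding isCont_def using c by (rule tendstoD)
  hence "eventually (\<lambda>s. dist (g s) (g t) < c) (nhds t)" using c by (simp add: eventually_nhds_conv_at)
  then obtain r1 where r1: "r1 > 0" "\<And>s. \<bar>s - t\<bar> < r1 \<Longrightarrow> \<bar>g s - g t\<bar> < c"
    unfolding eventually_nhds_metric dist_real_def by blast
  define d where "d = Min {r, r1, \<eta> / 2}"
  have d: "d > 0" "d \<le> r" "d \<le> r1" "d \<le> \<eta> / 2" using r r1 \<eta> by (auto simp: d_def)
  show thesis
  proof (rule that[OF d(1,2)])
    fix t' assume t': "\<bar>t' - t\<bar> < d" "t' \<in> J" "g t' = G t'" "p t' = P t'"
    have "\<bar>g t' - g t\<bar> < c" using r1(2)[of t'] t'(1) d by simp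
    hence "G t' \<ge> c" using t'(3) unfolding c_def abs_less_iff by linarith
    hence sub: "{t' - \<eta>..t' + \<eta>} \<subseteq> J" by (rule \<eta>(2)[OF t'(2)])
    have inJ: "\<tau> \<in> J" if "\<bar>\<tau> - t\<bar> < d" for \<tau>
    proof -
      have "\<tau> \<in> {t' - \<eta>..t' + \<eta>}" using that t'(1) d(4) by (simp add: abs_less_iff)
      thus ?thesis using sub by blast
    qed
    have eq: "g \<tau> = G \<tau>" if "\<bar>\<tau> - t\<bar> < d" for \<tau>
    proof (rule profile_solution_unique(1)[OF sol sol' k _ t'(2,3,4)])
      show "t' \<in> {t - r<..<t + r}" using t'(1) d(2) by (simp add: abs_less_iff)
      show "\<tau> \<in> {t - r<..<t + r}" using that d(2) by (simp add: abs_less_iff)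
      show "\<tau> \<in> J" by (rule inJ[OF that])
    qed
    have "matches_near J G (x, t) d"
      unfolding matches_near_def fst_conv snd_conv
    proof (intro allI impI)
      fix y :: "real^'n" and \<tau> assume a: "\<bar>\<tau> - t\<bar> < d" "\<bar>norm y - norm x\<bar> < d"
      have "(y, \<tau>) \<in> M \<longleftrightarrow> norm y = g \<tau>" by (rule M) (use a d(2) in auto)
      thus "(y, \<tau>) \<in> M \<longleftrightarrow> \<tau> \<in> J \<and> norm y = G \<tau>" using inJ[OF a(1)] eq[OF a(1)] by simp
    qed
    thus "\<exists>\<rho>>0. matches_near J G (x, t) \<rho>" using d(1) by blast
  qed
qed

lemma dist_bounds:
  fixes q q' :: "'n minkowski"
  assumes "dist q q' < r"
  shows "\<bar>snd q - snd q'\<bar> < r" "\<bar>norm (fst q) - norm (fst q')\<bar> < r" "norm (fst q - fst q') < r"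
proof -
  have 1: "dist (fst q) (fst q') < r" "dist (snd q) (snd q') < r"
    using assms dist_fst_le[of q q'] dist_snd_le[of q q'] by linarith+
  thus "\<bar>snd q - snd q'\<bar> < r" by (simp add: dist_real_def)
  show "norm (fst q - fst q') < r" using 1 by (simp add: dist_norm)
  thus "\<bar>norm (fst q) - norm (fst q')\<bar> < r" using norm_triangle_ineq3[of "fst q" "fst q'"] by linarith
qed

text \<open>The points where \<open>M\<close> matches the graph of \<open>G\<close> form an open subset of \<open>M\<close>. It is also closed: if such points
come close to \<open>(x, t)\<close>, then there are times near \<open>t\<close> around which the local profile at \<open>(x, t)\<close>
equals \<open>G\<close>, so that there is a contact of first order.\<close>

lemma matches_everywhere:
  assumes conn: "connected M" and max: "maximal_solution k J G P" and k: "k = real CARD('n) - 1"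
    and start: "q0 \<in> M" "\<exists>\<rho>>0. matches_near J G q0 \<rho>" and q: "q \<in> M"
  shows "\<exists>\<rho>>0. matches_near J G q \<rho>"
proof -
  have k0: "k \<ge> 0" using card k by simp
  note sol' = max[unfolded maximal_solution_def, THEN conjunct1]
  define W where "W = {q \<in> M. \<exists>\<rho>>0. matches_near J G q \<rho>}"
  have "openin (top_of_set M) W"
    unfolding openin_contains_ball
  proof (intro conjI ballI)
    show "W \<subseteq> M" by (auto simp: W_def)
    fix a assume "a \<in> W"
    then obtain \<rho> where \<rho>: "\<rho> > 0" "matches_near J G a \<rho>" by (auto simp: W_def)
    have "b \<in> W" if b: "b \<in> ball a (\<rho> / 2)" "b \<in> M" for b
    proof -
      have "dist b a < \<rho> / 2" using b by (simp add: dist_commute)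
      note db = dist_bounds[OF this]
      have "matches_near J G b (\<rho> / 2)"
        unfolding matches_near_def
      proof (intro allI impI)
        fix y :: "real^'n" and \<tau> assume y: "\<bar>\<tau> - snd b\<bar> < \<rho> / 2" "\<bar>norm y - norm (fst b)\<bar> < \<rho> / 2"
        have "\<bar>\<tau> - snd a\<bar> < \<rho>" "\<bar>norm y - norm (fst a)\<bar> < \<rho>" using y db(1,2) by linarith+
        thus "(y, \<tau>) \<in> M \<longleftrightarrow> \<tau> \<in> J \<and> norm y = G \<tau>"
          using \<rho>(2) unfolding matches_near_def by blast
      qed
      thus ?thesis using b(2) \<rho>(1) unfolding W_def by (intro CollectI conjI exI[of _ "\<rho> / 2"]) simp_all
    qed
    thus "\<exists>e>0. ball a e \<inter> M \<subseteq> W" using \<rho>(1) by (intro exI[of _ "\<rho> / 2"]) auto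
  qed
  moreover have "openin (top_of_set M) (M - W)"
    unfolding openin_contains_ball
  proof (intro conjI ballI)
    show "M - W \<subseteq> M" by blast
    fix a assume a: "a \<in> M - W"
    obtain x t where xt: "a = (x, t)" by (cases a)
    have xM: "(x, t) \<in> M" using a xt by simp
    show "\<exists>e>0. ball a e \<inter> M \<subseteq> M - W"
    proof (rule local_profile[OF xM])
      fix g p :: "real \<Rightarrow> real" and r :: real
      assume r: "r > 0" and "g t = norm x"
        and sol: "profile_solution (real CARD('n) - 1) {t - r<..<t + r} g p"
        and M: "\<And>y \<tau>. \<bar>\<tau> - t\<bar> < r \<Longrightarrow> \<bar>norm y - norm x\<bar> < r \<Longrightarrow> (y, \<tau>) \<in> M \<longleftrightarrow> norm y = g \<tau>"
        and M': "\<And>y \<tau>. \<bar>\<tau> - t\<bar> < r \<Longrightarrow> norm y = g \<tau> \<Longrightarrow> (y, \<tau>) \<in> M"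
      note sol = sol[folded k]
      obtain d where d: "d > 0" "d \<le> r"
        and trans: "\<And>t'. \<bar>t' - t\<bar> < d \<Longrightarrow> t' \<in> J \<Longrightarrow> g t' = G t' \<Longrightarrow> p t' = P t' \<Longrightarrow> \<exists>\<rho>>0. matches_near J G (x, t) \<rho>"
        using matches_near_if_tangent[OF max k0 sol r M] by metis
      have "b \<notin> W" if b: "b \<in> ball a d" for b
      proof
        assume "b \<in> W"
        then obtain \<rho> where \<rho>: "\<rho> > 0" "matches_near J G b \<rho>" and bM: "b \<in> M" by (auto simp: W_def)
        obtain y s where ys: "b = (y, s)" by (cases b)
        have "dist b a < d" using b by (simp add: dist_commute)
        note db = dist_bounds[OF this, unfolded xt ys fst_conv snd_conv]
        have sr: "\<bar>s - t\<bar> < r" using db(1) d(2) by simp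
        have gs: "norm y = g s" using M[of s y] db bM ys d(2) by simp
        have sJ: "s \<in> J" and Gs: "norm y = G s"
          using \<rho> bM unfolding matches_near_def ys by auto
        have sI: "s \<in> {t - r<..<t + r}" using sr by (simp add: abs_less_iff)
        have dgs: "(g has_real_derivative p s) (at s)" by (rule profile_solutionD(5)[OF sol sI])
        have "eventually (\<lambda>\<tau>. dist (g \<tau>) (g s) < \<rho>) (at s)"
          using DERIV_isCont[OF dgs] \<rho>(1) unfolding isCont_def by (intro tendstoD) auto
        hence "eventually (\<lambda>\<tau>. dist (g \<tau>) (g s) < \<rho>) (nhds s)" using \<rho>(1) by (simp add: eventually_nhds_conv_at)
        moreover have "eventually (\<lambda>\<tau>. \<tau> \<in> {t - r<..<t + r}) (nhds s)"
          using sI by (intro eventually_nhds_in_open) auto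
        moreover have "eventually (\<lambda>\<tau>. \<tau> \<in> ball s \<rho>) (nhds s)"
          using \<rho>(1) by (intro eventually_nhds_in_open) auto
        ultimately have ev: "eventually (\<lambda>\<tau>. g \<tau> = G \<tau>) (nhds s)"
        proof eventually_elim
          case (elim \<tau>)
          have "g \<tau> > 0" by (rule profile_solutionD(3)[OF sol elim(2)])
          then obtain z :: "real^'n" where z: "norm z = g \<tau>" using vector_choose_size less_imp_le by metis
          have "\<bar>\<tau> - t\<bar> < r" using elim(2) by (simp add: abs_less_iff)
          hence "(z, \<tau>) \<in> M" by (rule M'[OF _ z])
          moreover have "\<bar>\<tau> - s\<bar> < \<rho>" "\<bar>norm z - norm y\<bar> < \<rho>"
            using elim(1,3) z gs by (simp_all add: dist_real_def abs_minus_commute)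
          ultimately have "norm z = G \<tau>" using \<rho>(2) unfolding matches_near_def ys by simp
          thus ?case using z by simp
        qed
        have "(G has_real_derivative p s) (at s)"
          using DERIV_cong_ev[OF refl ev refl] dgs by blast
        hence "p s = P s" using profile_solutionD(5)[OF sol' sJ] by (rule DERIV_unique)
        hence "\<exists>\<rho>>0. matches_near J G (x, t) \<rho>" using trans[OF db(1) sJ] gs Gs by simp
        thus False using a xM xt by (simp add: W_def)
      qed
      thus "\<exists>e>0. ball a e \<inter> M \<subseteq> M - W" using d(1) by (intro exI[of _ d]) auto
    qed
  qed
  ultimately have "W = {} \<or> M - W = {}"
  proof -
    assume o: "openin (top_of_set M) W" "openin (top_of_set M) (M - W)"
    have "closedin (top_of_set M) W"
      using o(2) by (auto simp: closedin_def W_def)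
    hence "W = {} \<or> W = M" using conn o(1) unfolding connected_clopen by blast
    thus ?thesis by blast
  qed
  moreover have "q0 \<in> W" using start by (simp add: W_def)
  ultimately have "q \<in> W" using q by blast
  thus ?thesis by (simp add: W_def)
qed

end

theorem theorem5p1:
  fixes M :: "('n::finite) minkowski set"
  assumes "CARD('n) \<ge> 2"
    and "connected M"
    and "translating_soliton M"
    and "timelike M"
    and "SO_invariant M"
  shows "\<exists>\<Phi> S. lor_isometry \<Phi> \<and>
           (ogival_paraboloid S \<or> timelike_calyx S \<or> spindle S) \<and>
           openin (top_of_set S) (\<Phi> ` M)"
proof -
  interpret rotational_soliton M by unfold_locales (use assms in auto)
  define k where "k = real CARD('n) - 1"
  have k: "k > 0" using assms(1) by (simp add: k_def)
  have "\<exists>S :: 'n minkowski set. (ogival_paraboloid S \<or> timelike_calyx S \<or> spindle S) \<and> openin (top_of_set S) M"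
  proof (cases "M = {}")
    case True
    show ?thesis
    proof (rule exists_example[where k = k and ?g0.0 = 1 and ?p0.0 = 0 and ?t0.0 = 0 and 'n = 'n])
      fix S :: "'n minkowski set"
      assume "ogival_paraboloid S \<or> timelike_calyx S \<or> spindle S"
      thus ?thesis using True by (intro exI[of _ S]) simp
    qed (use k k_def in auto)
  next
    case False
    then obtain x0 t0 where M0: "(x0, t0) \<in> M" by auto
    show ?thesis
    proof (rule local_profile[OF M0])
      fix g p :: "real \<Rightarrow> real" and r :: real
      assume r: "r > 0" and "g t0 = norm x0"
        and sol: "profile_solution (real CARD('n) - 1) {t0 - r<..<t0 + r} g p"
        and M: "\<And>y \<tau>. \<bar>\<tau> - t0\<bar> < r \<Longrightarrow> \<bar>norm y - norm x0\<bar> < r \<Longrightarrow> (y, \<tau>) \<in> M \<longleftrightarrow> norm y = g \<tau>"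
      note sol = sol[folded k_def]
      have t0: "t0 \<in> {t0 - r<..<t0 + r}" using r by simp
      show ?thesis
      proof (rule exists_example[OF k_def k profile_solutionD(3)[OF sol t0] profile_solutionD(4)[OF sol t0], where ?t0.0 = t0])
        fix J G P and S :: "'n minkowski set"
        assume max: "maximal_solution k J G P" and J: "t0 \<in> J" "G t0 = g t0" "P t0 = p t0"
          and ex: "ogival_paraboloid S \<or> timelike_calyx S \<or> spindle S"
          and S: "\<And>x t. x \<noteq> 0 \<Longrightarrow> (x, t) \<in> S \<longleftrightarrow> t \<in> J \<and> norm x = G t"
        obtain d where d: "d > 0"
          "\<And>t'. \<bar>t' - t0\<bar> < d \<Longrightarrow> t' \<in> J \<Longrightarrow> g t' = G t' \<Longrightarrow> p t' = P t' \<Longrightarrow> \<exists>\<rho>>0. matches_near J G (x0, t0) \<rho>"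
          using matches_near_if_tangent[OF max less_imp_le[OF k] sol r M] by metis
        have "\<exists>\<rho>>0. matches_near J G (x0, t0) \<rho>" using d(2)[of t0] d(1) J by simp
        note match = matches_everywhere[OF assms(2) max k_def M0 this]
        have "openin (top_of_set S) M"
          unfolding openin_contains_ball
        proof (intro conjI ballI subsetI)
          fix q assume q: "q \<in> M"
          obtain \<rho> where \<rho>: "\<rho> > 0" "matches_near J G q \<rho>" using match[OF q] by blast
          have "snd q \<in> J \<and> norm (fst q) = G (snd q)"
            using \<rho>(2)[unfolded matches_near_def, rule_format, of "snd q" "fst q"] \<rho>(1) q by simp
          moreover have "fst q \<noteq> 0" using avoids_axis[of "snd q"] q by (metis prod.collapse)
          ultimately show "q \<in> S" using S[of "fst q" "snd q"] by simp
        next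
          fix q assume q: "q \<in> M"
          obtain \<rho> where \<rho>: "\<rho> > 0" "matches_near J G q \<rho>" using match[OF q] by blast
          have q0: "fst q \<noteq> 0" using avoids_axis[of "snd q"] q by (metis prod.collapse)
          define e where "e = min \<rho> (norm (fst q))"
          have "b \<in> M" if b: "b \<in> ball q e" "b \<in> S" for b
          proof -
            have "dist b q < e" using b by (simp add: dist_commute)
            note db = dist_bounds[OF this]
            have "fst b \<noteq> 0" using db(3) by (auto simp: e_def)
            hence "snd b \<in> J \<and> norm (fst b) = G (snd b)" using S[of "fst b" "snd b"] b(2) by simp
            moreover have "\<bar>snd b - snd q\<bar> < \<rho>" "\<bar>norm (fst b) - norm (fst q)\<bar> < \<rho>"
              using db(1,2) by (auto simp: e_def)
            ultimately have "(fst b, snd b) \<in> M" using \<rho>(2) unfolding matches_near_def by blast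
            thus ?thesis by simp
          qed
          moreover have "e > 0" using \<rho>(1) q0 by (simp add: e_def)
          ultimately show "\<exists>e>0. ball q e \<inter> S \<subseteq> M" by blast
        qed
        with ex show ?thesis by blast
      qed
    qed
  qed
  then obtain S :: "'n minkowski set" where S: "ogival_paraboloid S \<or> timelike_calyx S \<or> spindle S" "openin (top_of_set S) M"
    by blast
  show ?thesis
    by (intro exI[of _ "\<lambda>p. p"] exI[of _ S] conjI lor_isometry_id S(1)) (use S(2) in simp)
qed

end
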